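(* Let $\tau\in\mathbb{R}$, let $\ell\ge 1$ be such that $\lambda_1\le\dots\le\lambda_\ell<\lambda_\infty$, and let $Q_\ell$ be the spectral projection for $A$ onto $\mathrm{span}\{u_1,\dots,u_\ell\}$. Suppose that the trial vectors $\{w_i\}_{i=1}^\infty\subset\mathcal{H}_\tau$ are complete in $\mathcal{H}_\tau$. Then for all sufficiently large $n$ and each $j=1,\dots,\ell$, $$0\le \Lambda_j^{(n,\tau)}-\lambda_j\le \Lambda_\ell^{(n,\tau)}\left(\|(I-P_{n,\tau})Q_\ell\|_{\tau-1/2}^2+2\lambda_\ell\Big(\sum_{i=1}^{\ell}\lambda_i^{-1}\Big)\|(I-P_{n,\tau})Q_\ell\|_\tau^2\right),$$ where $\|\cdot\|_\tau$ and $\|\cdot\|_{\tau-1/2}$ applied to operators denote the norms of bounded operators in $\mathcal{H}_\tau$ and $\mathcal{H}_{\tau-1/2}$ respectively. Furthermore, for every $\kappa$ with $0<\kappa<1$, for all sufficiently large $n$ (depending on $\kappa$) and each $j=1,\dots,\ell$, there exists an eigenvector $u_{j,n}$ of $A$ in the $\lambda_j$-eigenspace, normalized in $\mathcal{H}_{\tau-1/2}$ (i.e. $\|u_{j,n}\|_{\tau-1/2}=1$), such that $$\|u_{j,n}-u_j^{(n,\tau)}\|_\tau^2\le 4\lambda_j\Big(1+\frac{\lambda_j}{\kappa\delta}\Big)^2\|(I-P_{n,\tau})Q\|_{\tau-1/2}^2+\Lambda_j^{(n,\tau)}-\lambda_j$$ and $$\|u_{j,n}-u_j^{(n,\tau)}\|_{\tau-1/2}\le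 2\Big(1+\frac{\lambda_\ell}{\kappa\delta}\Big)\|(I-P_{n,\tau})Q\|_{\tau-1/2},$$ where $Q$ is the spectral projection of $A$ onto the $\lambda_j$-eigenspace, $\delta=\mathrm{dist}(\{\lambda_j\},\sigma(A)\setminus\{\lambda_j\})$, and $\sigma(A)$ is the spectrum of $A$.
   Context: $\mathcal{H}$ is a separable complex Hilbert space with inner product $\langle\cdot,\cdot\rangle$ and norm $\|\cdot\|$. $A$ is a selfadjoint operator in $\mathcal{H}$ that is positive definite ($\langle Au,u\rangle\ge\alpha\|u\|^2$ for $u\in\mathcal{D}(A)$, some $\alpha>0$), and the lower part of its spectrum consists of isolated eigenvalues of finite multiplicity $0<\alpha\le\lambda_1\le\lambda_2\le\dots\le\lambda_\infty$ (counted with multiplicity), with corresponding orthonormal eigenvectors $u_1,u_2,\dots$; $\lambda_\infty$ is the least point of the essential spectrum of $A$ ($\lambda_\infty=\infty$ if $A^{-1}$ is compact). $T=A^{-1}$. For real $\tau$, $A^\tau$ is defined by the spectral theorem. $\mathcal{H}_\tau=\mathcal{D}(A^\tau)$ is the Hilbert space with inner product $\langle u,v\rangle_\tau=\langle A^\tau u,A^\tau v\rangle$ and norm $\|u\|_\tau=\|A^\tau u\|$; for $\tau<0$, $\mathcal{H}_\tau$ means the completion of $\mathcal{H}$ in the norm $\|A^\tau u\|$. $T$ (restricted or extended) is bounded and selfadjoint in every $\mathcal{H}_\tau$ with the same eigenvalues and eigenvectors; likewise spectral projections of $A$ onto spans of finitely many eigenvectors act in every $\mathcal{H}_\tau$.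 Rayleigh–Ritz method in $\mathcal{H}_\tau$: given linearly independent trial vectors $\{w_i\}_{i=1}^\infty\subset\mathcal{H}_\tau$, $P_{n,\tau}$ is the orthogonal projection in $\mathcal{H}_\tau$ onto $\mathrm{span}\{w_1,\dots,w_n\}$. $\Lambda_1^{(n,\tau)}\le\dots\le\Lambda_n^{(n,\tau)}$ are the eigenvalues of the generalized matrix eigenvalue problem $[\langle w_i,w_j\rangle_\tau]_{i,j=1}^n\mathbf{x}=\Lambda[\langle Tw_i,w_j\rangle_\tau]_{i,j=1}^n\mathbf{x}$, and $u_1^{(n,\tau)},\dots,u_n^{(n,\tau)}\in\mathrm{span}\{w_1,\dots,w_n\}$ are the corresponding eigenvectors, normalized so that $\langle u_i^{(n,\tau)},u_j^{(n,\tau)}\rangle_{\tau-1/2}=\delta_{ij}$ and $\langle u_i^{(n,\tau)},u_j^{(n,\tau)}\rangle_\tau=\Lambda_i^{(n,\tau)}\delta_{ij}$. Complete in $\mathcal{H}_\tau$ means that the linear span of $\{w_i\}$ is dense in $\mathcal{H}_\tau$. *)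

theory Defs
  imports "HOL-Analysis.Analysis"
begin

class complex_vector = real_vector +
  fixes scaleC :: "complex \<Rightarrow> 'a \<Rightarrow> 'a" (infixr "*\<^sub>C" 75)
  assumes scaleC_add_right: "c *\<^sub>C (x + y) = c *\<^sub>C x + c *\<^sub>C y"
    and scaleC_add_left: "(c + d) *\<^sub>C x = c *\<^sub>C x + d *\<^sub>C x"
    and scaleC_scaleC: "c *\<^sub>C (d *\<^sub>C x) = (c * d) *\<^sub>C x"
    and scaleC_of_real: "complex_of_real r *\<^sub>C x = r *\<^sub>R x"

text \<open>The inner product is linear in its second and antilinear in its first argument. With this
  convention the column vector \<open>x\<close> in the matrix problem
  \<open>(\<langle>w_i, w_j\<rangle>)_{i,j} x = \<Lambda> (\<langle>T w_i, w_j\<rangle>)_{i,j} x\<close> is the coefficient vector of the Ritz vector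
  \<open>\<Sum>j. x_j w_j\<close>; with the opposite convention it would be its complex conjugate.\<close>

class complex_inner = complex_vector + real_normed_vector +
  fixes cinner :: "'a \<Rightarrow> 'a \<Rightarrow> complex"
  assumes cinner_commute: "cinner x y = cnj (cinner y x)"
    and cinner_add_right: "cinner x (y + z) = cinner x y + cinner x z"
    and cinner_scaleC_right: "cinner x (c *\<^sub>C y) = c * cinner x y"
    and cinner_self: "cinner x x = complex_of_real ((norm x)\<^sup>2)"

class complex_hilbert = complex_inner + complete_space

definition separable :: "'a::topological_space itself \<Rightarrow> bool" where
  "separable _ \<longleftrightarrow> (\<exists>D::'a set. countable D \<and> closure D = UNIV)"

definition clinear :: "('a::complex_vector \<Rightarrow> 'b::complex_vector) \<Rightarrow> bool" where
  "clinear S \<longleftrightarrow> (\<forall>c x y. S (c *\<^sub>C x + y) = c *\<^sub>C S x + S y)"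

abbreviation cspan :: "'a::complex_vector set \<Rightarrow> 'a set" where
  "cspan \<equiv> module.span scaleC"

abbreviation cdependent :: "'a::complex_vector set \<Rightarrow> bool" where
  "cdependent \<equiv> module.dependent scaleC"

definition orth_proj :: "'a::complex_inner set \<Rightarrow> 'a \<Rightarrow> 'a" where
  "orth_proj V x = (THE y. y \<in> V \<and> (\<forall>z\<in>V. cinner z (x - y) = 0))"

text \<open>An unbounded operator is represented by its graph: \<open>(u, v) \<in> A\<close> means \<open>u \<in> \<D>(A)\<close> and
  \<open>A u = v\<close>, so that \<open>Domain A\<close> is \<open>\<D>(A)\<close> and \<open>A\<inverse>\<close> (converse) is the inverse operator.\<close>

type_synonym 'a operator = "('a \<times> 'a) set"

definition linear_operator :: "'a::complex_vector operator \<Rightarrow> bool" where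
  "linear_operator A \<longleftrightarrow> single_valued A \<and> (0, 0) \<in> A \<and>
     (\<forall>c. \<forall>(x, y)\<in>A. \<forall>(x', y')\<in>A. (c *\<^sub>C x + x', c *\<^sub>C y + y') \<in> A)"

definition op_adjoint :: "'a::complex_inner operator \<Rightarrow> 'a operator" where
  "op_adjoint A = {(v, w). \<forall>(x, y)\<in>A. cinner v y = cinner w x}"

definition selfadjoint :: "'a::complex_inner operator \<Rightarrow> bool" where
  "selfadjoint A \<longleftrightarrow> linear_operator A \<and> closure (Domain A) = UNIV \<and> op_adjoint A = A"

definition positive_definite :: "'a::complex_inner operator \<Rightarrow> bool" where
  "positive_definite A \<longleftrightarrow> (\<exists>\<alpha>>0. \<forall>(x, y)\<in>A. Re (cinner y x) \<ge> \<alpha> * (norm x)\<^sup>2)"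

definition inverse_op :: "'a operator \<Rightarrow> 'a \<Rightarrow> 'a" where
  "inverse_op A u = (THE v. (u, v) \<in> A\<inverse>)"

text \<open>\<open>z\<close> is in the resolvent set iff \<open>(A - z)\<inverse>\<close> is (the graph of) an everywhere defined bounded
  operator \<open>R\<close>.\<close>

definition resolvent_set :: "'a::complex_inner operator \<Rightarrow> complex set" where
  "resolvent_set A =
     {z. \<exists>R. bounded_linear R \<and> {(x, y - z *\<^sub>C x) |x y. (x, y) \<in> A}\<inverse> = {(g, R g) |g. True}}"

definition spectrum :: "'a::complex_inner operator \<Rightarrow> complex set" where
  "spectrum A = - resolvent_set A"

definition eigenspace :: "'a::complex_inner operator \<Rightarrow> complex \<Rightarrow> 'a set" where
  "eigenspace A z = {x. (x, z *\<^sub>C x) \<in> A}"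

definition discrete_spectrum :: "'a::complex_inner operator \<Rightarrow> complex set" where
  "discrete_spectrum A = {z. z isolated_in spectrum A \<and> eigenspace A z \<noteq> {0} \<and>
     (\<exists>B. finite B \<and> eigenspace A z = cspan B)}"

definition essential_spectrum :: "'a::complex_inner operator \<Rightarrow> complex set" where
  "essential_spectrum A = spectrum A - discrete_spectrum A"

text \<open>The least point \<open>\<lambda>\<^sub>\<infinity>\<close> of the essential spectrum of a selfadjoint operator (which is real and
  closed); it is \<open>\<infinity>\<close> if the essential spectrum is empty, that is, if \<open>A\<inverse>\<close> is compact.\<close>

definition lambda_inf :: "'a::complex_inner operator \<Rightarrow> ereal" where
  "lambda_inf A = (INF z\<in>essential_spectrum A. ereal (Re z))"

text \<open>\<open>lam 1 \<le> lam 2 \<le> \<dots>\<close> is the enumeration of all eigenvalues below \<open>\<lambda>\<^sub>\<infinity>\<close>, counted with multiplicity,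
  and \<open>u 1, u 2, \<dots>\<close> are corresponding orthonormal eigenvectors. There are \<open>N\<close> of them, where
  \<open>N = \<infinity>\<close> is allowed.\<close>

definition lower_eigenpairs ::
  "'a::complex_inner operator \<Rightarrow> enat \<Rightarrow> (nat \<Rightarrow> real) \<Rightarrow> (nat \<Rightarrow> 'a) \<Rightarrow> bool" where
  "lower_eigenpairs A N lam u \<longleftrightarrow> (let I = {i. 1 \<le> i \<and> enat i \<le> N} in
     mono_on I lam \<and>
     (\<forall>i\<in>I. u i \<in> eigenspace A (complex_of_real (lam i)) \<and> ereal (lam i) < lambda_inf A) \<and>
     (\<forall>i\<in>I. \<forall>j\<in>I. cinner (u i) (u j) = (if i = j then 1 else 0)) \<and>
     (\<forall>\<mu>. ereal \<mu> < lambda_inf A \<longrightarrow>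
        eigenspace A (complex_of_real \<mu>) = cspan {u i |i. i \<in> I \<and> lam i = \<mu>}))"

definition projection_valued_measure :: "(real set \<Rightarrow> 'a::complex_inner \<Rightarrow> 'a) \<Rightarrow> bool" where
  "projection_valued_measure E \<longleftrightarrow>
     (\<forall>S\<in>sets borel. clinear (E S) \<and> E S \<circ> E S = E S \<and>
        (\<forall>x y. cinner (E S x) y = cinner x (E S y))) \<and>
     E UNIV = id \<and>
     (\<forall>S\<in>sets borel. \<forall>S'\<in>sets borel. E (S \<inter> S') = E S \<circ> E S') \<and>
     (\<forall>F :: nat \<Rightarrow> real set. range F \<subseteq> sets borel \<longrightarrow> disjoint_family F \<longrightarrow>
        (\<forall>x. (\<lambda>n. E (F n) x) sums E (\<Union>n. F n) x))"

text \<open>The measure \<open>S \<mapsto> \<langle>E S x, x\<rangle>\<close>.\<close>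

definition scalar_measure :: "(real set \<Rightarrow> 'a::complex_inner \<Rightarrow> 'a) \<Rightarrow> 'a \<Rightarrow> real measure" where
  "scalar_measure E x = measure_of UNIV (sets borel) (\<lambda>S. ennreal ((norm (E S x))\<^sup>2))"

text \<open>The operator \<open>\<integral> f dE\<close> for real \<open>f\<close>. Its domain consists of the \<open>x\<close> with
  \<open>\<integral> f\<^sup>2 d\<langle>E x, x\<rangle> < \<infinity>\<close>, and its value at \<open>x\<close> is the vector \<open>y\<close> with \<open>\<langle>z, y\<rangle> = \<integral> f d\<langle>z, E x\<rangle>\<close> for
  all \<open>z\<close> in this (dense) domain. The integral against the complex measure \<open>S \<mapsto> \<langle>z, E S x\<rangle>\<close> is
  written out by the polarization identity
  \<open>\<langle>z, E S x\<rangle> = 1/4 (\<Sum>k<4. \<i>^k \<langle>E S (x + \<i>^k z), x + \<i>^k z\<rangle>)\<close>.\<close>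

definition spectral_integral_domain ::
  "(real set \<Rightarrow> 'a::complex_inner \<Rightarrow> 'a) \<Rightarrow> (real \<Rightarrow> real) \<Rightarrow> 'a set" where
  "spectral_integral_domain E f = {x. integrable (scalar_measure E x) (\<lambda>t. (f t)\<^sup>2)}"

definition spectral_integral ::
  "(real set \<Rightarrow> 'a::complex_inner \<Rightarrow> 'a) \<Rightarrow> (real \<Rightarrow> real) \<Rightarrow> 'a operator" where
  "spectral_integral E f = {(x, y). x \<in> spectral_integral_domain E f \<and>
     (\<forall>z \<in> spectral_integral_domain E f. cinner z y =
        (\<Sum>k<4::nat. \<i> ^ k * complex_of_real (\<integral>t. f t \<partial>(scalar_measure E (x + \<i> ^ k *\<^sub>C z)))) / 4)}"

definition spectral_measure_of ::
  "'a::complex_inner operator \<Rightarrow> (real set \<Rightarrow> 'a \<Rightarrow> 'a) \<Rightarrow> bool" where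
  "spectral_measure_of A E \<longleftrightarrow>
     projection_valued_measure E \<and> spectral_integral E (\<lambda>t. t) = A"

text \<open>\<open>A\<^sup>\<tau> = \<integral> t\<^sup>\<tau> dE(t)\<close> for a positive definite \<open>A\<close>. By the spectral theorem \<open>E\<close> exists and is
  unique on the Borel sets; it vanishes on \<open>{t. t \<le> 0}\<close>, so the values of \<open>powr\<close> there do not
  matter.\<close>

definition op_power :: "'a::complex_inner operator \<Rightarrow> real \<Rightarrow> 'a operator" where
  "op_power A \<tau> =
     {(x, y). \<exists>E. spectral_measure_of A E \<and> (x, y) \<in> spectral_integral E (\<lambda>t. t powr \<tau>)}"

text \<open>\<open>is_scale_space A \<tau> \<iota>\<close>: the Hilbert space \<open>'k\<close> is \<open>H\<^sub>\<tau>\<close>, a vector \<open>u \<in> \<D>(A\<^sup>\<tau>)\<close> being identified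
  with \<open>\<iota> u\<close>. For \<open>\<tau> \<ge> 0\<close> the space consists of these vectors only; for \<open>\<tau> < 0\<close>, where \<open>\<D>(A\<^sup>\<tau>)\<close>
  is the whole space, it is the completion, which is determined up to a unitary map compatible
  with \<open>\<iota>\<close>. Values of \<open>\<iota>\<close> outside \<open>\<D>(A\<^sup>\<tau>)\<close> are irrelevant.\<close>

definition is_scale_space ::
  "'h::complex_hilbert operator \<Rightarrow> real \<Rightarrow> ('h \<Rightarrow> 'k::complex_hilbert) \<Rightarrow> bool" where
  "is_scale_space A \<tau> \<iota> \<longleftrightarrow>
     (\<forall>c. \<forall>u \<in> Domain (op_power A \<tau>). \<forall>v \<in> Domain (op_power A \<tau>).
        \<iota> (c *\<^sub>C u + v) = c *\<^sub>C \<iota> u + \<iota> v) \<and>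
     (\<forall>(u, u') \<in> op_power A \<tau>. \<forall>(v, v') \<in> op_power A \<tau>. cinner (\<iota> u) (\<iota> v) = cinner u' v') \<and>
     (if \<tau> \<ge> 0 then \<iota> ` Domain (op_power A \<tau>) = UNIV
      else closure (\<iota> ` Domain (op_power A \<tau>)) = UNIV)"

text \<open>The bounded operator \<open>S\<close> on \<open>H\<^sub>\<tau>\<close> (realized by \<open>\<iota>\<close>) that restricts to \<open>B\<close> on the dense subspace
  \<open>\<D>(A\<^sup>\<tau>)\<close>.\<close>

definition extend_op ::
  "'h::complex_hilbert operator \<Rightarrow> real \<Rightarrow> ('h \<Rightarrow> 'k::complex_hilbert) \<Rightarrow>
   ('h \<Rightarrow> 'm::complex_hilbert) \<Rightarrow> 'k \<Rightarrow> 'm" where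
  "extend_op A \<tau> \<iota> B =
     (THE S. bounded_linear S \<and> clinear S \<and> (\<forall>u \<in> Domain (op_power A \<tau>). S (\<iota> u) = B u))"

text \<open>The inclusion of \<open>H\<^sub>\<tau>\<close> (realized by \<open>\<iota>\<close>) into the larger space \<open>H\<^sub>\<sigma>\<close> (realized by \<open>\<iota>'\<close>),
  \<open>\<sigma> \<le> \<tau>\<close>.\<close>

definition inclusion ::
  "'h::complex_hilbert operator \<Rightarrow> real \<Rightarrow> ('h \<Rightarrow> 'k::complex_hilbert) \<Rightarrow>
   ('h \<Rightarrow> 'm::complex_hilbert) \<Rightarrow> 'k \<Rightarrow> 'm" where
  "inclusion A \<tau> \<iota> \<iota>' = extend_op A \<tau> \<iota> \<iota>'"

text \<open>\<open>T = A\<inverse>\<close>, restricted or extended to \<open>H\<^sub>\<tau>\<close>.\<close>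

definition T_op ::
  "'h::complex_hilbert operator \<Rightarrow> real \<Rightarrow> ('h \<Rightarrow> 'k::complex_hilbert) \<Rightarrow> 'k \<Rightarrow> 'k" where
  "T_op A \<tau> \<iota> = extend_op A \<tau> \<iota> (\<lambda>u. \<iota> (inverse_op A u))"

text \<open>For a projection \<open>Q\<close> of the base space onto a finite-dimensional span \<open>V\<close> of eigenvectors, and
  \<open>P\<close> an operator on \<open>H\<^sub>\<tau>\<close> (realized by \<open>\<iota>\<close>): the operator \<open>(I - P) Q\<close> in \<open>H\<^sub>\<tau>\<close>, and the
  operator \<open>(I - P) Q\<close> in \<open>H\<^sub>\<sigma>\<close> (realized by \<open>\<iota>'\<close>), \<open>\<sigma> \<le> \<tau>\<close>. In the latter \<open>Q\<close> is extended to a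
  map from \<open>H\<^sub>\<sigma>\<close> into \<open>V \<subseteq> H\<^sub>\<tau>\<close>, \<open>I - P\<close> is applied in \<open>H\<^sub>\<tau>\<close>, and the result is regarded as an element
  of \<open>H\<^sub>\<sigma>\<close>.\<close>

definition defect ::
  "'h::complex_hilbert operator \<Rightarrow> real \<Rightarrow> ('h \<Rightarrow> 'k::complex_hilbert) \<Rightarrow>
   ('k \<Rightarrow> 'k) \<Rightarrow> ('h \<Rightarrow> 'h) \<Rightarrow> 'k \<Rightarrow> 'k" where
  "defect A \<tau> \<iota> P Q = extend_op A \<tau> \<iota> (\<lambda>u. \<iota> (Q u) - P (\<iota> (Q u)))"

definition defect_lower ::
  "'h::complex_hilbert operator \<Rightarrow> real \<Rightarrow> ('h \<Rightarrow> 'k::complex_hilbert) \<Rightarrow>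
   real \<Rightarrow> ('h \<Rightarrow> 'm::complex_hilbert) \<Rightarrow> ('k \<Rightarrow> 'k) \<Rightarrow> ('h \<Rightarrow> 'h) \<Rightarrow> 'm \<Rightarrow> 'm" where
  "defect_lower A \<tau> \<iota> \<sigma> \<iota>' P Q =
     extend_op A \<sigma> \<iota>' (\<lambda>u. inclusion A \<tau> \<iota> \<iota>' (\<iota> (Q u) - P (\<iota> (Q u))))"

definition trial_vectors :: "(nat \<Rightarrow> 'k::complex_vector) \<Rightarrow> bool" where
  "trial_vectors w \<longleftrightarrow> inj_on w {1..} \<and> \<not> cdependent (w ` {1..})"

definition complete_trial_vectors :: "(nat \<Rightarrow> 'k::complex_inner) \<Rightarrow> bool" where
  "complete_trial_vectors w \<longleftrightarrow> closure (cspan (w ` {1..})) = UNIV"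

definition ritz_projection :: "(nat \<Rightarrow> 'k::complex_inner) \<Rightarrow> nat \<Rightarrow> 'k \<Rightarrow> 'k" where
  "ritz_projection w n = orth_proj (cspan (w ` {1..n}))"

text \<open>\<open>T\<close> is the operator \<open>A\<inverse>\<close> in \<open>H\<^sub>\<tau>\<close>, and \<open>J\<close> the inclusion of \<open>H\<^sub>\<tau>\<close> into the space with index \<open>\<tau> - 1/2\<close>. As
  the \<open>n\<close> vectors \<open>U 1, \<dots>, U n\<close> are linearly independent by the normalization, the numbers
  \<open>\<Lambda> 1 \<le> \<dots> \<le> \<Lambda> n\<close> are all eigenvalues of the \<open>n \<times> n\<close> matrix problem, counted with multiplicity.\<close>

definition ritz_pairs ::
  "('k::complex_inner \<Rightarrow> 'k) \<Rightarrow> ('k \<Rightarrow> 'm::complex_inner) \<Rightarrow> (nat \<Rightarrow> 'k) \<Rightarrow> nat \<Rightarrow>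
   (nat \<Rightarrow> real) \<Rightarrow> (nat \<Rightarrow> 'k) \<Rightarrow> bool" where
  "ritz_pairs T J w n \<Lambda> U \<longleftrightarrow>
     mono_on {1..n} \<Lambda> \<and>
     (\<forall>k\<in>{1..n}. \<exists>x :: nat \<Rightarrow> complex. (\<exists>j\<in>{1..n}. x j \<noteq> 0) \<and>
        (\<forall>i\<in>{1..n}. (\<Sum>j=1..n. cinner (w i) (w j) * x j) =
           complex_of_real (\<Lambda> k) * (\<Sum>j=1..n. cinner (T (w i)) (w j) * x j)) \<and>
        U k = (\<Sum>j=1..n. x j *\<^sub>C w j)) \<and>
     (\<forall>i\<in>{1..n}. \<forall>j\<in>{1..n}.
        cinner (J (U i)) (J (U j)) = (if i = j then 1 else 0) \<and>
        cinner (U i) (U j) = (if i = j then complex_of_real (\<Lambda> i) else 0))"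

end

theory Submission
  imports Defs
begin

text \<open>The space \<open>H\<^sub>\<tau>\<close> carries the two forms \<open>a(x,y) = \<langle>x,y\<rangle>\<^bsub>\<tau>\<^esub>\<close> and \<open>b(x,y) = \<langle>x,y\<rangle>\<^bsub>\<tau>-1/2\<^esub>\<close>. By
  the functional calculus, the suitably scaled eigenvectors \<open>\<phi>\<^sub>i\<close> of \<open>A\<close>
  are \<open>b\<close>-orthonormal with \<open>a(\<phi>\<^sub>i,y) = \<lambda>\<^sub>i b(\<phi>\<^sub>i,y)\<close>. The lower bound is the min-max principle. For the
  upper bound, a dimension count gives \<open>x\<close> in the span of \<open>\<phi>\<^sub>1, \<dots>, \<phi>\<^sub>j\<close> with \<open>b(x,x) = 1\<close> and \<open>P x\<close>
  \<open>b\<close>-orthogonal to the first \<open>j - 1\<close> Ritz vectors; then \<open>\<Lambda>\<^sub>j b(Px,Px) \<le> a(Px,Px) \<le> \<lambda>\<^sub>j\<close>, and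
  \<open>b(x,x-Px) = a((I-P)Tx,(I-P)x)\<close> is of second order. For the eigenvectors, the dimension count
  gives \<open>v\<close> in the \<open>\<lambda>\<^sub>j\<close>-eigenspace such that \<open>P v\<close> has no component along the other Ritz vectors of
  the cluster of \<open>\<lambda>\<^sub>j\<close>; its components along the Ritz vectors outside the cluster are controlled by
  \<open>(\<Lambda>\<^sub>i - \<lambda>\<^sub>j) b(U\<^sub>i,Pv) = \<lambda>\<^sub>j b(U\<^sub>i,v-Pv)\<close>. The existence of the spectral measure is implicit in the
  hypothesis that the scale spaces exist, but its uniqueness has to be proved.\<close>

section \<open>Complex inner product spaces\<close>

text \<open>Two obstacles shape the proof. \<open>op_power\<close> quantifies over all spectral
  measures of \<open>A\<close>, so powers cannot be computed from one \<open>E\<close> before the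
  scalar measures are known to coincide. And for \<tau> < 0 the scale space is a completion whose
  elements need not come from the base space, so a spectral projection cannot be applied to them;
  each spectral fact is shown on the image of \<open>\<iota>\<close> and passed on by density. Two
  such facts carry the Ritz argument: the relation between a and b on an eigenvector, and \<sigma>
  b(y,y) \<le> a(y,y) for y b-orthogonal to the eigenvectors belonging to the spectrum below
  \<sigma>. The number \<kappa> pays for the Ritz values below the cluster: they approach their
  eigenvalues from above and may use up (1 - \<kappa>) \<delta> of the distance \<delta>, while
  those above the cluster never fall below \<lambda>_j + \<delta>. The outer factor 2 in the vector
  bounds comes from spending 1 + \<lambda>/(\<kappa> \<delta>) twice, on the direction of the Ritz
  vector and on its length.\<close>

interpretation complex_vs: vector_space "scaleC :: complex \<Rightarrow> 'a::complex_vector \<Rightarrow> 'a"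
proof
  fix a b :: complex and x y :: 'a
  show "1 *\<^sub>C x = x"
    using scaleC_of_real[of 1 x] by simp
qed (simp_all add: scaleC_add_left scaleC_add_right scaleC_scaleC)

lemma scaleR_scaleC: "c *\<^sub>C (r *\<^sub>R x) = r *\<^sub>R (c *\<^sub>C x)"
  by (simp add: scaleC_of_real[symmetric] scaleC_scaleC mult.commute)

lemma clinear_add: "clinear S \<Longrightarrow> S (x + y) = S x + S y"
  unfolding clinear_def by (metis complex_vs.scale_one)

lemma clinear_zero: "clinear S \<Longrightarrow> S 0 = 0"
  using clinear_add[of S 0 0] by simp

lemma clinear_scaleC: "clinear S \<Longrightarrow> S (c *\<^sub>C x) = c *\<^sub>C S x"
  using clinear_zero[of S] unfolding clinear_def by (metis add.right_neutral)

lemma clinear_scaleR: "clinear S \<Longrightarrow> S (r *\<^sub>R x) = r *\<^sub>R S x"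
  using clinear_scaleC[of S "complex_of_real r" x] by (simp add: scaleC_of_real)

lemma clinear_minus: "clinear S \<Longrightarrow> S (- x) = - S x"
  using clinear_scaleR[of S "-1" x] by simp

lemma clinear_diff: "clinear S \<Longrightarrow> S (x - y) = S x - S y"
  using clinear_add[of S x "-y"] by (simp add: clinear_minus)

lemma clinear_sum: "clinear S \<Longrightarrow> S (\<Sum>i\<in>I. f i) = (\<Sum>i\<in>I. S (f i))"
  by (induction I rule: infinite_finite_induct) (auto simp: clinear_zero clinear_add)

lemma cinner_add_left: "cinner (x + y) z = cinner x z + cinner y z"
  by (metis cinner_add_right cinner_commute complex_cnj_add)

lemma cinner_scaleC_left: "cinner (c *\<^sub>C x) z = cnj c * cinner x z"
  by (metis cinner_commute cinner_scaleC_right complex_cnj_mult)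

lemma cinner_scaleR_left: "cinner (r *\<^sub>R x) z = r *\<^sub>R cinner x z"
  by (simp add: scaleC_of_real[symmetric] cinner_scaleC_left scaleR_conv_of_real)

lemma cinner_scaleR_right: "cinner x (r *\<^sub>R z) = r *\<^sub>R cinner x z"
  by (simp add: scaleC_of_real[symmetric] cinner_scaleC_right scaleR_conv_of_real)

lemma norm_sq_cinner: "(norm x)\<^sup>2 = Re (cinner x x)"
  by (simp add: cinner_self)

lemma norm_scaleC: "norm (c *\<^sub>C x) = cmod c * norm (x::'a::complex_inner)"
proof -
  have "cinner (c *\<^sub>C x) (c *\<^sub>C x) = complex_of_real ((cmod c)\<^sup>2) * cinner x x"
    unfolding complex_norm_square cinner_scaleC_left cinner_scaleC_right by simp
  also have "\<dots> = complex_of_real ((cmod c * norm x)\<^sup>2)"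
    by (simp add: cinner_self power_mult_distrib)
  finally have "(norm (c *\<^sub>C x))\<^sup>2 = (cmod c * norm x)\<^sup>2"
    unfolding cinner_self of_real_eq_iff .
  then show ?thesis
    by (simp add: power2_eq_iff_nonneg)
qed

lemma norm_add_sq: "(norm (x + y))\<^sup>2 = (norm x)\<^sup>2 + 2 * Re (cinner x y) + (norm y)\<^sup>2"
proof -
  have "Re (cinner y x) = Re (cinner x y)"
    by (subst cinner_commute) simp
  then show ?thesis
    by (simp add: norm_sq_cinner cinner_add_left cinner_add_right)
qed

lemma cinner_zero_right [simp]: "cinner x 0 = 0"
  using cinner_add_right[of x 0 0] by simp

lemma cinner_zero_left [simp]: "cinner 0 x = 0"
  using cinner_add_left[of 0 0 x] by simp

lemma cauchy_schwarz: "cmod (cinner x y) \<le> norm x * norm (y::'a::complex_inner)"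
proof (cases "y = 0")
  case False
  define c where "c = cinner y x / (norm y)\<^sup>2"
  have y2: "(norm y)\<^sup>2 > 0" using False by simp
  have "Re (cinner (c *\<^sub>C y) x) = (cmod (cinner x y))\<^sup>2 / (norm y)\<^sup>2"
  proof -
    have "cinner (c *\<^sub>C y) x = cnj (cinner y x) * cinner y x / (norm y)\<^sup>2"
      by (simp add: c_def cinner_scaleC_left)
    also have "\<dots> = complex_of_real ((cmod (cinner y x))\<^sup>2 / (norm y)\<^sup>2)"
      by (simp only: of_real_divide complex_norm_square mult.commute)
    finally show ?thesis
      by (metis Re_complex_of_real cinner_commute complex_mod_cnj)
  qed
  moreover have "(norm (c *\<^sub>C y))\<^sup>2 = (cmod (cinner x y))\<^sup>2 / (norm y)\<^sup>2"
  proof -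
    have "cmod (cinner y x) = cmod (cinner x y)"
      by (subst cinner_commute) simp
    then show ?thesis
      using False by (simp add: norm_scaleC c_def power_mult_distrib power_divide norm_divide
          norm_power norm_mult power2_eq_square)
  qed
  moreover have "(norm (x + - (c *\<^sub>C y)))\<^sup>2
      = (norm x)\<^sup>2 - 2 * Re (cinner (c *\<^sub>C y) x) + (norm (c *\<^sub>C y))\<^sup>2"
  proof -
    have "Re (cinner x (c *\<^sub>C y)) = Re (cinner (c *\<^sub>C y) x)"
      by (subst cinner_commute) simp
    then have "Re (cinner x (- (c *\<^sub>C y))) = - Re (cinner (c *\<^sub>C y) x)"
      using cinner_scaleR_right[of x "-1" "c *\<^sub>C y"] by simp
    then show ?thesis unfolding norm_add_sq by simp
  qed
  moreover have "0 \<le> (norm (x + - (c *\<^sub>C y)))\<^sup>2" by simp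
  ultimately have "(cmod (cinner x y))\<^sup>2 / (norm y)\<^sup>2 \<le> (norm x)\<^sup>2" by linarith
  then have "(cmod (cinner x y))\<^sup>2 \<le> (norm x * norm y)\<^sup>2"
    using y2 by (simp add: pos_divide_le_eq power_mult_distrib)
  then show ?thesis
    by (rule power2_le_imp_le) simp
qed simp

lemma bounded_bilinear_cinner:
  "bounded_bilinear (cinner :: 'a::complex_inner \<Rightarrow> 'a \<Rightarrow> complex)"
proof
  show "\<exists>K. \<forall>a b::'a. norm (cinner a b) \<le> norm a * norm b * K"
    using cauchy_schwarz by (intro exI[of _ 1]) auto
qed (simp_all add: cinner_add_left cinner_add_right cinner_scaleR_left cinner_scaleR_right)

lemma bounded_bilinear_scaleC:
  "bounded_bilinear (scaleC :: complex \<Rightarrow> 'a::complex_inner \<Rightarrow> 'a)"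
proof
  show "(r *\<^sub>R a) *\<^sub>C b = r *\<^sub>R (a *\<^sub>C b)" for r a and b :: 'a
    by (simp only: scaleR_conv_of_real[of r a] scaleC_scaleC[symmetric] scaleC_of_real)
  show "\<exists>K. \<forall>a (b::'a). norm (a *\<^sub>C b) \<le> norm a * norm b * K"
    by (intro exI[of _ 1]) (auto simp: norm_scaleC)
qed (simp_all add: scaleC_add_left scaleC_add_right scaleR_scaleC)

lemmas cinner_diff_left = bounded_bilinear.diff_left[OF bounded_bilinear_cinner]
  and cinner_diff_right = bounded_bilinear.diff_right[OF bounded_bilinear_cinner]
  and cinner_minus_right = bounded_bilinear.minus_right[OF bounded_bilinear_cinner]
  and cinner_sum_left = bounded_bilinear.sum_left[OF bounded_bilinear_cinner]
  and cinner_sum_right = bounded_bilinear.sum_right[OF bounded_bilinear_cinner]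
  and tendsto_cinner = bounded_bilinear.tendsto[OF bounded_bilinear_cinner]
  and continuous_on_cinner = bounded_bilinear.continuous_on[OF bounded_bilinear_cinner]
  and tendsto_scaleC = bounded_bilinear.tendsto[OF bounded_bilinear_scaleC]
  and continuous_on_scaleC = bounded_bilinear.continuous_on[OF bounded_bilinear_scaleC]

lemma cinner_eqI: "(\<And>z. cinner z x = cinner z y) \<Longrightarrow> x = (y::'a::complex_inner)"
proof -
  assume "\<And>z. cinner z x = cinner z y"
  then have "cinner (x - y) (x - y) = 0"
    by (simp add: cinner_diff_right)
  then show "x = y"
    by (simp add: cinner_self)
qed

lemma cinner_eq_0_commute: "cinner x y = 0 \<longleftrightarrow> cinner y x = 0"
  by (metis cinner_commute complex_cnj_zero)

lemma norm_diff_sq: "(norm (x - y))\<^sup>2 = (norm x)\<^sup>2 - 2 * Re (cinner x y) + (norm y)\<^sup>2"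
  using norm_add_sq[of x "- y"] by (simp add: cinner_minus_right)

text \<open>Expanding the k-th summand gives
  \<open>\<i> ^ k * (?a + ?b) + (-1) ^ k * ?c + ?d\<close>; the powers of \<i> and of -1 each sum to
  zero over k < 4, and four copies of \<open>?d\<close> are left. This is the formula through which
  \<open>spectral_integral\<close> encodes an inner product.\<close>

lemma sesquilinear_polarization:
  assumes "clinear F"
  shows "cinner z (F x) = (\<Sum>k<4::nat. \<i> ^ k * cinner (x + \<i> ^ k *\<^sub>C z) (F (x + \<i> ^ k *\<^sub>C z))) / 4"
proof -
  let ?a = "cinner x (F x)" and ?b = "cinner z (F z)" and ?c = "cinner x (F z)" and ?d = "cinner z (F x)"
  have *: "\<i> ^ k * cinner (x + \<i> ^ k *\<^sub>C z) (F (x + \<i> ^ k *\<^sub>C z))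
      = \<i> ^ k * (?a + ?b) + (-1) ^ k * ?c + ?d" for k :: nat
  proof -
    have 1: "\<i> ^ k * cnj (\<i> ^ k) = 1"
      by (simp add: power_mult_distrib[symmetric])
    have 2: "\<i> ^ k * \<i> ^ k = (-1) ^ k"
      by (simp add: power_mult_distrib[symmetric])
    define e where "e = \<i> ^ k"
    have "cinner (x + e *\<^sub>C z) (F (x + e *\<^sub>C z)) = ?a + e * ?c + cnj e * ?d + e * cnj e * ?b"
      by (simp only: clinear_add[OF assms] clinear_scaleC[OF assms] cinner_add_left
          cinner_add_right cinner_scaleC_left cinner_scaleC_right distrib_left mult_ac add_ac)
    then have "e * cinner (x + e *\<^sub>C z) (F (x + e *\<^sub>C z))
        = e * ?a + (e * e) * ?c + (e * cnj e) * ?d + (e * cnj e) * (e * ?b)"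
      by (simp only: distrib_left mult_ac)
    then show ?thesis
      using 1 2 unfolding e_def by (simp only: distrib_left mult_1_left add_ac)
  qed
  have "(\<Sum>k<4::nat. \<i> ^ k) = 0" "(\<Sum>k<4::nat. (-1::complex) ^ k) = 0"
    by (simp_all add: lessThan_nat_numeral lessThan_Suc numeral_eq_Suc)
  then show ?thesis
    unfolding * by (simp add: sum.distrib sum_distrib_right[symmetric])
qed

text \<open>Polarization, hence special to complex scalars: the rotation of a real plane by a right
  angle has zero quadratic form. Uniqueness in the functional calculus rests on it.\<close>

lemma clinear_eqI_quadratic:
  assumes "clinear F" "clinear G" "\<And>x. cinner x (F x) = cinner x (G x)"
  shows "F = G"
proof
  fix x
  show "F x = G x"
    by (rule cinner_eqI)
      (simp only: sesquilinear_polarization[OF assms(1), of _ x]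
        sesquilinear_polarization[OF assms(2), of _ x] assms(3))
qed

lemma clinear_bounded_linear:
  assumes "clinear F" "\<And>x. norm (F x) \<le> K * norm x"
  shows "bounded_linear F"
  by (rule bounded_linear_intro[where K = K])
    (use assms in \<open>auto simp: clinear_add clinear_scaleR mult.commute\<close>)

lemma orthonormal_expansion:
  assumes "finite I" "i \<in> I"
    and "\<And>i j. i \<in> I \<Longrightarrow> j \<in> I \<Longrightarrow> cinner (e i) (e j) = (if i = j then 1 else 0)"
  shows "cinner (e i) (\<Sum>k\<in>I. c k *\<^sub>C e k) = c i"
proof -
  have "cinner (e i) (\<Sum>k\<in>I. c k *\<^sub>C e k) = (\<Sum>k\<in>I. if k = i then c i else 0)"
    unfolding cinner_sum_right cinner_scaleC_right by (rule sum.cong) (use assms in auto)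
  then show ?thesis using assms by simp
qed

section \<open>The bounded functional calculus of a projection-valued measure\<close>

definition bounded_borel :: "(real \<Rightarrow> real) \<Rightarrow> bool" where
  "bounded_borel f \<longleftrightarrow> f \<in> borel_measurable borel \<and> (\<exists>M. \<forall>t. \<bar>f t\<bar> \<le> M)"

lemma bounded_borel_measurable [measurable_dest]: "bounded_borel f \<Longrightarrow> f \<in> borel_measurable borel"
  by (simp add: bounded_borel_def)

lemma bounded_borelI: "f \<in> borel_measurable borel \<Longrightarrow> (\<And>t. \<bar>f t\<bar> \<le> M) \<Longrightarrow> bounded_borel f"
  by (auto simp: bounded_borel_def)

lemma bounded_borelE:
  assumes "bounded_borel f"
  obtains M where "M \<ge> 0" "\<And>t. \<bar>f t\<bar> \<le> M"
  using assms unfolding bounded_borel_def by (meson abs_ge_zero order_trans)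

lemma bounded_borel_indicator: "S \<in> sets borel \<Longrightarrow> bounded_borel (indicator S)"
  by (rule bounded_borelI[where M = 1]) (auto simp: indicator_def)

lemma bounded_borel_add:
  assumes "bounded_borel f" "bounded_borel g"
  shows "bounded_borel (\<lambda>t. f t + g t)"
proof -
  obtain M M' where "\<And>t. \<bar>f t\<bar> \<le> M" "\<And>t. \<bar>g t\<bar> \<le> M'"
    using assms bounded_borelE by metis
  then show ?thesis
    using assms by (intro bounded_borelI[where M = "M + M'"])
      (auto intro: order_trans[OF abs_triangle_ineq add_mono])
qed

lemma bounded_borel_mult:
  assumes "bounded_borel f" "bounded_borel g"
  shows "bounded_borel (\<lambda>t. f t * g t)"
proof -
  obtain M M' where "M \<ge> 0" "\<And>t. \<bar>f t\<bar> \<le> M" "\<And>t. \<bar>g t\<bar> \<le> M'"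
    using assms bounded_borelE by metis
  then show ?thesis
    using assms by (intro bounded_borelI[where M = "M * M'"]) (auto simp: abs_mult mult_mono)
qed

lemma bounded_borel_const: "bounded_borel (\<lambda>t. c)"
  by (rule bounded_borelI[where M = "\<bar>c\<bar>"]) auto

lemma bounded_borel_diff:
  assumes "bounded_borel f" "bounded_borel g"
  shows "bounded_borel (\<lambda>t. f t - g t)"
  using bounded_borel_add[OF assms(1) bounded_borel_mult[OF bounded_borel_const[of "-1"] assms(2)]]
  by simp

section \<open>Projections of a spectral family and their scalar measures\<close>

locale pvm =
  fixes E :: "real set \<Rightarrow> 'a::complex_hilbert \<Rightarrow> 'a"
  assumes pvm: "projection_valued_measure E"
begin

lemma E_clinear: "S \<in> sets borel \<Longrightarrow> clinear (E S)"
  and E_sym: "S \<in> sets borel \<Longrightarrow> cinner (E S x) y = cinner x (E S y)"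
  and E_UNIV: "E UNIV x = x"
  and E_sums: "range F \<subseteq> sets borel \<Longrightarrow> disjoint_family F \<Longrightarrow> (\<lambda>n. E (F n) x) sums E (\<Union>n. F n) x"
  using pvm unfolding projection_valued_measure_def by (auto simp: fun_eq_iff)

lemma E_inter: "S \<in> sets borel \<Longrightarrow> S' \<in> sets borel \<Longrightarrow> E S (E S' x) = E (S \<inter> S') x"
  using pvm unfolding projection_valued_measure_def by (metis comp_apply)

lemma E_idem: "S \<in> sets borel \<Longrightarrow> E S (E S x) = E S x"
  by (simp add: E_inter)

text \<open>Countable additivity on a constant family of empty sets: a convergent series with
  constant terms has zero terms.\<close>

lemma E_empty: "E {} x = 0"
proof -
  have "(\<lambda>n::nat. E {} x) sums E (\<Union>n::nat. {}) x"
    by (rule E_sums) (auto simp: disjoint_family_on_def)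
  then have "(\<lambda>n::nat. E {} x) \<longlonglongrightarrow> 0"
    using sums_summable summable_LIMSEQ_zero by blast
  then show ?thesis
    using LIMSEQ_unique tendsto_const by blast
qed

lemma cinner_E_self: "S \<in> sets borel \<Longrightarrow> cinner x (E S x) = complex_of_real ((norm (E S x))\<^sup>2)"
  by (metis E_idem E_sym cinner_self)

lemma norm_E_le: "S \<in> sets borel \<Longrightarrow> norm (E S x) \<le> norm x"
proof -
  assume S: "S \<in> sets borel"
  have "(norm (E S x))\<^sup>2 \<le> norm x * norm (E S x)"
    using cauchy_schwarz[of x "E S x"] cinner_E_self[OF S, of x] by (simp add: norm_power)
  then show ?thesis
    by (cases "E S x = 0") (simp_all add: power2_eq_square)
qed

lemma bounded_linear_E: "S \<in> sets borel \<Longrightarrow> bounded_linear (E S)"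
  by (rule clinear_bounded_linear[where K = 1]) (simp_all add: E_clinear norm_E_le)

abbreviation \<mu> :: "'a \<Rightarrow> real measure" where
  "\<mu> \<equiv> scalar_measure E"

lemma sets_\<mu> [simp, measurable_cong]: "sets (\<mu> x) = sets borel"
  unfolding scalar_measure_def
  using sigma_algebra.sets_measure_of_eq[of UNIV "sets (borel :: real measure)"]
    sets.sigma_algebra_axioms[of "borel :: real measure"] by simp

lemma space_\<mu> [simp]: "space (\<mu> x) = UNIV"
  unfolding scalar_measure_def by (simp add: space_measure_of_conv)

lemma emeasure_\<mu>:
  assumes "S \<in> sets borel"
  shows "emeasure (\<mu> x) S = ennreal ((norm (E S x))\<^sup>2)"
  unfolding scalar_measure_def
proof (rule emeasure_measure_of_sigma)
  show "sigma_algebra UNIV (sets (borel :: real measure))"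
    using sets.sigma_algebra_axioms[of "borel :: real measure"] by simp
  show "positive (sets borel) (\<lambda>S. ennreal ((norm (E S x))\<^sup>2))"
    by (simp add: positive_def E_empty)
  show "countably_additive (sets borel) (\<lambda>S. ennreal ((norm (E S x))\<^sup>2))"
  proof (rule countably_additiveI)
    fix F :: "nat \<Rightarrow> real set"
    assume F: "range F \<subseteq> sets borel" "disjoint_family F" "(\<Union>n. F n) \<in> sets borel"
    \<comment> \<open>Squared norms are not additive in the vector. Additivity comes from the linear
      functional y \<mapsto> <x, y>, because <x, E S x> is the squared norm of E S x.\<close>
    have "(\<lambda>n. Re (cinner x (E (F n) x))) sums Re (cinner x (E (\<Union>n. F n) x))"
      by (intro sums_Re bounded_linear.sums[OF bounded_bilinear.bounded_linear_right,
            OF bounded_bilinear_cinner] E_sums F)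
    moreover have "Re (cinner x (E (F n) x)) = (norm (E (F n) x))\<^sup>2" for n
      using F by (subst cinner_E_self) auto
    ultimately have "(\<lambda>n. (norm (E (F n) x))\<^sup>2) sums (norm (E (\<Union>n. F n) x))\<^sup>2"
      using F(3) by (simp add: cinner_E_self)
    then show "(\<Sum>n. ennreal ((norm (E (F n) x))\<^sup>2)) = ennreal ((norm (E (\<Union>n. F n) x))\<^sup>2)"
      by (intro suminf_ennreal_eq) auto
  qed
qed (rule assms)

lemma measure_\<mu>: "S \<in> sets borel \<Longrightarrow> measure (\<mu> x) S = (norm (E S x))\<^sup>2"
  by (simp add: measure_def emeasure_\<mu>)

sublocale finite_measure "\<mu> x" for x
  by standard (simp add: emeasure_\<mu>)

lemma integrable_bounded_borel:
  assumes "bounded_borel f"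
  shows "integrable (\<mu> x) f"
proof -
  have [measurable]: "f \<in> borel_measurable borel"
    using assms by (rule bounded_borel_measurable)
  obtain M where "\<And>t. \<bar>f t\<bar> \<le> M" using assms bounded_borelE by blast
  then show ?thesis
    by (intro integrable_const_bound[where B = M]) auto
qed

lemma integral_\<mu>_tendsto:
  fixes f :: "nat \<Rightarrow> real \<Rightarrow> real"
  assumes [measurable]: "\<And>n. f n \<in> borel_measurable borel"
    and "\<And>n t. \<bar>f n t\<bar> \<le> M" and lim: "\<And>t. (\<lambda>n. f n t) \<longlonglongrightarrow> g t"
  shows "(\<lambda>n. \<integral>t. f n t \<partial>\<mu> x) \<longlonglongrightarrow> (\<integral>t. g t \<partial>\<mu> x)"
proof (rule integral_dominated_convergence[where w = "\<lambda>_. M"])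
  show "g \<in> borel_measurable (\<mu> x)"
    by (rule borel_measurable_LIMSEQ_real[OF lim]) measurable
qed (use assms in auto)

text \<open>Read: F is the integral of f with respect to E. The calculus starts as a relation closed
  under sums, scalings and bounded pointwise limits, so that linearity, symmetry, the quadratic form
  and the product rule all follow by rule induction; existence and uniqueness come afterwards.
  Strong convergence of the operators is a premise of \<open>bcalc_lim\<close> and is verified
  separately in \<open>bcalc_convergent\<close>.\<close>

inductive bcalc :: "(real \<Rightarrow> real) \<Rightarrow> ('a \<Rightarrow> 'a) \<Rightarrow> bool" where
  bcalc_indicator: "S \<in> sets borel \<Longrightarrow> bcalc (indicator S) (E S)"
| bcalc_add: "bcalc f F \<Longrightarrow> bcalc g G \<Longrightarrow> bcalc (\<lambda>t. f t + g t) (\<lambda>x. F x + G x)"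
| bcalc_scale: "bcalc f F \<Longrightarrow> bcalc (\<lambda>t. c * f t) (\<lambda>x. c *\<^sub>R F x)"
| bcalc_lim: "(\<And>n. bcalc (f n) (F n)) \<Longrightarrow> (\<And>n t. \<bar>f n t\<bar> \<le> M) \<Longrightarrow> (\<And>t. (\<lambda>n. f n t) \<longlonglongrightarrow> g t) \<Longrightarrow>
    (\<And>x. (\<lambda>n. F n x) \<longlonglongrightarrow> G x) \<Longrightarrow> bcalc g G"

lemma bcalc_bounded_borel: "bcalc f F \<Longrightarrow> bounded_borel f"
proof (induction rule: bcalc.induct)
  case (bcalc_lim f F M g G)
  have "\<bar>g t\<bar> \<le> M" for t
    by (rule tendsto_upperbound[OF tendsto_rabs[OF bcalc_lim.hyps(3)]]) (use bcalc_lim.hyps(2) in auto)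
  moreover have "g \<in> borel_measurable borel"
    by (rule borel_measurable_LIMSEQ_real[OF bcalc_lim.hyps(3)])
      (use bcalc_lim.IH bounded_borel_measurable in auto)
  ultimately show ?case by (rule bounded_borelI[rotated])
qed (auto intro: bounded_borel_indicator bounded_borel_add bounded_borel_mult bounded_borel_const)

lemma bcalc_clinear: "bcalc f F \<Longrightarrow> clinear F"
proof (induction rule: bcalc.induct)
  case (bcalc_lim f F M g G)
  show ?case unfolding clinear_def
  proof (intro allI)
    fix c x y
    have "(\<lambda>n. F n (c *\<^sub>C x + y)) \<longlonglongrightarrow> c *\<^sub>C G x + G y"
      unfolding clinear_add[OF bcalc_lim.IH] clinear_scaleC[OF bcalc_lim.IH]
      by (intro tendsto_add tendsto_scaleC tendsto_const bcalc_lim.hyps(4))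
    then show "G (c *\<^sub>C x + y) = c *\<^sub>C G x + G y"
      using bcalc_lim.hyps(4) LIMSEQ_unique by blast
  qed
qed (use E_clinear in \<open>auto simp: clinear_def algebra_simps scaleR_scaleC complex_vs.scale_right_distrib\<close>)

lemma bcalc_sym: "bcalc f F \<Longrightarrow> cinner (F x) y = cinner x (F y)"
proof (induction rule: bcalc.induct)
  case (bcalc_lim f F M g G)
  have "(\<lambda>n. cinner (F n x) y) \<longlonglongrightarrow> cinner (G x) y"
    by (intro tendsto_cinner bcalc_lim.hyps(4) tendsto_const)
  moreover have "(\<lambda>n. cinner (F n x) y) \<longlonglongrightarrow> cinner x (G y)"
    unfolding bcalc_lim.IH by (intro tendsto_cinner bcalc_lim.hyps(4) tendsto_const)
  ultimately show ?case by (rule LIMSEQ_unique)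
qed (auto simp: E_sym cinner_add_left cinner_add_right cinner_scaleR_left cinner_scaleR_right)

lemma bcalc_quadratic: "bcalc f F \<Longrightarrow> cinner x (F x) = complex_of_real (\<integral>t. f t \<partial>\<mu> x)"
proof (induction rule: bcalc.induct)
  case (bcalc_indicator S)
  then show ?case by (simp add: cinner_E_self measure_\<mu>)
next
  case (bcalc_add f F g G)
  then show ?case
    by (simp add: cinner_add_right integrable_bounded_borel bcalc_bounded_borel)
next
  case (bcalc_scale f F c)
  then show ?case
    by (simp add: cinner_scaleR_right integrable_bounded_borel bcalc_bounded_borel scaleR_conv_of_real)
next
  case (bcalc_lim f F M g G)
  have "(\<lambda>n. cinner x (F n x)) \<longlonglongrightarrow> cinner x (G x)"
    by (intro tendsto_cinner bcalc_lim.hyps(4) tendsto_const)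
  moreover have "(\<lambda>n. cinner x (F n x)) \<longlonglongrightarrow> complex_of_real (\<integral>t. g t \<partial>\<mu> x)"
    unfolding bcalc_lim.IH
    by (intro tendsto_of_real integral_\<mu>_tendsto[where M = M] bcalc_lim.hyps(2,3))
      (use bcalc_lim.hyps(1) bcalc_bounded_borel bounded_borel_measurable in blast)
  ultimately show ?case by (rule LIMSEQ_unique)
qed

text \<open>First half of the product rule: the induction runs over one factor while the other is an
  indicator. It is the base case of \<open>bcalc_mult\<close>, where the induction runs over the
  other factor.\<close>

lemma bcalc_mult_indicator:
  assumes "S \<in> sets borel"
  shows "bcalc g G \<Longrightarrow> bcalc (\<lambda>t. indicator S t * g t) (\<lambda>x. E S (G x))"
proof (induction rule: bcalc.induct)
  case (bcalc_indicator S')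
  have "(\<lambda>t. indicator S t * indicator S' t) = (indicator (S \<inter> S') :: real \<Rightarrow> real)"
    by (auto simp: indicator_def)
  then show ?case
    using bcalc.bcalc_indicator[of "S \<inter> S'"] bcalc_indicator assms by (simp add: E_inter)
next
  case (bcalc_add f F g G)
  show ?case
    using bcalc.bcalc_add[OF bcalc_add.IH] by (simp add: clinear_add[OF E_clinear] assms algebra_simps)
next
  case (bcalc_scale f F c)
  show ?case
    using bcalc.bcalc_scale[OF bcalc_scale.IH, of c]
    by (simp add: clinear_scaleR[OF E_clinear] assms algebra_simps)
next
  case (bcalc_lim f F M g G)
  have M: "M \<ge> 0" using bcalc_lim.hyps(2)[of 0 0] by simp
  show ?case
  proof (rule bcalc.bcalc_lim[OF bcalc_lim.IH])
    show "\<bar>indicator S t * f n t\<bar> \<le> M" for n t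
      using bcalc_lim.hyps(2)[of n t] M by (auto simp: indicator_def)
    show "(\<lambda>n. E S (F n x)) \<longlonglongrightarrow> E S (G x)" for x
      by (intro bounded_linear.tendsto[OF bounded_linear_E] assms bcalc_lim.hyps(4))
  qed (intro tendsto_mult tendsto_const bcalc_lim.hyps(3,4))+
qed

lemma bcalc_mult:
  assumes "bcalc g G"
  shows "bcalc f F \<Longrightarrow> bcalc (\<lambda>t. f t * g t) (\<lambda>x. F (G x))"
proof (induction rule: bcalc.induct)
  case (bcalc_indicator S)
  then show ?case using assms by (rule bcalc_mult_indicator)
next
  case (bcalc_add f F h H)
  show ?case
    using bcalc.bcalc_add[OF bcalc_add.IH] by (simp add: algebra_simps)
next
  case (bcalc_scale f F c)
  show ?case
    using bcalc.bcalc_scale[OF bcalc_scale.IH, of c] by (simp add: algebra_simps)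
next
  case (bcalc_lim f F M h H)
  have M: "M \<ge> 0" using bcalc_lim.hyps(2)[of 0 0] by simp
  obtain M' where M': "\<And>t. \<bar>g t\<bar> \<le> M'"
    using assms bcalc_bounded_borel bounded_borelE by metis
  show ?case
  proof (rule bcalc.bcalc_lim[OF bcalc_lim.IH])
    show "\<bar>f n t * g t\<bar> \<le> M * M'" for n t
      using bcalc_lim.hyps(2)[of n t] M M'[of t] by (auto simp: abs_mult intro!: mult_mono)
      show "(\<lambda>n. f n t * g t) \<longlonglongrightarrow> h t * g t" for t
      by (intro tendsto_mult tendsto_const bcalc_lim.hyps(3))
  qed (rule bcalc_lim.hyps(4))
qed

text \<open>The quadratic form of F is the integral of f against \<open>\<mu> x\<close>, whichever
  derivation led to F.\<close>

lemma bcalc_unique: "bcalc f F \<Longrightarrow> bcalc f G \<Longrightarrow> F = G"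
  by (rule clinear_eqI_quadratic) (auto simp: bcalc_clinear bcalc_quadratic)

text \<open>Symmetry and the product rule turn <F x, F x> into <x, F (F x)>. The resulting isometry
  into L2 of \<open>\<mu> x\<close> converts convergence of functions into convergence of
  operators.\<close>

lemma bcalc_norm:
  assumes "bcalc f F"
  shows "(norm (F x))\<^sup>2 = (\<integral>t. (f t)\<^sup>2 \<partial>\<mu> x)"
proof -
  have "cinner (F x) (F x) = cinner x (F (F x))"
    by (rule bcalc_sym[OF assms])
  also have "\<dots> = complex_of_real (\<integral>t. f t * f t \<partial>\<mu> x)"
    by (rule bcalc_quadratic[OF bcalc_mult[OF assms assms]])
  finally show ?thesis
    unfolding cinner_self of_real_eq_iff by (simp add: power2_eq_square)
qed

lemma bcalc_diff:
  assumes "bcalc f F" "bcalc g G"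
  shows "bcalc (\<lambda>t. f t - g t) (\<lambda>x. F x - G x)"
  using bcalc_add[OF assms(1) bcalc_scale[OF assms(2), of "-1"]] by simp

text \<open>By the isometry, the distance of \<open>F m x\<close> and \<open>F n x\<close> is that
  of \<open>f m\<close> and \<open>f n\<close> in L2 of \<open>\<mu> x\<close>; it is small because
  both functions are close to g there, by dominated convergence. Completeness of the Hilbert space
  does the rest.\<close>

lemma bcalc_convergent:
  assumes f: "\<And>n. bcalc (f n) (F n)" and M: "\<And>n t. \<bar>f n t\<bar> \<le> M"
    and lim: "\<And>t. (\<lambda>n. f n t) \<longlonglongrightarrow> g t"
  shows "convergent (\<lambda>n. F n x)"
proof -
  have [measurable]: "f n \<in> borel_measurable borel" for n
    using f bcalc_bounded_borel bounded_borel_measurable by blast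
  have [measurable]: "g \<in> borel_measurable borel"
    by (rule borel_measurable_LIMSEQ_real[OF lim]) auto
  have gM: "\<bar>g t\<bar> \<le> M" for t
    by (rule tendsto_upperbound[OF tendsto_rabs[OF lim]]) (use M in auto)
  have fg: "\<bar>f n t - g t\<bar> \<le> 2 * M" for n t
    using M[of n t] gM[of t] by linarith
  have bb: "bounded_borel (\<lambda>t. (f n t - g t)\<^sup>2)" for n
  proof (rule bounded_borelI)
    show "\<bar>(f n t - g t)\<^sup>2\<bar> \<le> (2 * M)\<^sup>2" for t
      using power_mono[OF fg[of n t] abs_ge_zero, of 2] by simp
  qed auto
  define a where "a n = (\<integral>t. (f n t - g t)\<^sup>2 \<partial>\<mu> x)" for n
  have "a \<longlonglongrightarrow> (\<integral>t. (g t - g t)\<^sup>2 \<partial>\<mu> x)"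
    unfolding a_def
  proof (rule integral_\<mu>_tendsto[where M = "(2 * M)\<^sup>2"])
    show "\<bar>(f n t - g t)\<^sup>2\<bar> \<le> (2 * M)\<^sup>2" for n t
      using power_mono[OF fg[of n t] abs_ge_zero, of 2] by simp
      show "(\<lambda>n. (f n t - g t)\<^sup>2) \<longlonglongrightarrow> (g t - g t)\<^sup>2" for t
      by (intro tendsto_intros lim)
  qed auto
  then have a: "a \<longlonglongrightarrow> 0" by simp
  have bound: "(norm (F m x - F n x))\<^sup>2 \<le> 2 * a m + 2 * a n" for m n
  proof -
    have "(norm (F m x - F n x))\<^sup>2 = (\<integral>t. (f m t - f n t)\<^sup>2 \<partial>\<mu> x)"
      by (rule bcalc_norm[OF bcalc_diff[OF f f]])
    also have "\<dots> \<le> (\<integral>t. 2 * (f m t - g t)\<^sup>2 + 2 * (f n t - g t)\<^sup>2 \<partial>\<mu> x)"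
    proof (rule integral_mono)
      show "integrable (\<mu> x) (\<lambda>t. (f m t - f n t)\<^sup>2)"
        using bcalc_bounded_borel[OF bcalc_diff[OF f f]]
        by (simp add: power2_eq_square integrable_bounded_borel bounded_borel_mult)
      show "integrable (\<mu> x) (\<lambda>t. 2 * (f m t - g t)\<^sup>2 + 2 * (f n t - g t)\<^sup>2)"
        by (intro Bochner_Integration.integrable_add integrable_mult_right integrable_bounded_borel bb)
      fix t
      have "0 \<le> (f m t - g t + (f n t - g t))\<^sup>2" by simp
      then show "(f m t - f n t)\<^sup>2 \<le> 2 * (f m t - g t)\<^sup>2 + 2 * (f n t - g t)\<^sup>2"
        by (simp add: power2_eq_square algebra_simps)
    qed
    also have "\<dots> = 2 * a m + 2 * a n"
      by (simp add: a_def integrable_bounded_borel bb)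
    finally show ?thesis .
  qed
  have "Cauchy (\<lambda>n. F n x)"
  proof (rule metric_CauchyI)
    fix e :: real assume e: "0 < e"
    then have "\<forall>\<^sub>F n in sequentially. a n < e\<^sup>2 / 4"
      by (intro order_tendstoD(2)[OF a]) auto
    then obtain N where N: "\<And>n. n \<ge> N \<Longrightarrow> a n < e\<^sup>2 / 4"
      by (auto simp: eventually_sequentially)
    have "dist (F m x) (F n x) < e" if "m \<ge> N" "n \<ge> N" for m n
    proof -
      have "(norm (F m x - F n x))\<^sup>2 < e\<^sup>2"
        using bound[of m n] N[OF that(1)] N[OF that(2)] by linarith
      then show ?thesis
        using e by (simp add: dist_norm power_less_imp_less_base)
    qed
    then show "\<exists>N. \<forall>m\<ge>N. \<forall>n\<ge>N. dist (F m x) (F n x) < e" by blast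
  qed
  then show ?thesis by (simp add: Cauchy_convergent_iff)
qed

text \<open>Induction along the approximation of a nonnegative Borel function by simple ones. The
  bound M varies in the induction, since rescaling a function changes its bound.\<close>

lemma bcalc_exists_nonneg:
  assumes "f \<in> borel_measurable borel" "\<And>t. 0 \<le> f t"
  shows "(\<And>t. f t \<le> M) \<Longrightarrow> \<exists>F. bcalc f F"
  using assms
proof (induction arbitrary: M rule: borel_measurable_induct_real)
  case (set A)
  then show ?case using bcalc_indicator by blast
next
  case (mult u c)
  show ?case
  proof (cases "c = 0")
    \<comment> \<open>With c = 0 the bound on the product says nothing about u, so the induction
      hypothesis is out of reach; the zero function is taken as 0 times an indicator.\<close>
    case True
    then show ?thesis
      using bcalc_scale[OF bcalc_indicator[of UNIV], of 0] by (auto simp: indicator_def)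
  next
    case False
    then have "u t \<le> M / c" for t
      using mult.prems[of t] mult.hyps by (simp add: field_simps)
    then obtain F where "bcalc u F" using mult.IH by blast
    then show ?thesis using bcalc_scale by blast
  qed
next
  case (add u v)
  have "u t \<le> M" "v t \<le> M" for t
    using add.prems[of t] add.hyps(2)[of t] add.hyps(4)[of t] by linarith+
  then obtain F G where "bcalc u F" "bcalc v G" using add.IH by metis
  then show ?case using bcalc_add by blast
next
  case (seq U)
  have le: "U i t \<le> f t" for i t
    by (rule incseq_le) (use seq in \<open>auto simp: incseq_def le_fun_def\<close>)
  then have UM: "U i t \<le> M" for i t
    using seq.prems[of t] order_trans by blast
  then have "\<forall>i. \<exists>F. bcalc (U i) F"
    using seq.IH by blast
  then obtain F where F: "\<And>i. bcalc (U i) (F i)"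
    by metis
  have abs: "\<bar>U i t\<bar> \<le> M" for i t
    using UM seq.hyps(2)[of i t] by simp
  have lim: "(\<lambda>i. U i t) \<longlonglongrightarrow> f t" for t
    using seq.hyps by simp
  have "(\<lambda>i. F i x) \<longlonglongrightarrow> Lim sequentially (\<lambda>i. F i x)" for x
    using bcalc_convergent[OF F abs lim] convergent_LIMSEQ_iff by metis
  then have "bcalc f (\<lambda>x. Lim sequentially (\<lambda>i. F i x))"
    by (rule bcalc_lim[OF F abs lim])
  then show ?case by blast
qed

lemma bcalc_exists:
  assumes "bounded_borel f"
  shows "\<exists>F. bcalc f F"
proof -
  have [measurable]: "f \<in> borel_measurable borel"
    using assms by (rule bounded_borel_measurable)
  obtain M where M: "M \<ge> 0" "\<And>t. \<bar>f t\<bar> \<le> M" using assms bounded_borelE by blast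
  have "\<exists>F. bcalc (\<lambda>t. max 0 (f t)) F"
    by (rule bcalc_exists_nonneg[where M = M]) (use M in \<open>auto simp: abs_le_iff\<close>)
  then obtain F where F: "bcalc (\<lambda>t. max 0 (f t)) F" ..
  have "\<exists>F. bcalc (\<lambda>t. max 0 (- f t)) F"
    by (rule bcalc_exists_nonneg[where M = M]) (use M in \<open>auto simp: abs_le_iff\<close>)
  then obtain G where G: "bcalc (\<lambda>t. max 0 (- f t)) G" ..
  have "(\<lambda>t. max 0 (f t) - max 0 (- f t)) = f" by (auto simp: max_def)
  then show ?thesis using bcalc_diff[OF F G] by auto
qed

section \<open>The bounded calculus as an operator-valued map\<close>

definition \<Phi> :: "(real \<Rightarrow> real) \<Rightarrow> 'a \<Rightarrow> 'a" where
  "\<Phi> f = (THE F. bcalc f F)"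

lemma \<Phi>_eqI: "bcalc f F \<Longrightarrow> \<Phi> f = F"
  unfolding \<Phi>_def using bcalc_unique by blast

lemma bcalc_\<Phi>: "bounded_borel f \<Longrightarrow> bcalc f (\<Phi> f)"
  using bcalc_exists \<Phi>_eqI by metis

lemma \<Phi>_indicator: "S \<in> sets borel \<Longrightarrow> \<Phi> (indicator S) = E S"
  by (rule \<Phi>_eqI[OF bcalc_indicator])

lemma \<Phi>_add: "bounded_borel f \<Longrightarrow> bounded_borel g \<Longrightarrow> \<Phi> (\<lambda>t. f t + g t) x = \<Phi> f x + \<Phi> g x"
  by (simp add: \<Phi>_eqI[OF bcalc_add[OF bcalc_\<Phi> bcalc_\<Phi>]])

lemma \<Phi>_diff: "bounded_borel f \<Longrightarrow> bounded_borel g \<Longrightarrow> \<Phi> (\<lambda>t. f t - g t) x = \<Phi> f x - \<Phi> g x"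
  by (simp add: \<Phi>_eqI[OF bcalc_diff[OF bcalc_\<Phi> bcalc_\<Phi>]])

lemma \<Phi>_mult: "bounded_borel f \<Longrightarrow> bounded_borel g \<Longrightarrow> \<Phi> (\<lambda>t. f t * g t) x = \<Phi> f (\<Phi> g x)"
  by (simp add: \<Phi>_eqI[OF bcalc_mult[OF bcalc_\<Phi> bcalc_\<Phi>]])

lemma \<Phi>_scale: "bounded_borel f \<Longrightarrow> \<Phi> (\<lambda>t. c * f t) x = c *\<^sub>R \<Phi> f x"
  by (simp add: \<Phi>_eqI[OF bcalc_scale[OF bcalc_\<Phi>]])

lemma \<Phi>_clinear: "bounded_borel f \<Longrightarrow> clinear (\<Phi> f)"
  by (rule bcalc_clinear[OF bcalc_\<Phi>])

lemma \<Phi>_sym: "bounded_borel f \<Longrightarrow> cinner (\<Phi> f x) y = cinner x (\<Phi> f y)"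
  by (rule bcalc_sym[OF bcalc_\<Phi>])

lemma \<Phi>_quadratic: "bounded_borel f \<Longrightarrow> cinner x (\<Phi> f x) = complex_of_real (\<integral>t. f t \<partial>\<mu> x)"
  by (rule bcalc_quadratic[OF bcalc_\<Phi>])

lemma \<Phi>_norm: "bounded_borel f \<Longrightarrow> (norm (\<Phi> f x))\<^sup>2 = (\<integral>t. (f t)\<^sup>2 \<partial>\<mu> x)"
  by (rule bcalc_norm[OF bcalc_\<Phi>])

lemma \<Phi>_tendsto:
  assumes f: "\<And>n. bounded_borel (f n)" and M: "\<And>n t. \<bar>f n t\<bar> \<le> M"
    and lim: "\<And>t. (\<lambda>n. f n t) \<longlonglongrightarrow> g t"
  shows "(\<lambda>n. \<Phi> (f n) x) \<longlonglongrightarrow> \<Phi> g x"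
proof -
  have "(\<lambda>n. \<Phi> (f n) x) \<longlonglongrightarrow> Lim sequentially (\<lambda>n. \<Phi> (f n) x)" for x
    using bcalc_convergent[OF bcalc_\<Phi>[OF f] M lim] convergent_LIMSEQ_iff by metis
  moreover from this have "bcalc g (\<lambda>x. Lim sequentially (\<lambda>n. \<Phi> (f n) x))"
    by (rule bcalc_lim[OF bcalc_\<Phi>[OF f] M lim])
  ultimately show ?thesis using \<Phi>_eqI by metis
qed

lemma \<Phi>_commute: "bounded_borel f \<Longrightarrow> bounded_borel g \<Longrightarrow> \<Phi> f (\<Phi> g x) = \<Phi> g (\<Phi> f x)"
  by (simp add: \<Phi>_mult[symmetric] mult.commute)

lemma \<Phi>_E: "bounded_borel f \<Longrightarrow> S \<in> sets borel \<Longrightarrow> \<Phi> f (E S x) = \<Phi> (\<lambda>t. f t * indicator S t) x"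
  by (simp add: \<Phi>_mult bounded_borel_indicator \<Phi>_indicator)

lemma E_\<Phi>: "bounded_borel f \<Longrightarrow> S \<in> sets borel \<Longrightarrow> E S (\<Phi> f x) = \<Phi> f (E S x)"
  by (metis \<Phi>_commute \<Phi>_indicator bounded_borel_indicator)

lemma \<Phi>_norm_le:
  assumes "bounded_borel f" "bounded_borel g" "\<And>t. \<bar>f t\<bar> \<le> \<bar>g t\<bar>"
  shows "norm (\<Phi> f x) \<le> norm (\<Phi> g x)"
proof -
  have "(norm (\<Phi> f x))\<^sup>2 \<le> (norm (\<Phi> g x))\<^sup>2"
    unfolding \<Phi>_norm[OF assms(1)] \<Phi>_norm[OF assms(2)]
    using assms by (intro integral_mono integrable_bounded_borel)
      (auto simp: power2_eq_square bounded_borel_mult abs_mult_self_eq intro: abs_le_square_iff[THEN iffD1, unfolded power2_eq_square])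
  then show ?thesis by (rule power2_le_imp_le) simp
qed

lemma E_tendsto:
  assumes S: "\<And>n::nat. S n \<in> sets borel" and "incseq S" and "(\<Union>n. S n) = UNIV"
  shows "(\<lambda>n. E (S n) x) \<longlonglongrightarrow> x"
proof -
  have "(\<lambda>n. \<Phi> (indicator (S n)) x) \<longlonglongrightarrow> \<Phi> (indicator (\<Union>n. S n)) x"
  proof (rule \<Phi>_tendsto[where M = 1])
    show "(\<lambda>n. indicator (S n) t) \<longlonglongrightarrow> (indicator (\<Union>n. S n) t :: real)" for t
      by (rule LIMSEQ_indicator_incseq[OF assms(2)])
  qed (use S in \<open>auto intro!: bounded_borel_indicator simp: indicator_def\<close>)
  then show ?thesis
    using \<Phi>_indicator[OF S] \<Phi>_indicator[of UNIV] E_UNIV unfolding assms(3)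
    by (simp del: indicator_UNIV)
qed

end

section \<open>Unbounded spectral integrals\<close>

lemma bounded_borel_cut:
  assumes "f \<in> borel_measurable borel" "S \<in> sets borel" "\<And>t. t \<in> S \<Longrightarrow> \<bar>f t\<bar> \<le> M"
  shows "bounded_borel (\<lambda>t. f t * indicator S t)"
  by (rule bounded_borelI[where M = "\<bar>M\<bar>"])
    (use assms in \<open>auto simp: indicator_def intro: order_trans[OF _ abs_ge_self]\<close>)

definition cut :: "(real \<Rightarrow> real) \<Rightarrow> nat \<Rightarrow> real set" where
  "cut f n = {t. \<bar>f t\<bar> \<le> real n}"

lemma cut_borel: "f \<in> borel_measurable borel \<Longrightarrow> cut f n \<in> sets borel"
  unfolding cut_def by measurable

lemma incseq_cut: "incseq (cut f)"
  by (auto simp: incseq_def cut_def)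

lemma UN_cut: "(\<Union>n. cut f n) = UNIV"
  using real_arch_simple by (auto simp: cut_def)

lemma cut_bound: "t \<in> cut f n \<Longrightarrow> \<bar>f t\<bar> \<le> real n"
  by (simp add: cut_def)

abbreviation trunc :: "(real \<Rightarrow> real) \<Rightarrow> nat \<Rightarrow> real \<Rightarrow> real" where
  "trunc f n \<equiv> (\<lambda>t. f t * indicator (cut f n) t)"

lemma bounded_borel_trunc: "f \<in> borel_measurable borel \<Longrightarrow> bounded_borel (trunc f n)"
  by (rule bounded_borel_cut[OF _ cut_borel, where M = "real n"]) (auto intro: cut_bound)

lemma trunc_tendsto: "(\<lambda>n. trunc f n t) \<longlonglongrightarrow> f t"
proof -
  have "(\<lambda>n. indicator (cut f n) t :: real) \<longlonglongrightarrow> indicator (\<Union>n. cut f n) t"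
    by (rule LIMSEQ_indicator_incseq[OF incseq_cut])
  then have "(\<lambda>n. trunc f n t) \<longlonglongrightarrow> f t * indicator (\<Union>n. cut f n) t"
    by (rule tendsto_mult[OF tendsto_const])
  then show ?thesis by (simp add: UN_cut)
qed

lemma trunc_mono: "m \<le> n \<Longrightarrow> (trunc f m t)\<^sup>2 \<le> (trunc f n t)\<^sup>2"
  using incseq_cut[of f] by (auto simp: indicator_def incseq_def)

lemma trunc_le: "(trunc f m t)\<^sup>2 \<le> (f t)\<^sup>2"
  by (auto simp: indicator_def)

context pvm
begin

lemma \<Phi>_norm_le_const:
  assumes "bounded_borel f" "\<And>t. \<bar>f t\<bar> \<le> M"
  shows "norm (\<Phi> f x) \<le> M * norm x"
proof -
  have "norm (\<Phi> f x) \<le> norm (\<Phi> (\<lambda>t. M * indicator UNIV t) x)"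
    by (rule \<Phi>_norm_le) (use assms order_trans[OF assms(2) abs_ge_self] in
      \<open>auto intro: bounded_borel_const\<close>)
  also have "\<dots> = \<bar>M\<bar> * norm x"
    by (subst \<Phi>_scale) (auto simp: bounded_borel_indicator \<Phi>_indicator[of UNIV] E_UNIV simp del: indicator_UNIV)
  also have "\<bar>M\<bar> = M"
    using assms(2)[of 0] by simp
  finally show ?thesis .
qed

text \<open>The working form of membership in \<open>spectral_integral E f\<close>: wherever f is
  bounded, y is what the bounded calculus makes of x. Unlike the polarized integrals it involves no
  test vectors and localizes to Borel sets; \<open>spectral_integral_iff\<close> shows that the two
  agree for Borel f.\<close>

definition spectral_pair :: "(real \<Rightarrow> real) \<Rightarrow> 'a \<Rightarrow> 'a \<Rightarrow> bool" where
  "spectral_pair f x y \<longleftrightarrow> (\<forall>S\<in>sets borel. (\<exists>M. \<forall>t\<in>S. \<bar>f t\<bar> \<le> M) \<longrightarrow>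
     E S y = \<Phi> (\<lambda>t. f t * indicator S t) x)"

lemma spectral_pairD:
  assumes "spectral_pair f x y" "S \<in> sets borel" "\<And>t. t \<in> S \<Longrightarrow> \<bar>f t\<bar> \<le> M"
  shows "E S y = \<Phi> (\<lambda>t. f t * indicator S t) x"
  using assms unfolding spectral_pair_def by blast

text \<open>One exhausting sequence suffices: the projections \<open>E (F n)\<close> commute with
  \<open>E S\<close> and with the calculus, and they converge strongly to the identity.\<close>

lemma spectral_pair_exhaust:
  fixes F :: "nat \<Rightarrow> real set"
  assumes f: "f \<in> borel_measurable borel"
    and F: "\<And>n. F n \<in> sets borel" "incseq F" "(\<Union>n. F n) = UNIV"
    and b: "\<And>n t. t \<in> F n \<Longrightarrow> \<bar>f t\<bar> \<le> M n"
    and eq: "\<And>n. E (F n) y = \<Phi> (\<lambda>t. f t * indicator (F n) t) x"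
  shows "spectral_pair f x y"
  unfolding spectral_pair_def
proof (intro ballI impI)
  fix S :: "real set" assume S: "S \<in> sets borel" and "\<exists>M. \<forall>t\<in>S. \<bar>f t\<bar> \<le> M"
  then obtain C where C: "\<And>t. t \<in> S \<Longrightarrow> \<bar>f t\<bar> \<le> C" by blast
  have bS: "bounded_borel (\<lambda>t. f t * indicator S t)"
    by (rule bounded_borel_cut[OF f S C])
  have bF: "bounded_borel (\<lambda>t. f t * indicator (F n) t)" for n
    by (rule bounded_borel_cut[OF f F(1) b])
  have "E (F n) (E S y) = E (F n) (\<Phi> (\<lambda>t. f t * indicator S t) x)" for n
  proof -
    have "E (F n) (E S y) = E S (E (F n) y)"
      by (simp add: E_inter S F Int_commute)
    also have "\<dots> = \<Phi> (\<lambda>t. f t * indicator (F n) t * indicator S t) x"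
      unfolding eq by (simp add: E_\<Phi> \<Phi>_E bF S)
    also have "(\<lambda>t. f t * indicator (F n) t * indicator S t) = (\<lambda>t. f t * indicator S t * indicator (F n) t)"
      by (simp add: ac_simps)
    also have "\<Phi> \<dots> x = E (F n) (\<Phi> (\<lambda>t. f t * indicator S t) x)"
      by (simp add: E_\<Phi> \<Phi>_E bS F)
    finally show ?thesis .
  qed
  then have "(\<lambda>n. E (F n) (E S y)) \<longlonglongrightarrow> \<Phi> (\<lambda>t. f t * indicator S t) x"
    using E_tendsto[OF F] by simp
  then show "E S y = \<Phi> (\<lambda>t. f t * indicator S t) x"
    using LIMSEQ_unique[OF E_tendsto[OF F]] by blast
qed

lemma spectral_pair_trunc:
  assumes "f \<in> borel_measurable borel" "spectral_pair f x y"
  shows "E (cut f n) y = \<Phi> (trunc f n) x"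
  by (rule spectral_pairD[where M = "real n", OF assms(2) cut_borel[OF assms(1)]])
    (rule cut_bound)

lemma spectral_pair_truncI:
  assumes "f \<in> borel_measurable borel" "\<And>n. E (cut f n) y = \<Phi> (trunc f n) x"
  shows "spectral_pair f x y"
  by (rule spectral_pair_exhaust[where M = real and F = "cut f"])
    (use assms in \<open>auto intro: cut_borel incseq_cut cut_bound simp: UN_cut\<close>)

text \<open>The squared norms are the integrals of the truncated squares, which increase with n; by
  monotone convergence their boundedness amounts to integrability of the square of f.\<close>

lemma domain_iff:
  assumes f: "f \<in> borel_measurable borel"
  shows "x \<in> spectral_integral_domain E f \<longleftrightarrow> (\<exists>C. \<forall>n. (norm (\<Phi> (trunc f n) x))\<^sup>2 \<le> C)"
proof
  note [measurable] = f
  have int: "integrable (\<mu> x) (\<lambda>t. (trunc f n t)\<^sup>2)" for n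
    using bounded_borel_mult[OF bounded_borel_trunc[OF f, of n] bounded_borel_trunc[OF f, of n]]
      integrable_bounded_borel unfolding power2_eq_square by blast
  have norm: "(norm (\<Phi> (trunc f n) x))\<^sup>2 = (\<integral>t. (trunc f n t)\<^sup>2 \<partial>\<mu> x)" for n
    by (rule \<Phi>_norm[OF bounded_borel_trunc[OF f]])
  {
    assume "x \<in> spectral_integral_domain E f"
    then have "integrable (\<mu> x) (\<lambda>t. (f t)\<^sup>2)"
      by (simp add: spectral_integral_domain_def)
    then have "(\<integral>t. (trunc f n t)\<^sup>2 \<partial>\<mu> x) \<le> (\<integral>t. (f t)\<^sup>2 \<partial>\<mu> x)" for n
      by (intro integral_mono int trunc_le)
    then show "\<exists>C. \<forall>n. (norm (\<Phi> (trunc f n) x))\<^sup>2 \<le> C"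
      unfolding norm by blast
  }
  {
    assume "\<exists>C. \<forall>n. (norm (\<Phi> (trunc f n) x))\<^sup>2 \<le> C"
    then obtain C where C: "\<And>n. (\<integral>t. (trunc f n t)\<^sup>2 \<partial>\<mu> x) \<le> C"
      unfolding norm by blast
    have "incseq (\<lambda>n. \<integral>t. (trunc f n t)\<^sup>2 \<partial>\<mu> x)"
      unfolding incseq_def by (auto intro!: integral_mono int trunc_mono)
    then obtain L where L: "(\<lambda>n. \<integral>t. (trunc f n t)\<^sup>2 \<partial>\<mu> x) \<longlonglongrightarrow> L"
      using incseq_convergent[of "\<lambda>n. \<integral>t. (trunc f n t)\<^sup>2 \<partial>\<mu> x" C] C by blast
    have "integrable (\<mu> x) (\<lambda>t. (f t)\<^sup>2)"
    proof (rule integrable_monotone_convergence[OF int _ _ L])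
      show "AE t in \<mu> x. mono (\<lambda>n. (trunc f n t)\<^sup>2)"
        by (intro AE_I2 monoI trunc_mono)
      show "AE t in \<mu> x. (\<lambda>n. (trunc f n t)\<^sup>2) \<longlonglongrightarrow> (f t)\<^sup>2"
        by (intro AE_I2 tendsto_power trunc_tendsto)
    qed measurable
    then show "x \<in> spectral_integral_domain E f"
      by (simp add: spectral_integral_domain_def)
  }
qed

text \<open>Polarization evaluates the scalar measure at \<open>x + \<i> ^ k *\<^sub>C z\<close>, so
  the domain has to be stable under such combinations. On the truncations this is the inequality (a
  + b)^2 \<le> 2 a^2 + 2 b^2.\<close>

lemma domain_add_scaleC:
  assumes f: "f \<in> borel_measurable borel"
    and "x \<in> spectral_integral_domain E f" "z \<in> spectral_integral_domain E f"
  shows "x + c *\<^sub>C z \<in> spectral_integral_domain E f"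
proof -
  obtain C D where C: "\<And>n. (norm (\<Phi> (trunc f n) x))\<^sup>2 \<le> C" and D: "\<And>n. (norm (\<Phi> (trunc f n) z))\<^sup>2 \<le> D"
    using assms(2,3) unfolding domain_iff[OF f] by blast
  have "(norm (\<Phi> (trunc f n) (x + c *\<^sub>C z)))\<^sup>2 \<le> 2 * C + 2 * (cmod c)\<^sup>2 * D" for n
  proof -
    let ?a = "\<Phi> (trunc f n) x" and ?b = "\<Phi> (trunc f n) z"
    have "(norm (\<Phi> (trunc f n) (x + c *\<^sub>C z)))\<^sup>2 = (norm (?a + c *\<^sub>C ?b))\<^sup>2"
      using \<Phi>_clinear[OF bounded_borel_trunc[OF f]] by (simp add: clinear_add clinear_scaleC)
    also have "\<dots> \<le> (norm ?a + norm (c *\<^sub>C ?b))\<^sup>2"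
      by (intro power_mono norm_triangle_ineq) simp
    also have "\<dots> \<le> 2 * (norm ?a)\<^sup>2 + 2 * (norm (c *\<^sub>C ?b))\<^sup>2"
      using zero_le_power2[of "norm ?a - norm (c *\<^sub>C ?b)"] by (simp add: power2_sum power2_diff)
    also have "(norm (c *\<^sub>C ?b))\<^sup>2 = (cmod c)\<^sup>2 * (norm ?b)\<^sup>2"
      by (simp add: norm_scaleC power_mult_distrib)
    also have "2 * (norm ?a)\<^sup>2 + 2 * ((cmod c)\<^sup>2 * (norm ?b)\<^sup>2) \<le> 2 * C + 2 * ((cmod c)\<^sup>2 * D)"
      by (intro add_mono mult_left_mono C D) auto
    finally show ?thesis by (simp add: mult.assoc)
  qed
  then show ?thesis unfolding domain_iff[OF f] by blast
qed

text \<open>Membership in the domain provides square integrability of f; since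
  \<open>\<mu> x\<close> is finite, 1 + f^2 is integrable as well, and it dominates |f|.\<close>

lemma integral_trunc_tendsto:
  assumes [measurable]: "f \<in> borel_measurable borel"
    and "x \<in> spectral_integral_domain E f"
  shows "(\<lambda>n. \<integral>t. trunc f n t \<partial>\<mu> x) \<longlonglongrightarrow> (\<integral>t. f t \<partial>\<mu> x)"
proof (rule integral_dominated_convergence[where w = "\<lambda>t. 1 + (f t)\<^sup>2"])
  show "integrable (\<mu> x) (\<lambda>t. 1 + (f t)\<^sup>2)"
    using assms(2) by (simp add: spectral_integral_domain_def)
  have "\<bar>f t\<bar> \<le> 1 + (f t)\<^sup>2" for t
    using zero_le_power2[of "\<bar>f t\<bar> - 1"] zero_le_power2[of "f t"] by (simp add: power2_diff)
  moreover have "0 \<le> 1 + (f t)\<^sup>2" for t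
    by (simp add: add_nonneg_nonneg)
  ultimately show "AE t in \<mu> x. norm (trunc f n t) \<le> 1 + (f t)\<^sup>2" for n
    by (intro AE_I2) (auto simp: indicator_def)
  show "trunc f n \<in> borel_measurable (\<mu> x)" for n
    using bounded_borel_measurable[OF bounded_borel_trunc[OF assms(1)]] by measurable
qed (auto intro: trunc_tendsto)

lemma cinner_trunc_tendsto:
  assumes f: "f \<in> borel_measurable borel"
    and x: "x \<in> spectral_integral_domain E f" and z: "z \<in> spectral_integral_domain E f"
  shows "(\<lambda>n. cinner z (\<Phi> (trunc f n) x)) \<longlonglongrightarrow>
    (\<Sum>k<4::nat. \<i> ^ k * complex_of_real (\<integral>t. f t \<partial>\<mu> (x + \<i> ^ k *\<^sub>C z))) / 4"
proof -
  have "cinner z (\<Phi> (trunc f n) x)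
      = (\<Sum>k<4::nat. \<i> ^ k * complex_of_real (\<integral>t. trunc f n t \<partial>\<mu> (x + \<i> ^ k *\<^sub>C z))) / 4" for n
    by (subst sesquilinear_polarization[OF \<Phi>_clinear[OF bounded_borel_trunc[OF f]]])
      (simp only: \<Phi>_quadratic[OF bounded_borel_trunc[OF f]])
  then show ?thesis
    by (simp only:) (intro tendsto_intros integral_trunc_tendsto f domain_add_scaleC x z, simp)
qed

lemma spectral_pair_domain:
  assumes f: "f \<in> borel_measurable borel" and xy: "spectral_pair f x y"
  shows "x \<in> spectral_integral_domain E f"
proof -
  have "\<Phi> (trunc f n) x = E (cut f n) y" for n
    by (rule spectral_pair_trunc[OF f xy, symmetric])
  then have "(norm (\<Phi> (trunc f n) x))\<^sup>2 \<le> (norm y)\<^sup>2" for n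
    using norm_E_le[OF cut_borel[OF f]] by (simp add: power_mono)
  then show ?thesis unfolding domain_iff[OF f] by blast
qed

lemma spectral_integral_iff:
  assumes f: "f \<in> borel_measurable borel"
  shows "(x, y) \<in> spectral_integral E f \<longleftrightarrow> spectral_pair f x y"
proof
  assume xy: "spectral_pair f x y"
  then have x: "x \<in> spectral_integral_domain E f" by (rule spectral_pair_domain[OF f])
  have eq: "\<Phi> (trunc f n) x = E (cut f n) y" for n
    by (rule spectral_pair_trunc[OF f xy, symmetric])
  have "cinner z y = (\<Sum>k<4::nat. \<i> ^ k * complex_of_real (\<integral>t. f t \<partial>\<mu> (x + \<i> ^ k *\<^sub>C z))) / 4"
    if z: "z \<in> spectral_integral_domain E f" for z
  proof (rule LIMSEQ_unique[OF _ cinner_trunc_tendsto[OF f x z]])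
    show "(\<lambda>n. cinner z (\<Phi> (trunc f n) x)) \<longlonglongrightarrow> cinner z y"
      unfolding eq by (intro tendsto_cinner tendsto_const E_tendsto cut_borel f incseq_cut UN_cut)
  qed
  then show "(x, y) \<in> spectral_integral E f"
    using x unfolding spectral_integral_def by blast
next
  assume "(x, y) \<in> spectral_integral E f"
  then have x: "x \<in> spectral_integral_domain E f"
    and y: "\<And>z. z \<in> spectral_integral_domain E f \<Longrightarrow>
      cinner z y = (\<Sum>k<4::nat. \<i> ^ k * complex_of_real (\<integral>t. f t \<partial>\<mu> (x + \<i> ^ k *\<^sub>C z))) / 4"
    unfolding spectral_integral_def by blast+
  show "spectral_pair f x y"
  proof (rule spectral_pair_truncI[OF f])
    fix n
    show "E (cut f n) y = \<Phi> (trunc f n) x"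
    proof (rule cinner_eqI)
      fix z'
      \<comment> \<open>The defining identity of y is available for test vectors in the domain. For
        arbitrary z' the vector z is one: applying \<open>trunc f k\<close> to z amounts to applying
        \<open>trunc f (min k n)\<close> to z', so the norms stay bounded in k, and the sequence is
        stationary from k = n on.\<close>
      define z where "z = E (cut f n) z'"
      have prod: "(\<lambda>t. trunc f k t * indicator (cut f n) t) = trunc f (min k n)" for k
        by (auto simp: indicator_def cut_def fun_eq_iff)
      have zE: "\<Phi> (trunc f k) z = \<Phi> (trunc f (min k n)) z'" for k
        unfolding z_def by (simp only: \<Phi>_E[OF bounded_borel_trunc[OF f] cut_borel[OF f]] prod)
      have "norm (\<Phi> (trunc f k) z) \<le> norm (\<Phi> (trunc f n) z')" for k
        unfolding zE by (rule \<Phi>_norm_le[OF bounded_borel_trunc[OF f] bounded_borel_trunc[OF f]])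
            (auto simp: indicator_def cut_def)
      then have "(norm (\<Phi> (trunc f k) z))\<^sup>2 \<le> (norm (\<Phi> (trunc f n) z'))\<^sup>2" for k
        by (simp add: power_mono)
      then have z: "z \<in> spectral_integral_domain E f"
        unfolding domain_iff[OF f] by blast
      have "(\<lambda>k. cinner z (\<Phi> (trunc f k) x)) \<longlonglongrightarrow> cinner z y"
        unfolding y[OF z] by (rule cinner_trunc_tendsto[OF f x z])
      moreover have "cinner z (\<Phi> (trunc f k) x) = cinner z' (\<Phi> (trunc f (min k n)) x)" for k
        unfolding z_def
        by (simp only: E_sym[OF cut_borel[OF f]] E_\<Phi>[OF bounded_borel_trunc[OF f] cut_borel[OF f]]
            \<Phi>_E[OF bounded_borel_trunc[OF f] cut_borel[OF f]] prod)
      ultimately have "(\<lambda>k. cinner z' (\<Phi> (trunc f (min k n)) x)) \<longlonglongrightarrow> cinner z y"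
        by simp
      moreover have "(\<lambda>k. cinner z' (\<Phi> (trunc f (min k n)) x)) \<longlonglongrightarrow> cinner z' (\<Phi> (trunc f n) x)"
      proof (rule tendsto_eventually)
        show "\<forall>\<^sub>F k in sequentially.
            cinner z' (\<Phi> (trunc f (min k n)) x) = cinner z' (\<Phi> (trunc f n) x)"
          using eventually_ge_at_top[of n] by eventually_elim (simp add: min_absorb2)
      qed
      ultimately have "cinner z y = cinner z' (\<Phi> (trunc f n) x)"
        by (rule LIMSEQ_unique)
      then show "cinner z' (E (cut f n) y) = cinner z' (\<Phi> (trunc f n) x)"
        by (simp add: z_def E_sym cut_borel f)
    qed
  qed
qed

lemma spectral_integral_linear:
  assumes f: "f \<in> borel_measurable borel"
    and "(x, y) \<in> spectral_integral E f" "(x', y') \<in> spectral_integral E f"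
  shows "(c *\<^sub>C x + x', c *\<^sub>C y + y') \<in> spectral_integral E f"
  unfolding spectral_integral_iff[OF f] spectral_pair_def
proof (intro ballI impI)
  fix S :: "real set" assume S: "S \<in> sets borel" "\<exists>M. \<forall>t\<in>S. \<bar>f t\<bar> \<le> M"
  then have "bounded_borel (\<lambda>t. f t * indicator S t)"
    using bounded_borel_cut[OF f] by blast
  moreover have "E S y = \<Phi> (\<lambda>t. f t * indicator S t) x" "E S y' = \<Phi> (\<lambda>t. f t * indicator S t) x'"
    using assms(2,3) S unfolding spectral_integral_iff[OF f] spectral_pair_def by blast+
  ultimately show "E S (c *\<^sub>C y + y') = \<Phi> (\<lambda>t. f t * indicator S t) (c *\<^sub>C x + x')"
    using E_clinear[OF S(1)] \<Phi>_clinear by (simp add: clinear_add clinear_scaleC)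
qed

lemma spectral_integral_cut:
  assumes "f \<in> borel_measurable borel" "(x, y) \<in> spectral_integral E f"
    and "S \<in> sets borel" "\<And>t. t \<in> S \<Longrightarrow> \<bar>f t\<bar> \<le> M"
  shows "E S y = \<Phi> (\<lambda>t. f t * indicator S t) x"
  using assms spectral_pairD unfolding spectral_integral_iff[OF assms(1)] by blast

lemma spectral_integral_E:
  assumes f: "f \<in> borel_measurable borel" and xy: "(x, y) \<in> spectral_integral E f"
    and S: "S \<in> sets borel"
  shows "(E S x, E S y) \<in> spectral_integral E f"
  unfolding spectral_integral_iff[OF f]
proof (rule spectral_pair_truncI[OF f])
  fix n
  have "E (cut f n) (E S y) = E S (E (cut f n) y)"
    by (simp add: E_inter S cut_borel f Int_commute)
  also have "\<dots> = E S (\<Phi> (trunc f n) x)"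
    using xy by (simp only: spectral_integral_iff[OF f] spectral_pair_trunc[OF f])
  finally show "E (cut f n) (E S y) = \<Phi> (trunc f n) (E S x)"
    by (simp add: E_\<Phi> S bounded_borel_trunc f)
qed

lemma spectral_integral_E_cut:
  assumes f: "f \<in> borel_measurable borel" and S: "S \<in> sets borel"
    and M: "\<And>t. t \<in> S \<Longrightarrow> \<bar>f t\<bar> \<le> M"
  shows "(E S x, \<Phi> (\<lambda>t. f t * indicator S t) x) \<in> spectral_integral E f"
  unfolding spectral_integral_iff[OF f]
proof (rule spectral_pair_truncI[OF f])
  fix n
  have "(\<lambda>t. f t * indicator S t * indicator (cut f n) t) = (\<lambda>t. trunc f n t * indicator S t)"
    by (simp add: ac_simps)
  then show "E (cut f n) (\<Phi> (\<lambda>t. f t * indicator S t) x) = \<Phi> (trunc f n) (E S x)"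
    using bounded_borel_cut[OF f S M] bounded_borel_trunc[OF f, of n] S cut_borel[OF f, of n]
    by (simp only: E_\<Phi> \<Phi>_E)
qed

lemma spectral_integral_zero:
  assumes f: "f \<in> borel_measurable borel" and "(0, y) \<in> spectral_integral E f"
  shows "y = 0"
proof -
  have "E (cut f n) y = 0" for n
    using spectral_pair_trunc[OF f, of 0 y n] assms(2) clinear_zero[OF \<Phi>_clinear[OF bounded_borel_trunc[OF f]]]
    unfolding spectral_integral_iff[OF f] by simp
  then show ?thesis
    using E_tendsto[OF cut_borel[OF f] incseq_cut UN_cut, of y] by (simp add: LIMSEQ_const_iff)
qed

lemma E_zero: "S \<in> sets borel \<Longrightarrow> E S 0 = 0"
  by (rule clinear_zero[OF E_clinear])

lemma E_Un_disjoint: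
  assumes "S \<in> sets borel" "S' \<in> sets borel" "S \<inter> S' = {}"
  shows "E (S \<union> S') x = E S x + E S' x"
proof -
  have "indicator (S \<union> S') = (\<lambda>t. indicator S t + indicator S' t :: real)"
    using assms(3) by (auto simp: indicator_def fun_eq_iff)
  then have "\<Phi> (indicator (S \<union> S')) x = \<Phi> (indicator S) x + \<Phi> (indicator S') x"
    using assms by (simp only: \<Phi>_add bounded_borel_indicator)
  then show ?thesis
    using assms by (simp only: \<Phi>_indicator sets.Un)
qed

text \<open>The sets in \<open>zero\<close>, united with B, increase to the whole line. Their clause
  on |t| keeps the identity function bounded, as both uses require: h t = \<alpha> - t locates the
  support of E, and h t = |t - p| the spectral support of an eigenvector.\<close>

lemma E_eq_self:
  assumes h: "h \<in> borel_measurable borel" and B: "B \<in> sets borel" "\<And>t. t \<in> B \<longleftrightarrow> h t \<le> 0"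
    and zero: "\<And>n::nat. E {t. \<bar>t\<bar> \<le> real n \<and> 1 / Suc n \<le> h t} x = 0"
  shows "E B x = x"
proof -
  note [measurable] = h
  define G where "G n = {t. \<bar>t\<bar> \<le> real n \<and> 1 / Suc n \<le> h t}" for n :: nat
  have G: "G n \<in> sets borel" for n
    unfolding G_def by measurable
  let ?F = "\<lambda>n. G n \<union> B"
  have "(\<lambda>n. E (?F n) x) \<longlonglongrightarrow> x"
  proof (rule E_tendsto)
    show "incseq ?F"
      unfolding incseq_def
    proof (intro allI impI subsetI)
      fix m n :: nat and t assume mn: "m \<le> n" and t: "t \<in> ?F m"
      have "1 / real (Suc n) \<le> 1 / real (Suc m)"
        using mn by (intro divide_left_mono) auto
      then show "t \<in> ?F n"
        using mn t by (auto simp: G_def)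
    qed
    have "\<exists>n. t \<in> ?F n" for t
    proof (cases "t \<in> B")
      case False
      then obtain m where m: "1 / Suc m < h t"
        using nat_approx_posE[of "h t"] B(2) by auto
      obtain k :: nat where k: "\<bar>t\<bar> \<le> k" using real_arch_simple by blast
      have "1 / real (Suc (max m k)) \<le> 1 / real (Suc m)"
        by (intro divide_left_mono) auto
      then have "t \<in> ?F (max m k)"
        using m k by (auto simp: G_def)
      then show ?thesis by blast
    qed auto
    then show "(\<Union>n. ?F n) = UNIV" by blast
  qed (use G B in auto)
  moreover have "E (?F n) x = E B x" for n
  proof -
    have "t \<notin> B" if "t \<in> G n" for t
    proof -
      have "0 < 1 / real (Suc n)" by simp
      also have "\<dots> \<le> h t" using that by (simp add: G_def)
      finally show ?thesis by (simp add: B(2))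
    qed
    then have "G n \<inter> B = {}" by blast
    then show ?thesis
      using E_Un_disjoint[OF G B(1)] zero[of n] by (simp add: G_def)
  qed
  ultimately show ?thesis
    by (simp add: LIMSEQ_const_iff)
qed

text \<open>Lindelof: countably many of the neighbourhoods cover S, and a countable union of null
  sets of \<open>\<mu> x\<close> is null.\<close>

lemma E_locally_null:
  assumes S: "S \<in> sets borel"
    and loc: "\<And>p. p \<in> S \<Longrightarrow> \<exists>U. open U \<and> p \<in> U \<and> E (U \<inter> S) x = 0"
  shows "E S x = 0"
proof -
  define C where "C = {U. open U \<and> E (U \<inter> S) x = 0}"
  obtain D where D: "D \<subseteq> C" "countable D" "\<Union>D = \<Union>C"
    using Lindelof[of C] unfolding C_def by blast
  have "(\<Union>U\<in>D. U \<inter> S) \<in> null_sets (\<mu> x)"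
  proof (rule null_sets_UN'[OF D(2)])
    fix U assume "U \<in> D"
    then show "U \<inter> S \<in> null_sets (\<mu> x)"
      using D(1) S by (auto simp: C_def null_sets_def emeasure_\<mu>)
  qed
  moreover have "(\<Union>U\<in>D. U \<inter> S) = S"
  proof -
    have "S \<subseteq> \<Union>C" using loc by (force simp: C_def)
    then show ?thesis using D(3) by blast
  qed
  ultimately show ?thesis
    using S by (simp add: null_sets_def emeasure_\<mu>)
qed

lemma \<Phi>_cong_full:
  assumes B: "B \<in> sets borel" "\<And>v. E B v = v"
    and "bounded_borel f" "bounded_borel g" "\<And>t. t \<in> B \<Longrightarrow> f t = g t"
  shows "\<Phi> f x = \<Phi> g x"
proof -
  have "(\<lambda>t. f t * indicator B t) = (\<lambda>t. g t * indicator B t)"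
    using assms(5) by (auto simp: indicator_def)
  then have "\<Phi> f (E B x) = \<Phi> g (E B x)"
    by (simp only: \<Phi>_E[OF assms(3,1)] \<Phi>_E[OF assms(4,1)])
  then show ?thesis by (simp add: B)
qed

text \<open>The exhausting sets are those where f and h are both bounded by n. Equality of h with g
  f is asked for only on a set B of full spectral measure, so that g may be cut off outside B; this
  is how the negative powers become bounded.\<close>

lemma spectral_integral_mult:
  assumes f: "f \<in> borel_measurable borel" and xy: "(x, y) \<in> spectral_integral E f"
    and g: "bounded_borel g" and h: "h \<in> borel_measurable borel"
    and B: "B \<in> sets borel" "\<And>v. E B v = v" "\<And>t. t \<in> B \<Longrightarrow> h t = g t * f t"
  shows "(x, \<Phi> g y) \<in> spectral_integral E h"
  unfolding spectral_integral_iff[OF h]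
proof (rule spectral_pair_exhaust[OF h])
  let ?F = "\<lambda>n. cut f n \<inter> cut h n"
  show F: "?F n \<in> sets borel" for n
    using cut_borel f h by auto
  show "incseq ?F"
    using incseq_cut[of f] incseq_cut[of h] unfolding incseq_def by blast
  show "(\<Union>n. ?F n) = UNIV"
  proof -
    have "t \<in> ?F (nat \<lceil>max \<bar>f t\<bar> \<bar>h t\<bar>\<rceil>)" for t
      by (auto simp: cut_def) linarith+
    then show ?thesis by blast
  qed
  show "\<bar>h t\<bar> \<le> real n" if "t \<in> ?F n" for n t
    using that cut_bound by auto
  fix n
  have fb: "bounded_borel (\<lambda>t. f t * indicator (?F n) t)" and hb: "bounded_borel (\<lambda>t. h t * indicator (?F n) t)"
    using cut_bound by (auto intro!: bounded_borel_cut[OF _ F, where M = "real n"] f h)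
  have "E (?F n) (\<Phi> g y) = \<Phi> g (E (?F n) y)"
    by (rule E_\<Phi>[OF g F])
  also have "\<dots> = \<Phi> g (\<Phi> (\<lambda>t. f t * indicator (?F n) t) x)"
    using spectral_integral_cut[OF f xy F, of n "real n"] cut_bound by auto
  also have "\<dots> = \<Phi> (\<lambda>t. g t * (f t * indicator (?F n) t)) x"
    by (rule \<Phi>_mult[OF g fb, symmetric])
  also have "\<dots> = \<Phi> (\<lambda>t. h t * indicator (?F n) t) x"
    by (rule \<Phi>_cong_full[OF B(1,2)]) (use B(3) in \<open>auto intro: bounded_borel_mult g fb hb\<close>)
  finally show "E (?F n) (\<Phi> g y) = \<Phi> (\<lambda>t. h t * indicator (?F n) t) x" .
qed

end

section \<open>Uniqueness of the spectral measure\<close>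

locale spectral_op = pvm E for E :: "real set \<Rightarrow> 'a::complex_hilbert \<Rightarrow> 'a" +
  fixes A :: "'a operator" and \<alpha> :: real
  assumes A_eq: "spectral_integral E (\<lambda>t. t) = A"
    and \<alpha>_pos: "\<alpha> > 0"
    and A_ge: "(x, y) \<in> A \<Longrightarrow> Re (cinner y x) \<ge> \<alpha> * (norm x)\<^sup>2"
begin

lemma A_pair: "(x, y) \<in> A \<longleftrightarrow> spectral_pair (\<lambda>t. t) x y"
  unfolding A_eq[symmetric] by (rule spectral_integral_iff) simp

lemma A_linear: "(x, y) \<in> A \<Longrightarrow> (x', y') \<in> A \<Longrightarrow> (c *\<^sub>C x + x', c *\<^sub>C y + y') \<in> A"
  unfolding A_eq[symmetric] by (rule spectral_integral_linear) simp_all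

lemma A_diff: "(x, y) \<in> A \<Longrightarrow> (x', y') \<in> A \<Longrightarrow> (x - x', y - y') \<in> A"
  using A_linear[of x' y' x y "-1"] by simp

lemma A_kernel: "(x, 0) \<in> A \<Longrightarrow> x = 0"
  using A_ge[of x 0] \<alpha>_pos by (simp add: mult_le_0_iff)

text \<open>For bounded S the vector \<open>E S v\<close> lies in the domain of A, and its energy is
  the integral of t over S, at most c times its squared norm. Positivity of A bounds the energy from
  below by \<alpha> times the same number.\<close>

lemma E_below:
  assumes "c < \<alpha>" "S \<in> sets borel" "S \<subseteq> {-M..c}"
  shows "E S v = 0"
proof -
  have b: "\<bar>t\<bar> \<le> max \<bar>M\<bar> \<bar>c\<bar>" if "t \<in> S" for t
  proof -
    have "-M \<le> t" "t \<le> c" using assms(3) that by auto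
    then show ?thesis by linarith
  qed
  have bb: "bounded_borel (\<lambda>t. t * indicator S t)"
    by (rule bounded_borel_cut[OF _ assms(2) b]) simp_all
  let ?y = "\<Phi> (\<lambda>t. t * indicator S t) v"
  have "(E S v, ?y) \<in> A"
    unfolding A_eq[symmetric] by (rule spectral_integral_E_cut[OF _ assms(2) b]) simp_all
  then have "\<alpha> * (norm (E S v))\<^sup>2 \<le> Re (cinner ?y (E S v))"
    by (rule A_ge)
  also have "cinner ?y (E S v) = cinner v (\<Phi> (\<lambda>t. t * indicator S t) (E S v))"
    by (rule \<Phi>_sym[OF bb])
  also have "\<dots> = cinner v ?y"
    unfolding \<Phi>_E[OF bb assms(2)] by (simp add: mult.assoc indicator_inter_arith[symmetric])
  also have "\<dots> = complex_of_real (\<integral>t. t * indicator S t \<partial>\<mu> v)"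
    by (rule \<Phi>_quadratic[OF bb])
  also have "Re \<dots> \<le> (\<integral>t. c * indicator S t \<partial>\<mu> v)"
  proof -
    have "bounded_borel (\<lambda>t. c * indicator S t)"
      by (intro bounded_borel_mult bounded_borel_const bounded_borel_indicator assms)
    then show ?thesis
      using assms(3) unfolding Re_complex_of_real
      by (intro integral_mono integrable_bounded_borel bb) (auto simp: indicator_def)
  qed
  also have "\<dots> = c * (norm (E S v))\<^sup>2"
    using assms(2) by (simp add: measure_\<mu>)
  finally have "(\<alpha> - c) * (norm (E S v))\<^sup>2 \<le> 0"
    by (simp add: algebra_simps)
  then show ?thesis
    using assms(1) by (simp add: mult_le_0_iff)
qed

lemma E_full: "E {\<alpha>..} v = v"
proof (rule E_eq_self[where h = "\<lambda>t. \<alpha> - t"])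
  fix n :: nat
  show "E {t. \<bar>t\<bar> \<le> real n \<and> 1 / Suc n \<le> \<alpha> - t} v = 0"
    by (rule E_below[where c = "\<alpha> - 1 / Suc n" and M = n]) auto
qed auto

text \<open>The symbol of A^(-s), set to zero below \<alpha>. As E lives on {\<alpha>..}, the cutoff
  does not affect the operator, but for s \<ge> 0 it makes the function bounded.\<close>

definition negpow :: "real \<Rightarrow> real \<Rightarrow> real" where
  "negpow s t = t powr (- s) * indicator {\<alpha>..} t"

lemma negpow_bounds:
  assumes "0 \<le> s"
  shows "0 \<le> negpow s t" "negpow s t \<le> \<alpha> powr (- s)"
  using \<alpha>_pos assms by (auto simp: negpow_def indicator_def powr_minus le_imp_inverse_le powr_mono2)

lemma bounded_borel_negpow: "0 \<le> s \<Longrightarrow> bounded_borel (negpow s)"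
  by (rule bounded_borelI[where M = "\<alpha> powr (- s)"]) (use negpow_bounds in \<open>auto simp: negpow_def[abs_def]\<close>)

lemma A_inverse: "(\<Phi> (negpow 1) y, y) \<in> A"
  unfolding A_pair
proof (rule spectral_pair_truncI)
  fix n
  let ?c = "cut (\<lambda>t. t) n"
  have c: "?c \<in> sets borel" by (rule cut_borel) simp
  have "\<Phi> (trunc (\<lambda>t. t) n) (\<Phi> (negpow 1) y) = \<Phi> (\<lambda>t. t * indicator ?c t * negpow 1 t) y"
    by (rule \<Phi>_mult[symmetric]) (simp_all add: bounded_borel_trunc bounded_borel_negpow)
  also have "\<dots> = \<Phi> (indicator ?c) y"
  proof (rule \<Phi>_cong_full[OF _ E_full])
    show "bounded_borel (\<lambda>t. t * indicator ?c t * negpow 1 t)"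
      by (intro bounded_borel_mult bounded_borel_trunc bounded_borel_negpow) simp_all
    show "t * indicator ?c t * negpow 1 t = indicator ?c t" if "t \<in> {\<alpha>..}" for t
      using that \<alpha>_pos by (simp add: negpow_def powr_minus)
  qed (simp_all add: bounded_borel_indicator c)
  finally show "E ?c y = \<Phi> (trunc (\<lambda>t. t) n) (\<Phi> (negpow 1) y)"
    by (simp add: \<Phi>_indicator c)
qed simp

end

text \<open>The powers of \<open>A\<inverse> = \<integral> 1/t dE\<close>, hence by the Weierstrass theorem all continuous functions of
  \<open>A\<inverse>\<close>, do not depend on the choice of \<open>E\<close>.\<close>

lemma spectral_measure_unique:
  assumes "spectral_op E A \<alpha>" "spectral_op E' A \<alpha>"
  shows "scalar_measure E = scalar_measure E'"
proof -
  interpret e: spectral_op E A \<alpha> by fact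
  interpret e': spectral_op E' A \<alpha> by fact
  \<comment> \<open>The functions with equal integrals in both calculi form an algebra closed under
    bounded pointwise limits; it is enlarged step by step until it contains enough
    indicators.\<close>
  define agree where "agree f \<longleftrightarrow> bounded_borel f \<and> e.\<Phi> f = e'.\<Phi> f" for f
  have add: "agree (\<lambda>t. f t + g t)" if "agree f" "agree g" for f g
    using that unfolding agree_def by (auto simp: bounded_borel_add e.\<Phi>_add e'.\<Phi>_add fun_eq_iff)
  have mult: "agree (\<lambda>t. f t * g t)" if "agree f" "agree g" for f g
    using that unfolding agree_def by (auto simp: bounded_borel_mult e.\<Phi>_mult e'.\<Phi>_mult fun_eq_iff)
  have const: "agree (\<lambda>t. c)" for c
  proof -
    have "e.\<Phi> (\<lambda>t. c * indicator UNIV t) x = e'.\<Phi> (\<lambda>t. c * indicator UNIV t) x" for x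
      by (simp only: e.\<Phi>_scale e'.\<Phi>_scale bounded_borel_indicator sets.top[of borel, unfolded space_borel]
          e.\<Phi>_indicator e'.\<Phi>_indicator e.E_UNIV e'.E_UNIV)
    then show ?thesis
      by (auto simp: agree_def bounded_borel_const)
  qed
  have diff: "agree (\<lambda>t. f t - g t)" if "agree f" "agree g" for f g
    using add[OF that(1) mult[OF const[of "-1"] that(2)]] by simp
  have pow: "agree (\<lambda>t. f t ^ k)" if "agree f" for f and k :: nat
    by (induction k) (auto intro: mult[OF that] const)
  have sum: "agree (\<lambda>t. \<Sum>i\<in>I. f i t)" if "finite I" "\<And>i. i \<in> I \<Longrightarrow> agree (f i)" for I :: "nat set" and f
    using that by (induction rule: finite_induct) (auto intro: add const)
  have lim: "agree g" if f: "\<And>n::nat. agree (f n)" and M: "\<And>n t. \<bar>f n t\<bar> \<le> M"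
    and l: "\<And>t. (\<lambda>n. f n t) \<longlonglongrightarrow> g t" for f g M
  proof -
    have fb: "\<And>n. bounded_borel (f n)" and eq: "\<And>n. e.\<Phi> (f n) = e'.\<Phi> (f n)"
      using f unfolding agree_def by auto
    have "\<bar>g t\<bar> \<le> M" for t
      by (rule tendsto_upperbound[OF tendsto_rabs[OF l]]) (use M in auto)
    moreover have "g \<in> borel_measurable borel"
      by (rule borel_measurable_LIMSEQ_real[OF l]) (use fb bounded_borel_measurable in auto)
    moreover have "e.\<Phi> g x = e'.\<Phi> g x" for x
      using e.\<Phi>_tendsto[OF fb M l, of x] e'.\<Phi>_tendsto[OF fb M l, of x] LIMSEQ_unique
      unfolding eq by blast
    ultimately show ?thesis
      unfolding agree_def fun_eq_iff by (intro conjI allI bounded_borelI[of g M])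
  qed
  \<comment> \<open>\<open>negpow\<close> depends on \<alpha> alone, so both calculi integrate the
    same function. Both results invert A, and their difference lies in the kernel of A, which is
    trivial.\<close>
  have inv: "agree (e.negpow 1)"
  proof -
    have "e.\<Phi> (e.negpow 1) y = e'.\<Phi> (e.negpow 1) y" for y
    proof -
      have "(e'.\<Phi> (e.negpow 1) y, y) \<in> A"
        by (rule e'.A_inverse)
      then have "(e.\<Phi> (e.negpow 1) y - e'.\<Phi> (e.negpow 1) y, 0) \<in> A"
        using e.A_diff[OF e.A_inverse[of y]] by fastforce
      then show ?thesis
        using e.A_kernel by (metis eq_iff_diff_eq_0)
    qed
    then show ?thesis
      by (auto simp: agree_def e.bounded_borel_negpow)
  qed
  \<comment> \<open>Rescaled to the unit interval, where the Bernstein polynomials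
    approximate.\<close>
  define k where "k t = \<alpha> * e.negpow 1 t" for t
  have k: "agree k"
    unfolding k_def[abs_def] by (intro mult const inv)
  have k01: "k t \<in> {0..1}" for t
  proof -
    have "\<alpha> * e.negpow 1 t \<le> \<alpha> * \<alpha> powr (- 1)"
      using e.negpow_bounds[of 1 t] e.\<alpha>_pos by (intro mult_left_mono) auto
    then show ?thesis
      using e.negpow_bounds[of 1 t] e.\<alpha>_pos by (simp add: k_def powr_minus)
  qed
  have cont: "agree (\<lambda>t. g (k t))" if g: "continuous_on {0..1} g" for g
  proof -
    define p where "p n s = (\<Sum>i\<le>n. g (i / n) * Bernstein n i s)" for n s
    have "\<exists>N. \<forall>n s. N \<le> n \<and> s \<in> {0..1} \<longrightarrow> \<bar>g s - p n s\<bar> < 1 / Suc m" for m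
      unfolding p_def by (rule Bernstein_Weierstrass[OF g]) simp
    then obtain r where r: "\<And>m s. s \<in> {0..1} \<Longrightarrow> \<bar>g s - p (r m) s\<bar> < 1 / Suc m"
      by (metis order_refl)
    obtain M where M: "\<And>s. s \<in> {0..1} \<Longrightarrow> \<bar>g s\<bar> \<le> M"
      using compact_imp_bounded[OF compact_continuous_image[OF g compact_Icc]]
      unfolding bounded_iff by (metis imageI real_norm_def)
    show ?thesis
    proof (rule lim)
      show "agree (\<lambda>t. p (r m) (k t))" for m
        unfolding p_def Bernstein_def by (intro sum mult const pow diff k) simp
      show "\<bar>p (r m) (k t)\<bar> \<le> M + 1" for m t
      proof -
        have "1 / real (Suc m) \<le> 1" by simp
        then show ?thesis
          using r[OF k01, of t m] M[OF k01, of t] by linarith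
      qed
      show "(\<lambda>m. p (r m) (k t)) \<longlonglongrightarrow> g (k t)" for t
      proof (rule LIMSEQ_I)
        fix \<epsilon> :: real assume "\<epsilon> > 0"
        then obtain N where N: "1 / Suc N < \<epsilon>" using nat_approx_posE by blast
        have "norm (p (r m) (k t) - g (k t)) < \<epsilon>" if "m \<ge> N" for m
        proof -
          have "1 / real (Suc m) \<le> 1 / real (Suc N)"
            using that by (intro divide_left_mono) auto
          then show ?thesis
            using r[OF k01, of t m] N by simp
        qed
        then show "\<exists>N. \<forall>m\<ge>N. norm (p (r m) (k t) - g (k t)) < \<epsilon>" by blast
      qed
    qed
  qed
  have ind: "agree (indicator {t. k t < c})" for c
  proof (rule lim)
    \<comment> \<open>Ramps of slope m that vanish from c on, so that their limit is the indicator
      of the strict inequality.\<close>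
    let ?g = "\<lambda>m s. min 1 (max 0 (real m * (c - s)))"
    show "agree (\<lambda>t. ?g m (k t))" for m
      by (rule cont) (intro continuous_intros)
    show "\<bar>?g m (k t)\<bar> \<le> 1" for m t
      by auto
    show "(\<lambda>m. ?g m (k t)) \<longlonglongrightarrow> indicator {t. k t < c} t" for t
    proof (cases "k t < c")
      case True
      obtain N :: nat where N: "1 / (c - k t) \<le> N" using real_arch_simple by blast
      have "?g m (k t) = 1" if "m \<ge> N" for m
      proof -
        have "1 / (c - k t) \<le> m" using N that by linarith
        then show ?thesis using True by (simp add: divide_le_eq min_def max_def)
      qed
      then have "\<forall>\<^sub>F m in sequentially. ?g m (k t) = 1"
        unfolding eventually_sequentially by blast
      then show ?thesis
        using True by (simp add: tendsto_eventually)
    next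
      case False
      then have "?g m (k t) = 0" for m
        using mult_nonneg_nonpos[of "real m" "c - k t"] by simp
      then show ?thesis using False by simp
    qed
  qed
  have ray: "E {x<..} v = E' {x<..} v" for x v
  proof (cases "x < \<alpha>")
    case True
    then have "{x<..} \<inter> {\<alpha>..} = {\<alpha>..}" by auto
    then have "E {x<..} (E {\<alpha>..} v) = E {\<alpha>..} v" "E' {x<..} (E' {\<alpha>..} v) = E' {\<alpha>..} v"
      by (simp_all add: e.E_inter e'.E_inter)
    then show ?thesis by (simp add: e.E_full e'.E_full)
  next
    case False
    \<comment> \<open>On {\<alpha>..} one has k t = \<alpha> / t, so k t < \<alpha> / x says t > x.
      Below \<alpha>, where k vanishes, the inequality holds as well; hence the intersection with
      the full set {\<alpha>..}.\<close>
    let ?S = "{t. k t < \<alpha> / x}"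
    have S: "?S \<in> sets borel"
      using k unfolding agree_def by (auto dest: bounded_borel_measurable)
    have "?S \<inter> {\<alpha>..} = {x<..} \<inter> {\<alpha>..}"
      using False e.\<alpha>_pos by (auto simp: k_def e.negpow_def powr_minus field_simps)
    then have "E {x<..} (E {\<alpha>..} v) = E ?S (E {\<alpha>..} v)" "E' {x<..} (E' {\<alpha>..} v) = E' ?S (E' {\<alpha>..} v)"
      using S by (simp_all add: e.E_inter e'.E_inter)
    moreover have "E ?S v = E' ?S v"
      using ind[of "\<alpha> / x"] S by (simp add: agree_def e.\<Phi>_indicator e'.\<Phi>_indicator)
    ultimately show ?thesis by (simp add: e.E_full e'.E_full)
  qed
  show ?thesis
  proof
    fix v
    show "scalar_measure E v = scalar_measure E' v"
      by (rule measure_eqI_lessThan) (simp_all add: e.emeasure_\<mu> e'.emeasure_\<mu> ray)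
  qed
qed

section \<open>Powers, eigenvectors and the resolvent set\<close>

context spectral_op
begin

lemma spectral_measure_of_A: "spectral_measure_of A E"
  using pvm A_eq by (simp add: spectral_measure_of_def)

text \<open>\<open>op_power\<close> is a union over all spectral measures of A. Each of them
  contributes the same operator, because \<open>spectral_integral\<close> sees a measure only
  through its scalar measures.\<close>

lemma op_power_eq: "op_power A \<tau> = spectral_integral E (\<lambda>t. t powr \<tau>)"
proof -
  have "spectral_integral E' (\<lambda>t. t powr \<tau>) = spectral_integral E (\<lambda>t. t powr \<tau>)"
    if "spectral_measure_of A E'" for E'
  proof -
    have "spectral_op E' A \<alpha>"
      using that \<alpha>_pos A_ge by unfold_locales (auto simp: spectral_measure_of_def)
    then have "scalar_measure E' = scalar_measure E"
      by (rule spectral_measure_unique) (rule spectral_op_axioms)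
    then show ?thesis
      unfolding spectral_integral_def spectral_integral_domain_def by simp
  qed
  then have "(\<exists>E'. spectral_measure_of A E' \<and> (x, y) \<in> spectral_integral E' (\<lambda>t. t powr \<tau>)) \<longleftrightarrow>
      (x, y) \<in> spectral_integral E (\<lambda>t. t powr \<tau>)" for x y
    using spectral_measure_of_A by metis
  then show ?thesis
    unfolding op_power_def by auto
qed

lemma powr_measurable: "(\<lambda>t::real. t powr \<tau>) \<in> borel_measurable borel"
  by measurable

lemma op_power_linear:
  "(x, y) \<in> op_power A \<tau> \<Longrightarrow> (x', y') \<in> op_power A \<tau> \<Longrightarrow> (c *\<^sub>C x + x', c *\<^sub>C y + y') \<in> op_power A \<tau>"
  unfolding op_power_eq by (rule spectral_integral_linear[OF powr_measurable])

text \<open>A^(-s) is bounded, so domains shrink as the exponent grows, and a lower power of A is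
  computed from a higher one.\<close>

lemma op_power_lower:
  assumes "(x, y) \<in> op_power A \<tau>" "0 \<le> s"
  shows "(x, \<Phi> (negpow s) y) \<in> op_power A (\<tau> - s)"
  unfolding op_power_eq
proof (rule spectral_integral_mult[OF powr_measurable])
  show "(x, y) \<in> spectral_integral E (\<lambda>t. t powr \<tau>)"
    using assms unfolding op_power_eq by blast
  show "t powr (\<tau> - s) = negpow s t * t powr \<tau>" if "t \<in> {\<alpha>..}" for t
    using that \<alpha>_pos by (simp add: negpow_def powr_diff powr_minus field_simps)
qed (use assms in \<open>simp_all add: bounded_borel_negpow E_full\<close>)

text \<open>Since E commutes with the powers, y has no spectral mass below \<sigma> either, and on
  {\<sigma>..} the function t^(-s) is at most \<sigma>^(-s). The case s = 1/2 is the seed of the gap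
  inequality.\<close>

lemma op_power_lower_norm:
  assumes xy: "(x, y) \<in> op_power A \<tau>" and x: "E {..<\<sigma>} x = 0" and "0 \<le> s" "0 < \<sigma>"
  shows "norm (\<Phi> (negpow s) y) \<le> \<sigma> powr (- s) * norm y"
proof -
  have "(0, E {..<\<sigma>} y) \<in> spectral_integral E (\<lambda>t. t powr \<tau>)"
    using spectral_integral_E[OF powr_measurable, of x y \<tau> "{..<\<sigma>}"] xy x
    by (simp add: op_power_eq)
  then have "E {..<\<sigma>} y = 0"
    by (rule spectral_integral_zero[OF powr_measurable])
  moreover have "{..<\<sigma>} \<union> {\<sigma>..} = UNIV" by auto
  ultimately have y: "E {\<sigma>..} y = y"
    using E_Un_disjoint[of "{..<\<sigma>}" "{\<sigma>..}" y] E_UNIV[of y] by (simp add: disjoint_iff)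
  have "\<Phi> (negpow s) y = \<Phi> (\<lambda>t. negpow s t * indicator {\<sigma>..} t) y"
    using \<Phi>_E[OF bounded_borel_negpow[OF \<open>0 \<le> s\<close>], of "{\<sigma>..}" y] y by simp
  also have "norm \<dots> \<le> \<sigma> powr (- s) * norm y"
  proof (rule \<Phi>_norm_le_const)
    show "bounded_borel (\<lambda>t. negpow s t * indicator {\<sigma>..} t)"
      by (intro bounded_borel_mult bounded_borel_negpow bounded_borel_indicator assms) simp
    show "\<bar>negpow s t * indicator {\<sigma>..} t\<bar> \<le> \<sigma> powr (- s)" for t
      using assms(3,4)
      by (auto simp: negpow_def indicator_def powr_minus intro!: le_imp_inverse_le powr_mono2)
  qed
  finally show ?thesis .
qed

lemma E_below_zero: "E {..<\<alpha>} x = 0"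
proof -
  have "{..<\<alpha>} \<inter> {\<alpha>..} = {}" by auto
  then show ?thesis
    using E_inter[of "{..<\<alpha>}" "{\<alpha>..}" x] by (simp add: E_full E_empty)
qed

text \<open>The function t - p, cut to a bounded interval, annihilates u. Away from p it can be
  divided out: multiplication by \<open>g n\<close> turns it into the indicator of
  \<open>G n\<close>, so u has no mass on \<open>G n\<close>.\<close>

lemma eigenvector_E:
  assumes "u \<in> eigenspace A (complex_of_real p)"
  shows "E {p} u = u"
proof -
  have u: "(u, p *\<^sub>R u) \<in> A"
    using assms by (simp add: eigenspace_def scaleC_of_real)
  define G where "G n = {t. \<bar>t\<bar> \<le> real n \<and> 1 / Suc n \<le> \<bar>t - p\<bar>}" for n :: nat
  define g where "g n t = indicator (G n) t / (t - p)" for n t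
  have G: "G n \<in> sets borel" for n
    unfolding G_def by measurable
  have g: "bounded_borel (g n)" for n
  proof (rule bounded_borelI)
    show "g n \<in> borel_measurable borel"
      unfolding g_def[abs_def] using G by measurable
    show "\<bar>g n t\<bar> \<le> Suc n" for t
    proof (cases "t \<in> G n")
      case True
      then have *: "1 / real (Suc n) \<le> \<bar>t - p\<bar>"
        by (simp add: G_def)
      then have "0 < \<bar>t - p\<bar>"
        by (rule less_le_trans[rotated]) simp
      with * have "1 / \<bar>t - p\<bar> \<le> Suc n"
        by (simp add: divide_le_eq mult.commute)
      then show ?thesis
        using True by (simp add: g_def)
    qed (simp add: g_def)
  qed
  have zero: "E (G n) u = 0" for n
  proof -
    let ?S = "{-real n..real n}"
    have b: "\<bar>t\<bar> \<le> real n" if "t \<in> ?S" for t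
      using that by auto
    have t: "bounded_borel (\<lambda>t. t * indicator ?S t)"
      by (rule bounded_borel_cut[OF _ _ b]) simp_all
    have p: "bounded_borel (\<lambda>t. p * indicator ?S t)"
      by (intro bounded_borel_mult bounded_borel_const bounded_borel_indicator) simp
    have "E ?S (p *\<^sub>R u) = \<Phi> (\<lambda>t. t * indicator ?S t) u"
      by (rule spectral_pairD[OF u[unfolded A_pair] _ b]) simp_all
    moreover have "E ?S (p *\<^sub>R u) = \<Phi> (\<lambda>t. p * indicator ?S t) u"
      by (simp add: \<Phi>_scale bounded_borel_indicator \<Phi>_indicator clinear_scaleR E_clinear)
    ultimately have "\<Phi> (\<lambda>t. t * indicator ?S t - p * indicator ?S t) u = 0"
      by (simp add: \<Phi>_diff t p)
    then have "\<Phi> (\<lambda>t. g n t * (t * indicator ?S t - p * indicator ?S t)) u = 0"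
      by (simp add: \<Phi>_mult bounded_borel_diff g t p clinear_zero \<Phi>_clinear)
    also have "(\<lambda>t. g n t * (t * indicator ?S t - p * indicator ?S t)) = indicator (G n)"
      by (auto simp: fun_eq_iff g_def G_def indicator_def field_simps)
    finally show ?thesis by (simp add: \<Phi>_indicator G)
  qed
  show ?thesis
    by (rule E_eq_self[where h = "\<lambda>t. \<bar>t - p\<bar>"]) (use zero in \<open>auto simp: G_def\<close>)
qed

lemma E_singleton_eigenspace: "E {p} x \<in> eigenspace A (complex_of_real p)"
proof -
  have b: "\<bar>t\<bar> \<le> \<bar>p\<bar>" if "t \<in> {p}" for t
    using that by simp
  have "(\<lambda>t. t * indicator {p} t) = (\<lambda>t. p * indicator {p} t)"
    by (auto simp: indicator_def)
  then have "\<Phi> (\<lambda>t. t * indicator {p} t) x = p *\<^sub>R E {p} x"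
    by (simp add: \<Phi>_scale bounded_borel_indicator \<Phi>_indicator)
  then show ?thesis
    using spectral_integral_E_cut[of "\<lambda>t. t" "{p}" "\<bar>p\<bar>" x] A_eq
    by (simp add: eigenspace_def scaleC_of_real)
qed

lemma E_singleton_zero:
  assumes "\<And>v. v \<in> eigenspace A (complex_of_real p) \<Longrightarrow> cinner v x = 0"
  shows "E {p} x = 0"
proof -
  have "cinner (E {p} x) x = 0"
    by (rule assms[OF E_singleton_eigenspace])
  then have "cinner x (E {p} x) = 0"
    by (subst cinner_eq_0_commute)
  then show ?thesis by (simp add: cinner_E_self)
qed

lemma eigenvalue_ge:
  assumes "u \<in> eigenspace A (complex_of_real p)" "u \<noteq> 0"
  shows "\<alpha> \<le> p"
proof -
  have "(u, p *\<^sub>R u) \<in> A"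
    using assms by (simp add: eigenspace_def scaleC_of_real)
  from A_ge[OF this] have "\<alpha> * (norm u)\<^sup>2 \<le> p * (norm u)\<^sup>2"
    by (simp add: cinner_scaleR_left norm_sq_cinner)
  then show ?thesis using assms(2) by simp
qed

lemma eigenvector_op_power:
  assumes "u \<in> eigenspace A (complex_of_real p)"
  shows "(u, p powr \<tau> *\<^sub>R u) \<in> op_power A \<tau>"
  unfolding op_power_eq spectral_integral_iff[OF powr_measurable]
proof (rule spectral_pair_truncI[OF powr_measurable])
  fix n
  let ?f = "\<lambda>t::real. t powr \<tau>"
  let ?c = "cut ?f n"
  note Eu = eigenvector_E[OF assms]
  have c: "?c \<in> sets borel" by (rule cut_borel[OF powr_measurable])
  have "\<Phi> (trunc ?f n) u = \<Phi> (\<lambda>t. trunc ?f n t * indicator {p} t) u"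
    using \<Phi>_E[OF bounded_borel_trunc[OF powr_measurable], of "{p}" \<tau> n u] Eu by simp
  also have "(\<lambda>t. trunc ?f n t * indicator {p} t) = (\<lambda>t. p powr \<tau> * (indicator ?c t * indicator {p} t))"
    by (auto simp: indicator_def)
  also have "\<Phi> \<dots> u = p powr \<tau> *\<^sub>R E ?c (E {p} u)"
    using c by (simp add: \<Phi>_scale \<Phi>_mult bounded_borel_mult bounded_borel_indicator \<Phi>_indicator)
  finally show "E ?c (p powr \<tau> *\<^sub>R u) = \<Phi> (trunc ?f n) u"
    using c by (simp add: Eu clinear_scaleR E_clinear)
qed

text \<open>Compress to the range of \<open>E {p}\<close>, where t^\<tau> is the constant p^\<tau>,
  and use that this projection fixes u.\<close>

lemma eigenvector_cinner:
  assumes u: "u \<in> eigenspace A (complex_of_real p)" and "(x, y) \<in> op_power A \<tau>"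
  shows "cinner u y = p powr \<tau> *\<^sub>R cinner u x"
proof -
  have "(\<lambda>t::real. t powr \<tau> * indicator {p} t) = (\<lambda>t. p powr \<tau> * indicator {p} t)"
    by (auto simp: indicator_def)
  moreover have "E {p} y = \<Phi> (\<lambda>t. t powr \<tau> * indicator {p} t) x"
    using assms(2) unfolding op_power_eq
    by (rule spectral_integral_cut[OF powr_measurable, where M = "p powr \<tau>"]) auto
  ultimately have "E {p} y = p powr \<tau> *\<^sub>R E {p} x"
    by (simp add: \<Phi>_scale bounded_borel_indicator \<Phi>_indicator)
  then have "cinner u (E {p} y) = p powr \<tau> *\<^sub>R cinner u (E {p} x)"
    by (simp add: cinner_scaleR_right)
  then show ?thesis
    by (simp add: E_sym[symmetric] eigenvector_E[OF u])
qed

text \<open>Let R, with bound K, invert A - p. Within distance 1/(2K) of p, A - p maps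
  \<open>E S v\<close> to a vector of at most 1/(2K) times its norm, and R takes this back with a
  factor of at most K; so the norm of \<open>E S v\<close> is at most half of itself. The
  intersection with S' is the shape that \<open>E_locally_null\<close> asks for.\<close>

lemma resolvent_null:
  assumes "complex_of_real p \<notin> spectrum A" and S': "S' \<in> sets borel"
  shows "\<exists>U. open U \<and> p \<in> U \<and> E (U \<inter> S') v = 0"
proof -
  obtain R where R: "bounded_linear R"
    and eq: "{(x, y - complex_of_real p *\<^sub>C x) |x y. (x, y) \<in> A}\<inverse> = {(g, R g) |g. True}"
    using assms unfolding spectrum_def resolvent_set_def by auto
  have RA: "R (y - p *\<^sub>R x) = x" if "(x, y) \<in> A" for x y
  proof -
    have "(y - complex_of_real p *\<^sub>C x, x) \<in> {(x, y - complex_of_real p *\<^sub>C x) |x y. (x, y) \<in> A}\<inverse>"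
      using that by blast
    then show ?thesis
      unfolding eq by (simp add: scaleC_of_real)
  qed
  obtain K where K: "K > 0" "\<And>g. norm (R g) \<le> norm g * K"
    using bounded_linear.pos_bounded[OF R] by blast
  have "E S v = 0" if S: "S \<in> sets borel" "S \<subseteq> {p - 1 / (2 * K)<..<p + 1 / (2 * K)}" for S
  proof -
    let ?\<epsilon> = "1 / (2 * K)"
    let ?f = "\<lambda>t. t * indicator S t" and ?g = "\<lambda>t. p * indicator S t"
    have b: "\<bar>t\<bar> \<le> \<bar>p\<bar> + ?\<epsilon>" if "t \<in> S" for t
    proof -
      have "p - ?\<epsilon> < t" "t < p + ?\<epsilon>" using that S(2) by auto
      then show ?thesis by linarith
    qed
    have f: "bounded_borel ?f"
      by (rule bounded_borel_cut[OF _ S(1) b]) simp_all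
    have g: "bounded_borel ?g"
      by (intro bounded_borel_mult bounded_borel_const bounded_borel_indicator S)
    have "(E S v, \<Phi> ?f v) \<in> A"
      unfolding A_eq[symmetric] by (rule spectral_integral_E_cut[OF _ S(1) b]) simp_all
    then have "R (\<Phi> ?f v - p *\<^sub>R E S v) = E S v"
      by (rule RA)
    moreover have "\<Phi> ?f v - p *\<^sub>R E S v = \<Phi> (\<lambda>t. ?f t - ?g t) v"
      using S by (simp add: \<Phi>_diff f g \<Phi>_scale bounded_borel_indicator \<Phi>_indicator)
    moreover have "norm (\<Phi> (\<lambda>t. ?f t - ?g t) v) \<le> norm (\<Phi> (\<lambda>t. ?\<epsilon> * indicator S t) v)"
    proof (rule \<Phi>_norm_le)
      show "bounded_borel (\<lambda>t. ?\<epsilon> * indicator S t)"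
        by (intro bounded_borel_mult bounded_borel_const bounded_borel_indicator S)
      show "\<bar>?f t - ?g t\<bar> \<le> \<bar>?\<epsilon> * indicator S t\<bar>" for t
      proof (cases "t \<in> S")
        case True
        then have "p - ?\<epsilon> < t" "t < p + ?\<epsilon>" using S(2) by auto
        moreover have "\<bar>?\<epsilon>\<bar> = ?\<epsilon>" using K(1) by simp
        ultimately show ?thesis using True by simp
      qed simp
    qed (rule bounded_borel_diff[OF f g])
    moreover have "norm (\<Phi> (\<lambda>t. ?\<epsilon> * indicator S t) v) = ?\<epsilon> * norm (E S v)"
      using S K(1) by (subst \<Phi>_scale) (simp_all add: bounded_borel_indicator \<Phi>_indicator)
    ultimately have le: "norm (\<Phi> ?f v - p *\<^sub>R E S v) \<le> ?\<epsilon> * norm (E S v)"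
      and R: "R (\<Phi> ?f v - p *\<^sub>R E S v) = E S v"
      by (simp_all only:)
    have "norm (E S v) \<le> norm (\<Phi> ?f v - p *\<^sub>R E S v) * K"
      using K(2)[of "\<Phi> ?f v - p *\<^sub>R E S v"] unfolding R .
    then have "norm (E S v) \<le> ?\<epsilon> * norm (E S v) * K"
      using le K(1) by (meson less_imp_le mult_right_mono order_trans)
    then show ?thesis using K(1) by simp
  qed
  then have "E ({p - 1 / (2 * K)<..<p + 1 / (2 * K)} \<inter> S') v = 0"
    using S' by simp
  then show ?thesis
    using K(1) by (intro exI[of _ "{p - 1 / (2 * K)<..<p + 1 / (2 * K)}"]) auto
qed

lemma E_resolvent_null:
  assumes S: "S \<in> sets borel" and res: "\<And>p. p \<in> S \<Longrightarrow> complex_of_real p \<notin> spectrum A"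
  shows "E S v = 0"
  by (rule E_locally_null[OF S resolvent_null[OF res S]])

text \<open>An isolating neighbourhood of a spectral point p consists on the real line, apart from p
  itself, of resolvent points, which carry no mass. The local statements are glued by
  \<open>E_locally_null\<close>, so S may contain infinitely many eigenvalues.\<close>

lemma E_isolated_null:
  assumes S: "S \<in> sets borel"
    and iso: "\<And>p. p \<in> S \<Longrightarrow> complex_of_real p \<in> spectrum A \<Longrightarrow>
      complex_of_real p isolated_in spectrum A \<and> E {p} v = 0"
  shows "E S v = 0"
proof (rule E_locally_null[OF S])
  fix p assume p: "p \<in> S"
  show "\<exists>U. open U \<and> p \<in> U \<and> E (U \<inter> S) v = 0"
  proof (cases "complex_of_real p \<in> spectrum A")
    case False
    then show ?thesis by (rule resolvent_null[OF _ S])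
  next
    case True
    then obtain V where V: "open V" "V \<inter> spectrum A = {complex_of_real p}"
      using iso[OF p] unfolding isolated_in_def by blast
    define U where "U = complex_of_real -` V"
    have U: "open U"
      unfolding U_def by (intro open_vimage V continuous_intros)
    have pU: "p \<in> U" using V by (auto simp: U_def)
    have "E (U \<inter> S - {p}) v = 0"
    proof (rule E_resolvent_null)
      show "U \<inter> S - {p} \<in> sets borel" using U S by auto
      fix q assume "q \<in> U \<inter> S - {p}"
      then show "complex_of_real q \<notin> spectrum A"
        using V(2) by (metis DiffE IntE IntI U_def insertI1 of_real_eq_iff singletonD vimageD)
    qed
    moreover have "U \<inter> S = (U \<inter> S - {p}) \<union> {p}"
      using p pU by auto
    moreover have "E ((U \<inter> S - {p}) \<union> {p}) v = E (U \<inter> S - {p}) v + E {p} v"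
      using U S by (intro E_Un_disjoint) auto
    ultimately have "E (U \<inter> S) v = 0"
      using iso[OF p True] by simp
    then show ?thesis using U pU by blast
  qed
qed

lemma eigenvalue_in_spectrum:
  assumes "u \<in> eigenspace A (complex_of_real p)" "u \<noteq> 0"
  shows "complex_of_real p \<in> spectrum A"
proof (rule ccontr)
  assume "complex_of_real p \<notin> spectrum A"
  then have "E {p} u = 0"
    by (intro E_resolvent_null) auto
  then show False using eigenvector_E[OF assms(1)] assms(2) by simp
qed

lemma below_lambda_inf_discrete:
  assumes "ereal p < lambda_inf A" "complex_of_real p \<in> spectrum A"
  shows "complex_of_real p \<in> discrete_spectrum A"
proof (rule ccontr)
  assume "complex_of_real p \<notin> discrete_spectrum A"
  then have "complex_of_real p \<in> essential_spectrum A"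
    using assms by (simp add: essential_spectrum_def)
  then have "lambda_inf A \<le> ereal (Re (complex_of_real p))"
    unfolding lambda_inf_def by (rule INF_lower)
  then show False using assms(1) by simp
qed

end

section \<open>The Ritz method in an inner product space\<close>

text \<open>The dimension count behind all later choices of vectors, by Gaussian elimination: an
  equation with \<open>M k i0\<close> nonzero is solved for the unknown i0, and M' is the system
  left for the others. Index sets are arbitrary so that a cluster of eigenvalues can serve as well
  as an interval.\<close>

lemma homogeneous_system_solution:
  fixes M :: "'a \<Rightarrow> 'b \<Rightarrow> 'c::field"
  assumes "finite K" "finite I" "card K < card I"
  shows "\<exists>c. (\<exists>i\<in>I. c i \<noteq> 0) \<and> (\<forall>k\<in>K. (\<Sum>i\<in>I. M k i * c i) = 0)"
  using assms
proof (induction K arbitrary: I M rule: finite_induct)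
  case empty
  then obtain i where "i \<in> I" by fastforce
  then show ?case by (intro exI[of _ "\<lambda>_. 1"]) auto
next
  case (insert k K)
  show ?case
  proof (cases "\<forall>i\<in>I. M k i = 0")
    case True
    obtain c where "\<exists>i\<in>I. c i \<noteq> 0" "\<forall>k\<in>K. (\<Sum>i\<in>I. M k i * c i) = 0"
      using insert.IH[of I M] insert.prems insert.hyps by auto
    then show ?thesis using True by (intro exI[of _ c]) auto
  next
    case False
    then obtain i0 where i0: "i0 \<in> I" "M k i0 \<noteq> 0" by blast
    define M' where "M' k' i = M k' i - M k' i0 * M k i / M k i0" for k' i
    have "card K < card (I - {i0})"
      using insert.prems insert.hyps i0 by simp
    then obtain c where c: "\<exists>i\<in>I - {i0}. c i \<noteq> 0" "\<forall>k\<in>K. (\<Sum>i\<in>I - {i0}. M' k i * c i) = 0"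
      using insert.IH[of "I - {i0}" M'] insert.prems by auto
    define s where "s = (\<Sum>i\<in>I - {i0}. M k i * c i)"
    define c' where "c' = c(i0 := - s / M k i0)"
    have split: "(\<Sum>i\<in>I. M k' i * c' i) = - M k' i0 * s / M k i0 + (\<Sum>i\<in>I - {i0}. M k' i * c i)" for k'
      using insert.prems i0 by (subst sum.remove[of I i0]) (auto simp: c'_def)
    have "(\<Sum>i\<in>I. M k' i * c' i) = 0" if "k' \<in> K" for k'
    proof -
      have "0 = (\<Sum>i\<in>I - {i0}. M' k' i * c i)"
        using c(2) that by simp
      also have "\<dots> = (\<Sum>i\<in>I - {i0}. M k' i * c i) - M k' i0 * s / M k i0"
        unfolding M'_def s_def
        by (simp add: left_diff_distrib sum_subtractf sum_distrib_left sum_divide_distrib mult.assoc)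
      finally show ?thesis unfolding split by (simp add: algebra_simps)
    qed
    moreover have "(\<Sum>i\<in>I. M k i * c' i) = 0"
      unfolding split using i0 by (simp add: s_def)
    moreover have "\<exists>i\<in>I. c' i \<noteq> 0"
      using c(1) by (auto simp: c'_def)
    ultimately show ?thesis by blast
  qed
qed

text \<open>Serves both forms: the weights are 1 for b, and Ritz values or eigenvalues for
  a.\<close>

lemma norm_sq_orthogonal_sum:
  assumes "finite I"
    and orth: "\<And>i k. i \<in> I \<Longrightarrow> k \<in> I \<Longrightarrow> cinner (f i) (f k) = (if i = k then complex_of_real (L i) else 0)"
  shows "(norm (\<Sum>i\<in>I. c i *\<^sub>C f i))\<^sup>2 = (\<Sum>i\<in>I. L i * (cmod (c i))\<^sup>2)"
proof -
  have "cinner (\<Sum>i\<in>I. c i *\<^sub>C f i) (\<Sum>i\<in>I. c i *\<^sub>C f i)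
      = (\<Sum>i\<in>I. cnj (c i) * (\<Sum>k\<in>I. c k * cinner (f i) (f k)))"
  proof -
    have "cinner (f i) (\<Sum>k\<in>I. c k *\<^sub>C f k) = (\<Sum>k\<in>I. c k * cinner (f i) (f k))" for i
      by (simp add: cinner_sum_right cinner_scaleC_right)
    then show ?thesis
      by (simp only: cinner_sum_left cinner_scaleC_left)
  qed
  also have "\<dots> = (\<Sum>i\<in>I. cnj (c i) * (c i * complex_of_real (L i)))"
  proof (rule sum.cong[OF refl])
    fix i assume i: "i \<in> I"
    have "(\<Sum>k\<in>I. c k * cinner (f i) (f k)) = (\<Sum>k\<in>I. if k = i then c i * complex_of_real (L i) else 0)"
      by (rule sum.cong) (use i orth in auto)
    then show "cnj (c i) * (\<Sum>k\<in>I. c k * cinner (f i) (f k)) = cnj (c i) * (c i * complex_of_real (L i))"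
      using i assms(1) by simp
  qed
  also have "\<dots> = complex_of_real (\<Sum>i\<in>I. L i * (cmod (c i))\<^sup>2)"
    unfolding of_real_sum of_real_mult complex_norm_square by (simp add: ac_simps)
  finally show ?thesis
    unfolding cinner_self of_real_eq_iff .
qed

lemma bessel_inequality:
  assumes "finite I"
    and orth: "\<And>i k. i \<in> I \<Longrightarrow> k \<in> I \<Longrightarrow> cinner (f i) (f k) = (if i = k then 1 else 0)"
  shows "(\<Sum>i\<in>I. (cmod (cinner (f i) z))\<^sup>2) \<le> (norm z)\<^sup>2"
proof -
  let ?s = "\<Sum>i\<in>I. cinner (f i) z *\<^sub>C f i"
  have s: "(norm ?s)\<^sup>2 = (\<Sum>i\<in>I. (cmod (cinner (f i) z))\<^sup>2)"
    using norm_sq_orthogonal_sum[OF assms(1), of f "\<lambda>_. 1" "\<lambda>i. cinner (f i) z"] orth by simp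
  have "cinner ?s z = (\<Sum>i\<in>I. cnj (cinner (f i) z) * cinner (f i) z)"
    by (simp add: cinner_sum_left cinner_scaleC_left)
  also have "\<dots> = complex_of_real (\<Sum>i\<in>I. (cmod (cinner (f i) z))\<^sup>2)"
    unfolding of_real_sum complex_norm_square by (simp add: ac_simps)
  finally have "Re (cinner ?s z) = (\<Sum>i\<in>I. (cmod (cinner (f i) z))\<^sup>2)"
    by simp
  then have "(norm (?s - z))\<^sup>2 = (norm z)\<^sup>2 - (\<Sum>i\<in>I. (cmod (cinner (f i) z))\<^sup>2)"
    unfolding norm_diff_sq s by simp
  then show ?thesis
    using zero_le_power2[of "norm (?s - z)"] by linarith
qed

lemma cinner_span_zero:
  assumes "z \<in> cspan S" "\<And>s. s \<in> S \<Longrightarrow> cinner s x = 0"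
  shows "cinner z x = 0"
  using assms(1)
  by (induction rule: complex_vs.span_induct_alt) (simp_all add: cinner_add_left cinner_scaleC_left assms(2))

lemma orth_proj_eqI:
  assumes y: "y \<in> cspan S" and orth: "\<And>s. s \<in> S \<Longrightarrow> cinner s (x - y) = 0"
  shows "orth_proj (cspan S) x = y"
  unfolding orth_proj_def
proof (rule the_equality)
  show "y \<in> cspan S \<and> (\<forall>z\<in>cspan S. cinner z (x - y) = 0)"
    using y cinner_span_zero orth by blast
  fix y' assume y': "y' \<in> cspan S \<and> (\<forall>z\<in>cspan S. cinner z (x - y') = 0)"
  then have "y - y' \<in> cspan S"
    using y complex_vs.span_diff by blast
  then have "cinner (y - y') (x - y') = 0" "cinner (y - y') (x - y) = 0"
    using y' cinner_span_zero[OF _ orth] by blast+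
  then have "cinner (y - y') (x - y') - cinner (y - y') (x - y) = 0"
    by simp
  then have "cinner (y - y') (y - y') = 0"
    by (simp add: cinner_diff_right)
  then show "y' = y"
    by (simp add: cinner_self)
qed

lemma orth_proj_orthonormal:
  assumes "finite I"
    and "\<And>i k. i \<in> I \<Longrightarrow> k \<in> I \<Longrightarrow> cinner (e i) (e k) = (if i = k then 1 else 0)"
  shows "orth_proj (cspan (e ` I)) x = (\<Sum>i\<in>I. cinner (e i) x *\<^sub>C e i)"
proof (rule orth_proj_eqI)
  show "(\<Sum>i\<in>I. cinner (e i) x *\<^sub>C e i) \<in> cspan (e ` I)"
    by (intro complex_vs.span_sum complex_vs.span_scale complex_vs.span_base) auto
  fix s assume "s \<in> e ` I"
  then show "cinner s (x - (\<Sum>i\<in>I. cinner (e i) x *\<^sub>C e i)) = 0"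
    using orthonormal_expansion[OF assms(1) _ assms(2)] by (auto simp: cinner_diff_right)
qed

text \<open>Supplies the phase that makes the overlap of an eigenvector with its Ritz vector real
  and nonnegative.\<close>

lemma exists_unit_multiple_real:
  fixes s :: complex
  obtains e where "cmod e = 1" "e * s = complex_of_real (cmod s)"
proof (cases "s = 0")
  case False
  have "cnj s / cmod s * s = complex_of_real (cmod s)"
    using False by (simp add: complex_norm_square[symmetric] mult.commute power2_eq_square)
  moreover have "cmod (cnj s / cmod s) = 1"
    using False by (simp add: norm_divide)
  ultimately show ?thesis using that by blast
qed (use that[of 1] in simp)

text \<open>The inner product of the domain of J is the form a, and b is pulled back along J. What
  is kept of the matrix problem is that the \<open>U i\<close> are combinations of the trial vectors
  and diagonalize both forms.\<close>

locale ritz =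
  fixes J :: "'k::complex_inner \<Rightarrow> 'm::complex_inner" and w :: "nat \<Rightarrow> 'k" and n :: nat
    and \<Lambda> :: "nat \<Rightarrow> real" and U :: "nat \<Rightarrow> 'k"
  assumes J: "clinear J"
    and \<Lambda>_mono: "i \<in> {1..n} \<Longrightarrow> k \<in> {1..n} \<Longrightarrow> i \<le> k \<Longrightarrow> \<Lambda> i \<le> \<Lambda> k"
    and U_trial: "k \<in> {1..n} \<Longrightarrow> \<exists>x. U k = (\<Sum>j=1..n. x j *\<^sub>C w j)"
    and J_U: "i \<in> {1..n} \<Longrightarrow> k \<in> {1..n} \<Longrightarrow> cinner (J (U i)) (J (U k)) = (if i = k then 1 else 0)"
    and U_U: "i \<in> {1..n} \<Longrightarrow> k \<in> {1..n} \<Longrightarrow> cinner (U i) (U k) = (if i = k then complex_of_real (\<Lambda> i) else 0)"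
begin

lemma \<Lambda>_pos: "i \<in> {1..n} \<Longrightarrow> \<Lambda> i > 0"
proof -
  assume i: "i \<in> {1..n}"
  have "U i \<noteq> 0"
    using J_U[OF i i] clinear_zero[OF J] by auto
  moreover have "(norm (U i))\<^sup>2 = \<Lambda> i"
    using U_U[OF i i] by (simp add: norm_sq_cinner)
  ultimately show "\<Lambda> i > 0" by (metis norm_eq_zero zero_less_power2)
qed

lemma cinner_U_sum:
  "i \<in> {1..n} \<Longrightarrow> cinner (J (U i)) (J (\<Sum>k=1..n. c k *\<^sub>C U k)) = c i"
  using orthonormal_expansion[of "{1..n}" i "\<lambda>k. J (U k)" c] J_U
  by (simp add: clinear_sum[OF J] clinear_scaleC[OF J])

lemma norm_U_sum: "(norm (\<Sum>k=1..n. c k *\<^sub>C U k))\<^sup>2 = (\<Sum>k=1..n. \<Lambda> k * (cmod (c k))\<^sup>2)"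
  by (rule norm_sq_orthogonal_sum) (use U_U in auto)

lemma norm_J_U_sum:
  assumes "S \<subseteq> {1..n}"
  shows "(norm (J (\<Sum>k\<in>S. c k *\<^sub>C U k)))\<^sup>2 = (\<Sum>k\<in>S. (cmod (c k))\<^sup>2)"
proof -
  have "finite S" using assms finite_subset by blast
  then have "(norm (\<Sum>k\<in>S. c k *\<^sub>C J (U k)))\<^sup>2 = (\<Sum>k\<in>S. 1 * (cmod (c k))\<^sup>2)"
  proof (rule norm_sq_orthogonal_sum)
    fix i k assume "i \<in> S" "k \<in> S"
    then have "i \<in> {1..n}" "k \<in> {1..n}" using assms by blast+
    from J_U[OF this]
    show "cinner (J (U i)) (J (U k)) = (if i = k then complex_of_real 1 else 0)" by simp
  qed
  then show ?thesis
    by (simp add: clinear_sum[OF J] clinear_scaleC[OF J])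
qed

text \<open>By a dimension count: the \<open>n\<close> independent vectors \<open>U i\<close> lie in the span of \<open>n\<close> vectors.\<close>

lemma trial_in_span: "k \<in> {1..n} \<Longrightarrow> w k \<in> cspan (U ` {1..n})"
proof -
  assume k: "k \<in> {1..n}"
  obtain X where X: "\<And>i. i \<in> {1..n} \<Longrightarrow> U i = (\<Sum>j=1..n. X i j *\<^sub>C w j)"
    using U_trial by metis
  \<comment> \<open>Column 0 holds the coordinates of \<open>w k\<close> in terms of the trial
    vectors, columns 1 to n those of the \<open>U i\<close>. A nontrivial solution is a linear
    relation between n + 1 vectors, and \<open>c 0\<close> cannot vanish because the
    \<open>U i\<close> are independent.\<close>
  define M where "M j i = (if i = 0 then if j = k then 1 else 0 else X i j)" for j i
  have card: "finite {1..n}" "finite {0..n}" "card {1..n} < card {0..n}"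
    by auto
  obtain c where c: "\<exists>i\<in>{0..n}. c i \<noteq> 0" "\<And>j. j \<in> {1..n} \<Longrightarrow> (\<Sum>i\<in>{0..n}. M j i * c i) = 0"
    using homogeneous_system_solution[of "{1..n}" "{0..n}" M] card by blast
  have "0 = (\<Sum>j=1..n. (\<Sum>i\<in>{0..n}. M j i * c i) *\<^sub>C w j)"
    using c(2) by simp
  also have "\<dots> = (\<Sum>i\<in>{0..n}. c i *\<^sub>C (\<Sum>j=1..n. M j i *\<^sub>C w j))"
    unfolding complex_vs.scale_sum_left complex_vs.scale_sum_right
    by (subst sum.swap) (simp add: mult.commute)
  also have "\<dots> = c 0 *\<^sub>C (\<Sum>j=1..n. M j 0 *\<^sub>C w j) + (\<Sum>i=1..n. c i *\<^sub>C (\<Sum>j=1..n. M j i *\<^sub>C w j))"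
    by (simp add: sum.atLeast_Suc_atMost)
  also have "(\<Sum>j=1..n. M j 0 *\<^sub>C w j) = (\<Sum>j=1..n. if j = k then w k else 0)"
    by (rule sum.cong) (auto simp: M_def)
  also have "\<dots> = w k" using k by simp
  also have "(\<Sum>i=1..n. c i *\<^sub>C (\<Sum>j=1..n. M j i *\<^sub>C w j)) = (\<Sum>i=1..n. c i *\<^sub>C U i)"
    by (rule sum.cong) (auto simp: M_def X)
  finally have eq: "c 0 *\<^sub>C w k = - (\<Sum>i=1..n. c i *\<^sub>C U i)"
    by (simp add: eq_neg_iff_add_eq_0)
  have "c 0 \<noteq> 0"
  proof
    assume "c 0 = 0"
    then have "(\<Sum>i=1..n. c i *\<^sub>C U i) = 0" using eq by simp
    then have "c i = 0" if "i \<in> {1..n}" for i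
      using cinner_U_sum[OF that, of c] by (simp add: clinear_zero[OF J])
    moreover have "i = 0 \<or> i \<in> {1..n}" if "i \<in> {0..n}" for i
      using that by auto
    ultimately show False using c(1) \<open>c 0 = 0\<close> by blast
  qed
  then have "w k = (- inverse (c 0)) *\<^sub>C (\<Sum>i=1..n. c i *\<^sub>C U i)"
    using arg_cong[OF eq, of "\<lambda>z. inverse (c 0) *\<^sub>C z"] by simp
  also have "\<dots> \<in> cspan (U ` {1..n})"
    by (intro complex_vs.span_scale complex_vs.span_sum complex_vs.span_base) auto
  finally show ?thesis .
qed

lemma trial_span: "cspan (w ` {1..n}) = cspan (U ` {1..n})"
proof (rule complex_vs.span_eq[THEN iffD2], intro conjI subsetI)
  show "x \<in> cspan (U ` {1..n})" if "x \<in> w ` {1..n}" for x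
    using that trial_in_span by auto
  show "x \<in> cspan (w ` {1..n})" if x: "x \<in> U ` {1..n}" for x
  proof -
    obtain c where x_eq: "x = (\<Sum>j=1..n. c j *\<^sub>C w j)"
      using x U_trial by blast
    show ?thesis
      unfolding x_eq by (intro complex_vs.span_sum complex_vs.span_scale complex_vs.span_base) auto
  qed
qed

abbreviation P :: "'k \<Rightarrow> 'k" where
  "P \<equiv> ritz_projection w n"

lemma P_eq: "P x = (\<Sum>i=1..n. (cinner (U i) x / \<Lambda> i) *\<^sub>C U i)"
  unfolding ritz_projection_def trial_span
proof (rule orth_proj_eqI)
  show "(\<Sum>i=1..n. (cinner (U i) x / \<Lambda> i) *\<^sub>C U i) \<in> cspan (U ` {1..n})"
    by (intro complex_vs.span_sum complex_vs.span_scale complex_vs.span_base) auto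
  fix s assume "s \<in> U ` {1..n}"
  then obtain k where k: "k \<in> {1..n}" "s = U k" by blast
  have "cinner (U k) (\<Sum>i=1..n. (cinner (U i) x / \<Lambda> i) *\<^sub>C U i)
      = (\<Sum>i=1..n. if i = k then cinner (U k) x else 0)"
    unfolding cinner_sum_right cinner_scaleC_right
    by (rule sum.cong) (use k U_U \<Lambda>_pos[OF k(1)] in auto)
  then show "cinner s (x - (\<Sum>i=1..n. (cinner (U i) x / \<Lambda> i) *\<^sub>C U i)) = 0"
    using k by (simp add: cinner_diff_right)
qed

lemma P_clinear: "clinear P"
  unfolding clinear_def P_eq
  by (simp add: cinner_add_right cinner_scaleC_right add_divide_distrib complex_vs.scale_left_distrib
      sum.distrib complex_vs.scale_sum_right mult.commute)

lemma P_in_span: "P x \<in> cspan (w ` {1..n})"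
  unfolding P_eq trial_span
  by (intro complex_vs.span_sum complex_vs.span_scale complex_vs.span_base) auto

text \<open>Since a(U i, x) / \<Lambda> i = b(U i, P x), the projection can be expanded in
  b-orthonormal vectors, and a and b of P x become weighted sums over one and the same set of
  coefficients.\<close>

lemma P_coeff: "i \<in> {1..n} \<Longrightarrow> cinner (J (U i)) (J (P x)) = cinner (U i) x / \<Lambda> i"
  unfolding P_eq by (rule cinner_U_sum)

lemma P_expansion: "P x = (\<Sum>i=1..n. cinner (J (U i)) (J (P x)) *\<^sub>C U i)"
proof -
  have "(\<Sum>i=1..n. cinner (J (U i)) (J (P x)) *\<^sub>C U i) = (\<Sum>i=1..n. (cinner (U i) x / \<Lambda> i) *\<^sub>C U i)"
    by (rule sum.cong) (simp_all only: P_coeff)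
  then show ?thesis
    by (simp only: P_eq[of x, symmetric])
qed

lemma cinner_U_P: "k \<in> {1..n} \<Longrightarrow> cinner (U k) (x - P x) = 0"
proof -
  assume k: "k \<in> {1..n}"
  have "cinner (U k) (P x) = (\<Sum>i=1..n. if i = k then cinner (U k) x else 0)"
    unfolding P_eq cinner_sum_right cinner_scaleC_right
    by (rule sum.cong) (use k U_U \<Lambda>_pos[OF k] in auto)
  then show ?thesis using k by (simp add: cinner_diff_right)
qed

lemma P_orthogonal: "y \<in> cspan (w ` {1..n}) \<Longrightarrow> cinner y (x - P x) = 0"
  unfolding trial_span by (erule cinner_span_zero) (use cinner_U_P in auto)

lemma norm_P_sq: "(norm (P x))\<^sup>2 = (\<Sum>i=1..n. \<Lambda> i * (cmod (cinner (J (U i)) (J (P x))))\<^sup>2)"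
  using norm_U_sum[of "\<lambda>i. cinner (J (U i)) (J (P x))"] by (simp only: P_expansion[of x, symmetric])

lemma norm_J_P_sq: "(norm (J (P x)))\<^sup>2 = (\<Sum>i=1..n. (cmod (cinner (J (U i)) (J (P x))))\<^sup>2)"
  using norm_J_U_sum[of "{1..n}" "\<lambda>i. cinner (J (U i)) (J (P x))"]
  by (simp only: P_expansion[of x, symmetric] order_refl simp_thms)

lemma pythagoras_P:
  assumes "y \<in> cspan (w ` {1..n})"
  shows "(norm (x - y))\<^sup>2 = (norm (x - P x))\<^sup>2 + (norm (P x - y))\<^sup>2"
proof -
  have "cinner (P x - y) (x - P x) = 0"
    using P_orthogonal complex_vs.span_diff[OF P_in_span assms] by blast
  then have "(norm ((P x - y) + (x - P x)))\<^sup>2 = (norm (P x - y))\<^sup>2 + (norm (x - P x))\<^sup>2"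
    unfolding norm_add_sq by simp
  then show ?thesis by simp
qed

lemma norm_P_le: "norm (P x) \<le> norm x"
proof -
  have "(norm x)\<^sup>2 = (norm (x - P x))\<^sup>2 + (norm (P x))\<^sup>2"
    using pythagoras_P[OF complex_vs.span_zero, of x] by simp
  then have "(norm (P x))\<^sup>2 \<le> (norm x)\<^sup>2" by simp
  then show ?thesis by (rule power2_le_imp_le) simp
qed

lemma P_best_approx:
  assumes "y \<in> cspan (w ` {1..n})"
  shows "norm (x - P x) \<le> norm (x - y)"
proof (rule power2_le_imp_le)
  show "(norm (x - P x))\<^sup>2 \<le> (norm (x - y))\<^sup>2"
    unfolding pythagoras_P[OF assms, of x] by simp
qed simp

text \<open>Galerkin orthogonality: the error of y is a-orthogonal to the trial space, so P x may be
  subtracted for free. It produces products of two errors, hence the squared operator norm in the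
  eigenvalue bound.\<close>

lemma cinner_defect: "cinner x (y - P y) = cinner (x - P x) (y - P y)"
proof -
  have "cinner (P x) (y - P y) = 0"
    by (rule P_orthogonal[OF P_in_span])
  then show ?thesis
    unfolding cinner_diff_left[of x "P x"] by simp
qed

text \<open>A nonzero y in the span of U 1, ..., U j meets the j - 1 orthogonality conditions; its
  quotient a/b is at most \<open>\<Lambda> j\<close>, and at least \<sigma> by \<open>gap\<close>.
  The number \<sigma> need not be an eigenvalue, which is used for the Ritz values beyond a
  cluster.\<close>

lemma ritz_lower:
  fixes \<phi> :: "nat \<Rightarrow> 'k"
  assumes j: "j \<in> {1..n}"
    and gap: "\<And>y. (\<And>i. i \<in> {1..<j} \<Longrightarrow> cinner (J (\<phi> i)) (J y) = 0) \<Longrightarrow> \<sigma> * (norm (J y))\<^sup>2 \<le> (norm y)\<^sup>2"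
  shows "\<sigma> \<le> \<Lambda> j"
proof -
  have card: "finite {1..<j}" "finite {1..j}" "card {1..<j} < card {1..j}"
    using j by auto
  obtain c where c: "\<exists>i\<in>{1..j}. c i \<noteq> 0"
    "\<And>k. k \<in> {1..<j} \<Longrightarrow> (\<Sum>i=1..j. cinner (J (\<phi> k)) (J (U i)) * c i) = 0"
    using homogeneous_system_solution[of "{1..<j}" "{1..j}" "\<lambda>k i. cinner (J (\<phi> k)) (J (U i))"] card by blast
  define y where "y = (\<Sum>i=1..j. c i *\<^sub>C U i)"
  have sub: "{1..j} \<subseteq> {1..n}" using j by auto
  have "cinner (J (\<phi> k)) (J y) = (\<Sum>i=1..j. cinner (J (\<phi> k)) (J (U i)) * c i)" for k
    by (simp add: y_def clinear_sum[OF J] clinear_scaleC[OF J] cinner_sum_right cinner_scaleC_right mult.commute)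
  then have "\<sigma> * (norm (J y))\<^sup>2 \<le> (norm y)\<^sup>2"
    using gap c(2) by simp
  also have "(norm y)\<^sup>2 = (\<Sum>i=1..j. \<Lambda> i * (cmod (c i))\<^sup>2)"
    unfolding y_def by (rule norm_sq_orthogonal_sum) (use U_U sub in auto)
  also have "\<dots> \<le> (\<Sum>i=1..j. \<Lambda> j * (cmod (c i))\<^sup>2)"
    using \<Lambda>_mono j by (intro sum_mono mult_right_mono) auto
  also have "\<dots> = \<Lambda> j * (norm (J y))\<^sup>2"
    unfolding y_def norm_J_U_sum[OF sub] by (simp add: sum_distrib_left)
  finally have "\<sigma> * (norm (J y))\<^sup>2 \<le> \<Lambda> j * (norm (J y))\<^sup>2" .
  moreover have "(norm (J y))\<^sup>2 > 0"
    unfolding y_def norm_J_U_sum[OF sub] using c(1) by (auto intro: sum_pos2)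
  ultimately show ?thesis by simp
qed

text \<open>Here m and \<sigma> enclose the first j eigenvalues, and d bounds I - P on their span in
  the norm of a. The conclusion is kept as a product because its second factor need not be
  positive.\<close>

lemma ritz_upper:
  fixes \<phi> :: "nat \<Rightarrow> 'k" and lam :: "nat \<Rightarrow> real"
  assumes j: "j \<in> {1..n}"
    and J_\<phi>: "\<And>i k. i \<in> {1..j} \<Longrightarrow> k \<in> {1..j} \<Longrightarrow> cinner (J (\<phi> i)) (J (\<phi> k)) = (if i = k then 1 else 0)"
    and eig: "\<And>i y. i \<in> {1..j} \<Longrightarrow> cinner (\<phi> i) y = complex_of_real (lam i) * cinner (J (\<phi> i)) (J y)"
    and lam: "0 < m" "\<And>i. i \<in> {1..j} \<Longrightarrow> m \<le> lam i" "\<And>i. i \<in> {1..j} \<Longrightarrow> lam i \<le> \<sigma>"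
    and d: "0 \<le> d" "\<And>c. norm ((\<Sum>i=1..j. c i *\<^sub>C \<phi> i) - P (\<Sum>i=1..j. c i *\<^sub>C \<phi> i)) \<le> d * norm (\<Sum>i=1..j. c i *\<^sub>C \<phi> i)"
  shows "\<Lambda> j * (1 - 2 * (\<sigma> / m) * d\<^sup>2) \<le> \<sigma>"
proof -
  have \<phi>\<phi>: "cinner (\<phi> i) (\<phi> k) = (if i = k then complex_of_real (lam i) else 0)"
    if "i \<in> {1..j}" "k \<in> {1..j}" for i k
    using eig[OF that(1)] J_\<phi>[OF that] by simp
  have card: "finite {1..<j}" "finite {1..j}" "card {1..<j} < card {1..j}"
    using j by auto
  obtain c0 where c0: "\<exists>i\<in>{1..j}. c0 i \<noteq> 0"
    "\<And>k. k \<in> {1..<j} \<Longrightarrow> (\<Sum>i=1..j. cinner (J (U k)) (J (P (\<phi> i))) * c0 i) = 0"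
    using homogeneous_system_solution[of "{1..<j}" "{1..j}" "\<lambda>k i. cinner (J (U k)) (J (P (\<phi> i)))"] card by blast
  define N where "N = (\<Sum>i=1..j. (cmod (c0 i))\<^sup>2)"
  have N: "N > 0"
    unfolding N_def using c0(1) by (auto intro: sum_pos2)
  define c where "c i = c0 i / sqrt N" for i
  have c1: "(\<Sum>i=1..j. (cmod (c i))\<^sup>2) = 1"
  proof -
    have "(\<Sum>i=1..j. (cmod (c i))\<^sup>2) = (\<Sum>i=1..j. (cmod (c0 i))\<^sup>2) / N"
      using N by (simp add: c_def norm_divide power_divide sum_divide_distrib)
    then show ?thesis
      using N by (simp only: N_def[symmetric]) simp
  qed
  have c2: "(\<Sum>i=1..j. cinner (J (U k)) (J (P (\<phi> i))) * c i) = 0" if "k \<in> {1..<j}" for k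
    using c0(2)[OF that] by (simp add: c_def sum_divide_distrib[symmetric])
  define x where "x = (\<Sum>i=1..j. c i *\<^sub>C \<phi> i)"
  \<comment> \<open>This is T x, expressed by a(z, y) = b(x, y).\<close>
  define z where "z = (\<Sum>i=1..j. (c i / lam i) *\<^sub>C \<phi> i)"
  have lam_pos: "0 < lam i" if "i \<in> {1..j}" for i
    using lam(1,2) that less_le_trans by blast
  have j1: "1 \<in> {1..j}" using j by auto
  have "m \<le> \<sigma>" using lam(2,3)[OF j1] by linarith
  have Jx: "(norm (J x))\<^sup>2 = 1"
    using norm_sq_orthogonal_sum[of "{1..j}" "\<lambda>i. J (\<phi> i)" "\<lambda>_. 1" c] J_\<phi> c1
    by (simp add: x_def clinear_sum[OF J] clinear_scaleC[OF J])
  have x: "(norm x)\<^sup>2 \<le> \<sigma>"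
  proof -
    have "(norm x)\<^sup>2 = (\<Sum>i=1..j. lam i * (cmod (c i))\<^sup>2)"
      unfolding x_def by (rule norm_sq_orthogonal_sum) (use \<phi>\<phi> in auto)
    also have "\<dots> \<le> (\<Sum>i=1..j. \<sigma> * (cmod (c i))\<^sup>2)"
      using lam by (intro sum_mono mult_right_mono) auto
    finally show ?thesis using c1 by (simp add: sum_distrib_left[symmetric])
  qed
  have z: "(norm z)\<^sup>2 \<le> 1 / m"
  proof -
    have "(norm z)\<^sup>2 = (\<Sum>i=1..j. lam i * (cmod (c i / lam i))\<^sup>2)"
      unfolding z_def by (rule norm_sq_orthogonal_sum) (use \<phi>\<phi> in auto)
    also have "\<dots> \<le> (\<Sum>i=1..j. 1 / m * (cmod (c i))\<^sup>2)"
    proof (rule sum_mono)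
      fix i assume i: "i \<in> {1..j}"
      have "lam i * (cmod (c i / lam i))\<^sup>2 = 1 / lam i * (cmod (c i))\<^sup>2"
        using lam_pos[OF i] by (simp add: norm_divide power_divide power2_eq_square)
      also have "\<dots> \<le> 1 / m * (cmod (c i))\<^sup>2"
        using lam(1,2) i lam_pos[OF i] by (intro mult_right_mono divide_left_mono) auto
      finally show "lam i * (cmod (c i / lam i))\<^sup>2 \<le> 1 / m * (cmod (c i))\<^sup>2" .
    qed
    finally show ?thesis using c1 by (simp only: sum_distrib_left[symmetric])
  qed
  have zx: "cinner z y = cinner (J x) (J y)" for y
  proof -
    have "cinner z y = (\<Sum>i=1..j. cnj (c i / lam i) * cinner (\<phi> i) y)"
      by (simp add: z_def cinner_sum_left cinner_scaleC_left)
    also have "\<dots> = (\<Sum>i=1..j. cnj (c i) * cinner (J (\<phi> i)) (J y))"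
      by (rule sum.cong) (use eig lam_pos in \<open>auto simp: less_imp_neq[symmetric]\<close>)
    finally show ?thesis
      by (simp add: x_def clinear_sum[OF J] clinear_scaleC[OF J] cinner_sum_left cinner_scaleC_left)
  qed
  have "Re (cinner (J x) (J (x - P x))) \<le> (\<sigma> / m) * d\<^sup>2"
  proof -
    have "Re (cinner (J x) (J (x - P x))) \<le> cmod (cinner (z - P z) (x - P x))"
      unfolding zx[symmetric] cinner_defect[of z] by (rule complex_Re_le_cmod)
    also have "\<dots> \<le> norm (z - P z) * norm (x - P x)"
      by (rule cauchy_schwarz)
    also have "\<dots> \<le> (d * norm z) * (d * norm x)"
      unfolding z_def x_def using d by (intro mult_mono) auto
    also have "\<dots> = d\<^sup>2 * (norm z * norm x)"
      by (simp add: power2_eq_square)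
    also have "\<dots> \<le> d\<^sup>2 * (\<sigma> / m)"
    proof (rule mult_left_mono)
      \<comment> \<open>The product of the norms is at most the square root of \<sigma> / m, and
        \<sigma> / m \<ge> 1 removes the root.\<close>
      have "(norm z * norm x)\<^sup>2 \<le> 1 / m * \<sigma>"
        unfolding power_mult_distrib using x z lam(1) by (intro mult_mono) auto
      also have "\<dots> \<le> (\<sigma> / m)\<^sup>2"
        using \<open>m \<le> \<sigma>\<close> lam(1) by (simp add: power2_eq_square field_simps)
      finally show "norm z * norm x \<le> \<sigma> / m"
        by (rule power2_le_imp_le) (use \<open>m \<le> \<sigma>\<close> lam(1) in simp)
    qed simp
    finally show ?thesis by (simp add: mult.commute)
  qed
  moreover have "(norm (J (P x)))\<^sup>2 = (norm (J x))\<^sup>2 - 2 * Re (cinner (J x) (J (x - P x))) + (norm (J (x - P x)))\<^sup>2"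
    using norm_diff_sq[of "J x" "J (x - P x)"] by (simp add: clinear_diff[OF J])
  ultimately have low: "1 - 2 * (\<sigma> / m) * d\<^sup>2 \<le> (norm (J (P x)))\<^sup>2"
    using Jx zero_le_power2[of "norm (J (x - P x))"] by linarith
  have coeff: "cinner (J (U k)) (J (P x)) = 0" if "k \<in> {1..<j}" for k
    using c2[OF that]
    by (simp add: x_def clinear_sum[OF P_clinear] clinear_scaleC[OF P_clinear] clinear_sum[OF J]
        clinear_scaleC[OF J] cinner_sum_right cinner_scaleC_right mult.commute)
  have "\<Lambda> j * (1 - 2 * (\<sigma> / m) * d\<^sup>2) \<le> \<Lambda> j * (norm (J (P x)))\<^sup>2"
    using low \<Lambda>_pos[OF j] by (intro mult_left_mono) auto
  also have "\<dots> = (\<Sum>i=1..n. \<Lambda> j * (cmod (cinner (J (U i)) (J (P x))))\<^sup>2)"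
    by (simp add: norm_J_P_sq sum_distrib_left)
  \<comment> \<open>Below j the coefficients vanish by the choice of c; from j on the Ritz values
    are at least \<open>\<Lambda> j\<close>.\<close>
  also have "\<dots> \<le> (\<Sum>i=1..n. \<Lambda> i * (cmod (cinner (J (U i)) (J (P x))))\<^sup>2)"
  proof (rule sum_mono)
    fix i assume i: "i \<in> {1..n}"
    show "\<Lambda> j * (cmod (cinner (J (U i)) (J (P x))))\<^sup>2 \<le> \<Lambda> i * (cmod (cinner (J (U i)) (J (P x))))\<^sup>2"
    proof (cases "i < j")
      case True
      then show ?thesis using coeff[of i] i by simp
    next
      case False
      then show ?thesis using \<Lambda>_mono[OF j i] by (intro mult_right_mono) auto
    qed
  qed
  also have "\<dots> = (norm (P x))\<^sup>2"
    by (simp add: norm_P_sq)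
  also have "\<dots> \<le> (norm x)\<^sup>2"
    by (intro power_mono norm_P_le) simp
  finally show ?thesis using x by linarith
qed

text \<open>On the cluster C the projection P v is r U j with r \<ge> 0 after a change of phase. The
  rest of P v is at most \<sigma>/g times the error v - P v, by Bessel, so the b-distance of v from
  r U j is at most \<epsilon> = (1 + \<sigma>/g) d. As v and U j are b-normalized, |1 - r| \<le>
  \<epsilon> as well, whence the factor 2.\<close>

lemma ritz_vector:
  fixes \<phi> :: "nat \<Rightarrow> 'k"
  assumes C: "C \<subseteq> {1..n}" and j: "j \<in> C"
    and J_\<phi>: "\<And>i k. i \<in> C \<Longrightarrow> k \<in> C \<Longrightarrow> cinner (J (\<phi> i)) (J (\<phi> k)) = (if i = k then 1 else 0)"
    and eig: "\<And>i y. i \<in> C \<Longrightarrow> cinner (\<phi> i) y = complex_of_real \<sigma> * cinner (J (\<phi> i)) (J y)"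
    and \<sigma>: "0 < \<sigma>" and g: "0 < g" "\<And>i. i \<in> {1..n} - C \<Longrightarrow> g \<le> \<bar>\<Lambda> i - \<sigma>\<bar>"
    and d: "0 \<le> d" "\<And>c. norm (J ((\<Sum>i\<in>C. c i *\<^sub>C \<phi> i) - P (\<Sum>i\<in>C. c i *\<^sub>C \<phi> i))) \<le> d * norm (J (\<Sum>i\<in>C. c i *\<^sub>C \<phi> i))"
  shows "\<exists>c v. v = (\<Sum>i\<in>C. c i *\<^sub>C \<phi> i) \<and> norm (J v) = 1 \<and>
    norm (J v - J (U j)) \<le> 2 * (1 + \<sigma> / g) * d \<and>
    (norm (v - U j))\<^sup>2 = \<sigma> * (norm (J v - J (U j)))\<^sup>2 + \<Lambda> j - \<sigma>"
proof -
  have fin: "finite C" using C finite_subset by blast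
  have jn: "j \<in> {1..n}" using C j by blast
  obtain c0 where c0: "\<exists>i\<in>C. c0 i \<noteq> 0"
    "\<And>k. k \<in> C - {j} \<Longrightarrow> (\<Sum>i\<in>C. cinner (J (U k)) (J (P (\<phi> i))) * c0 i) = 0"
    using homogeneous_system_solution[of "C - {j}" C "\<lambda>k i. cinner (J (U k)) (J (P (\<phi> i)))"] fin j
    by (metis card_Diff1_less finite_Diff)
  define N where "N = (\<Sum>i\<in>C. (cmod (c0 i))\<^sup>2)"
  have N: "N > 0"
    unfolding N_def using c0(1) fin by (auto intro: sum_pos2)
  obtain e where e: "cmod e = 1"
    "e * (\<Sum>i\<in>C. cinner (J (U j)) (J (P (\<phi> i))) * (c0 i / sqrt N))
      = complex_of_real (cmod (\<Sum>i\<in>C. cinner (J (U j)) (J (P (\<phi> i))) * (c0 i / sqrt N)))"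
    using exists_unit_multiple_real by blast
  define r where "r = cmod (\<Sum>i\<in>C. cinner (J (U j)) (J (P (\<phi> i))) * (c0 i / sqrt N))"
  define c where "c i = e * (c0 i / sqrt N)" for i
  define v where "v = (\<Sum>i\<in>C. c i *\<^sub>C \<phi> i)"
  have c1: "(\<Sum>i\<in>C. (cmod (c i))\<^sup>2) = 1"
    using N e(1) by (simp add: c_def norm_mult norm_divide power_divide sum_divide_distrib[symmetric] N_def[symmetric])
  have "(norm (J v))\<^sup>2 = 1"
    using norm_sq_orthogonal_sum[OF fin, of "\<lambda>i. J (\<phi> i)" "\<lambda>_. 1" c] J_\<phi> c1
    by (simp add: v_def clinear_sum[OF J] clinear_scaleC[OF J])
  then have Jv: "norm (J v) = 1" by (metis norm_ge_zero power2_eq_1_iff neg_0_le_iff_le not_one_le_zero)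
  have eig_v: "cinner v y = complex_of_real \<sigma> * cinner (J v) (J y)" for y
    unfolding v_def clinear_sum[OF J] clinear_scaleC[OF J] cinner_sum_left cinner_scaleC_left sum_distrib_left
    by (rule sum.cong) (simp_all add: eig)
  have eig_v': "cinner y v = complex_of_real \<sigma> * cinner (J y) (J v)" for y
    using eig_v[of y] cinner_commute[of y v] cinner_commute[of "J y" "J v"] by simp
  have coeff_v: "cinner (J (U k)) (J (P v)) = e * (\<Sum>i\<in>C. cinner (J (U k)) (J (P (\<phi> i))) * (c0 i / sqrt N))" for k
    by (simp add: v_def c_def clinear_sum[OF P_clinear] clinear_scaleC[OF P_clinear] clinear_sum[OF J]
        clinear_scaleC[OF J] cinner_sum_right cinner_scaleC_right sum_distrib_left mult_ac)
  have coeff_j: "cinner (J (U j)) (J (P v)) = complex_of_real r"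
    unfolding coeff_v r_def by (rule e(2))
  have coeff_C: "cinner (J (U k)) (J (P v)) = 0" if "k \<in> C - {j}" for k
    using c0(2)[OF that] unfolding coeff_v by (simp add: sum_divide_distrib[symmetric])
  define b where "b i = cinner (J (U i)) (J (P v))" for i
  define rest where "rest = (\<Sum>i\<in>{1..n} - C. b i *\<^sub>C U i)"
  have Pv: "P v = complex_of_real r *\<^sub>C U j + rest"
  proof -
    have "P v = (\<Sum>i=1..n. b i *\<^sub>C U i)"
      unfolding b_def by (rule P_expansion)
    also have "\<dots> = (\<Sum>i\<in>C. b i *\<^sub>C U i) + rest"
      unfolding rest_def using sum.subset_diff[OF C] by (simp add: add.commute)
    also have "(\<Sum>i\<in>C. b i *\<^sub>C U i) = b j *\<^sub>C U j + (\<Sum>i\<in>C - {j}. b i *\<^sub>C U i)"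
      by (rule sum.remove[OF fin j])
    also have "(\<Sum>i\<in>C - {j}. b i *\<^sub>C U i) = 0"
      by (rule sum.neutral) (use coeff_C in \<open>simp add: b_def\<close>)
    finally show ?thesis by (simp add: b_def coeff_j)
  qed
  have rest: "norm (J rest) \<le> \<sigma> / g * norm (J (v - P v))"
  proof (rule power2_le_imp_le)
    have "(norm (J rest))\<^sup>2 = (\<Sum>i\<in>{1..n} - C. (cmod (b i))\<^sup>2)"
      unfolding rest_def by (rule norm_J_U_sum) auto
    also have "\<dots> \<le> (\<Sum>i\<in>{1..n} - C. (\<sigma> / g)\<^sup>2 * (cmod (cinner (J (U i)) (J (v - P v))))\<^sup>2)"
    proof (rule sum_mono)
      fix i assume i: "i \<in> {1..n} - C"
      have "\<Lambda> i * b i = cinner (U i) v"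
        using i P_coeff[of i v] \<Lambda>_pos[of i] by (simp add: b_def)
      also have "\<dots> = \<sigma> * cinner (J (U i)) (J v)"
        by (rule eig_v')
      \<comment> \<open>Both sides of \<Lambda> i b(U i, P v) = \<sigma> b(U i, v) are diminished by
        \<sigma> b(U i, P v), which leaves the error v - P v on the right.\<close>
      finally have "complex_of_real (\<Lambda> i - \<sigma>) * b i = \<sigma> * cinner (J (U i)) (J (v - P v))"
        by (simp add: clinear_diff[OF J] cinner_diff_right b_def algebra_simps)
      then have eq: "\<bar>\<Lambda> i - \<sigma>\<bar> * cmod (b i) = \<sigma> * cmod (cinner (J (U i)) (J (v - P v)))"
        using \<sigma> by (metis abs_of_pos norm_mult norm_of_real)
      have "g * cmod (b i) \<le> \<sigma> * cmod (cinner (J (U i)) (J (v - P v)))"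
        unfolding eq[symmetric] using g(2)[OF i] by (intro mult_right_mono) auto
      then have "cmod (b i) \<le> \<sigma> / g * cmod (cinner (J (U i)) (J (v - P v)))"
        using g(1) by (simp add: field_simps)
      then show "(cmod (b i))\<^sup>2 \<le> (\<sigma> / g)\<^sup>2 * (cmod (cinner (J (U i)) (J (v - P v))))\<^sup>2"
        unfolding power_mult_distrib[symmetric] by (intro power_mono) auto
    qed
    also have "\<dots> = (\<sigma> / g)\<^sup>2 * (\<Sum>i\<in>{1..n} - C. (cmod (cinner (J (U i)) (J (v - P v))))\<^sup>2)"
      by (simp add: sum_distrib_left)
    also have "\<dots> \<le> (\<sigma> / g)\<^sup>2 * (norm (J (v - P v)))\<^sup>2"
      by (intro mult_left_mono bessel_inequality) (use J_U in auto)
    finally show "(norm (J rest))\<^sup>2 \<le> (\<sigma> / g * norm (J (v - P v)))\<^sup>2"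
      by (simp only: power_mult_distrib)
  qed (use \<sigma> g in simp)
  define \<epsilon> where "\<epsilon> = (1 + \<sigma> / g) * d"
  have near: "norm (J v - r *\<^sub>R J (U j)) \<le> \<epsilon>"
  proof -
    have "v = (v - P v) + (complex_of_real r *\<^sub>C U j + rest)"
      by (simp add: Pv)
    then have "J v = J (v - P v) + (complex_of_real r *\<^sub>C J (U j) + J rest)"
      by (metis J clinear_add clinear_scaleC)
    then have "norm (J v - r *\<^sub>R J (U j)) = norm (J (v - P v) + J rest)"
      by (simp add: scaleC_of_real)
    also have "\<dots> \<le> norm (J (v - P v)) + norm (J rest)"
      by (rule norm_triangle_ineq)
    also have "\<dots> \<le> (1 + \<sigma> / g) * norm (J (v - P v))"
      using rest by (simp add: algebra_simps)
    also have "\<dots> \<le> (1 + \<sigma> / g) * d"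
      using d(2)[of c] Jv \<sigma> g by (intro mult_left_mono) (auto simp: v_def[symmetric] add_nonneg_nonneg)
    finally show ?thesis by (simp add: \<epsilon>_def)
  qed
  have "(norm (J (U j)))\<^sup>2 = 1"
    using J_U[OF jn jn] by (simp add: norm_sq_cinner)
  then have JU: "norm (J (U j)) = 1" by (metis norm_ge_zero power2_eq_1_iff neg_0_le_iff_le not_one_le_zero)
  have "norm (r *\<^sub>R J (U j)) = r"
    by (simp add: JU r_def)
  then have "\<bar>1 - r\<bar> \<le> \<epsilon>"
    using near norm_triangle_ineq3[of "J v" "r *\<^sub>R J (U j)"] Jv by simp
  moreover have "norm (r *\<^sub>R J (U j) - J (U j)) = \<bar>1 - r\<bar>"
  proof -
    have "r *\<^sub>R J (U j) - J (U j) = (r - 1) *\<^sub>R J (U j)"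
      by (simp add: scaleR_diff_left)
    then show ?thesis by (simp add: JU abs_minus_commute)
  qed
  ultimately have bound: "norm (J v - J (U j)) \<le> 2 * \<epsilon>"
    using near norm_triangle_ineq[of "J v - r *\<^sub>R J (U j)" "r *\<^sub>R J (U j) - J (U j)"] by simp
  \<comment> \<open>An exact identity: the cross term a(v, U j) equals \<sigma> b(v, U j), so the
    squared a-distance is \<sigma> times the squared b-distance plus \<Lambda> j - \<sigma>.\<close>
  have "(norm (v - U j))\<^sup>2 = \<sigma> * (norm (J v - J (U j)))\<^sup>2 + \<Lambda> j - \<sigma>"
  proof -
    have "(norm v)\<^sup>2 = \<sigma>"
      using eig_v[of v] unfolding cinner_self Jv by (metis mult_1_right of_real_1 of_real_eq_iff one_power2)
    moreover have "(norm (U j))\<^sup>2 = \<Lambda> j"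
      using U_U[OF jn jn] by (simp add: norm_sq_cinner)
    moreover have "Re (cinner v (U j)) = \<sigma> * Re (cinner (J v) (J (U j)))"
      by (simp add: eig_v)
    ultimately show ?thesis
      unfolding norm_diff_sq Jv JU by (simp add: algebra_simps)
  qed
  then show ?thesis
    using Jv bound v_def unfolding \<epsilon>_def mult.assoc by blast
qed

end

section \<open>The scale of Hilbert spaces\<close>

lemma dense_closed_all:
  assumes "closure X = UNIV" "closed {y. Q y}" "\<And>x. x \<in> X \<Longrightarrow> Q x"
  shows "Q y"
  using closure_minimal[of X "{y. Q y}"] assms by blast

text \<open>Extension by continuity along \<iota>, whose injectivity on D is not assumed: the bound
  makes \<open>B u\<close> depend on \<open>\<iota> u\<close> alone. Values are limits along
  sequences in D, and \<open>key\<close> makes them independent of the sequence. Uniqueness belongs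
  to the statement because \<open>extend_op\<close> is a definite description.\<close>

lemma dense_extension:
  fixes \<iota> :: "'h::complex_vector \<Rightarrow> 'k::complex_inner" and B :: "'h \<Rightarrow> 'm::complex_hilbert"
  assumes D: "\<And>c u v. u \<in> D \<Longrightarrow> v \<in> D \<Longrightarrow> c *\<^sub>C u + v \<in> D"
    and \<iota>: "\<And>c u v. u \<in> D \<Longrightarrow> v \<in> D \<Longrightarrow> \<iota> (c *\<^sub>C u + v) = c *\<^sub>C \<iota> u + \<iota> v"
    and B: "\<And>c u v. u \<in> D \<Longrightarrow> v \<in> D \<Longrightarrow> B (c *\<^sub>C u + v) = c *\<^sub>C B u + B v"
    and dense: "closure (\<iota> ` D) = UNIV"
    and bound: "\<And>u. u \<in> D \<Longrightarrow> norm (B u) \<le> C * norm (\<iota> u)"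
  shows "\<exists>!S. bounded_linear S \<and> clinear S \<and> (\<forall>u\<in>D. S (\<iota> u) = B u)"
proof (rule ex_ex1I)
  \<comment> \<open>The constant C may be negative or zero; K bounds as well and is positive, so
    that e / K can serve as a tolerance.\<close>
  define K where "K = \<bar>C\<bar> + 1"
  have K: "K > 0" by (simp add: K_def)
  have lip: "norm (B v - B u) \<le> K * norm (\<iota> v - \<iota> u)" if "u \<in> D" "v \<in> D" for u v
  proof -
    have "norm (B ((-1) *\<^sub>C u + v)) \<le> C * norm (\<iota> ((-1) *\<^sub>C u + v))"
      using D[OF that] by (rule bound)
    also have "\<dots> \<le> K * norm (\<iota> ((-1) *\<^sub>C u + v))"
      by (intro mult_right_mono) (auto simp: K_def)
    finally show ?thesis
      using B[OF that, of "-1"] \<iota>[OF that, of "-1"] by simp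
  qed
  have "\<exists>s. (\<forall>n::nat. s n \<in> D) \<and> (\<lambda>n. \<iota> (s n)) \<longlonglongrightarrow> y" for y
  proof -
    obtain z where z: "\<And>n. z n \<in> \<iota> ` D" "z \<longlonglongrightarrow> y"
      using dense closure_sequential[of y "\<iota> ` D"] by auto
    then have "\<forall>n. \<exists>d\<in>D. z n = \<iota> d" by blast
    then obtain s where "\<And>n. s n \<in> D" "\<And>n. z n = \<iota> (s n)" by metis
    moreover from this(2) have "z = (\<lambda>n. \<iota> (s n))" by auto
    ultimately show ?thesis using z(2) by blast
  qed
  then obtain s where s: "\<And>y n. s y n \<in> D" "\<And>y. (\<lambda>n. \<iota> (s y n)) \<longlonglongrightarrow> y" by metis
  define S where "S y = lim (\<lambda>n. B (s y n))" for y
  have conv: "(\<lambda>n. B (s y n)) \<longlonglongrightarrow> S y" for y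
  proof -
    have "Cauchy (\<lambda>n. B (s y n))"
    proof (rule metric_CauchyI)
      fix e :: real assume e: "0 < e"
      have "Cauchy (\<lambda>n. \<iota> (s y n))" using s(2) by (rule LIMSEQ_imp_Cauchy)
      then obtain N where N: "\<And>m n. m \<ge> N \<Longrightarrow> n \<ge> N \<Longrightarrow> dist (\<iota> (s y m)) (\<iota> (s y n)) < e / K"
        using e K unfolding Cauchy_def by (meson divide_pos_pos)
      have "dist (B (s y m)) (B (s y n)) < e" if "m \<ge> N" "n \<ge> N" for m n
        using lip[OF s(1) s(1), of y m y n] N[OF that] K
        by (simp add: dist_norm field_simps)
      then show "\<exists>N. \<forall>m\<ge>N. \<forall>n\<ge>N. dist (B (s y m)) (B (s y n)) < e" by blast
    qed
    then show ?thesis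
      unfolding S_def by (simp add: Cauchy_convergent_iff convergent_LIMSEQ_iff)
  qed
  have key: "(\<lambda>n. B (t n)) \<longlonglongrightarrow> S y" if t: "\<And>n. t n \<in> D" "(\<lambda>n. \<iota> (t n)) \<longlonglongrightarrow> y" for t y
  proof -
    have "(\<lambda>n. \<iota> (t n) - \<iota> (s y n)) \<longlonglongrightarrow> y - y"
      by (intro tendsto_diff t s)
    then have "(\<lambda>n. \<iota> (t n) - \<iota> (s y n)) \<longlonglongrightarrow> 0"
      by simp
    from tendsto_mult_right_zero[OF tendsto_norm_zero[OF this], of K]
    have "(\<lambda>n. B (t n) - B (s y n)) \<longlonglongrightarrow> 0"
      by (rule Lim_null_comparison[rotated]) (rule always_eventually, rule allI, rule lip[OF s(1) t(1)])
    from tendsto_add[OF this conv[of y]] show ?thesis by simp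
  qed
  have "clinear S"
    unfolding clinear_def
  proof (intro allI)
    fix c x y
    have "(\<lambda>n. B (c *\<^sub>C s x n + s y n)) \<longlonglongrightarrow> S (c *\<^sub>C x + y)"
    proof (rule key)
      show "(\<lambda>n. \<iota> (c *\<^sub>C s x n + s y n)) \<longlonglongrightarrow> c *\<^sub>C x + y"
        unfolding \<iota>[OF s(1) s(1)] by (intro tendsto_add tendsto_scaleC tendsto_const s(2))
    qed (rule D[OF s(1) s(1)])
    moreover have "(\<lambda>n. B (c *\<^sub>C s x n + s y n)) \<longlonglongrightarrow> c *\<^sub>C S x + S y"
      unfolding B[OF s(1) s(1)] by (intro tendsto_add tendsto_scaleC tendsto_const conv)
    ultimately show "S (c *\<^sub>C x + y) = c *\<^sub>C S x + S y"
      by (rule LIMSEQ_unique)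
  qed
  moreover have "norm (S y) \<le> K * norm y" for y
  proof (rule LIMSEQ_le)
    show "(\<lambda>n. norm (B (s y n))) \<longlonglongrightarrow> norm (S y)"
      by (intro tendsto_norm conv)
    show "(\<lambda>n. K * norm (\<iota> (s y n))) \<longlonglongrightarrow> K * norm y"
      by (intro tendsto_mult tendsto_norm tendsto_const s)
    show "\<exists>N. \<forall>n\<ge>N. norm (B (s y n)) \<le> K * norm (\<iota> (s y n))"
    proof (intro exI allI impI)
      fix n
      have "norm (B (s y n)) \<le> C * norm (\<iota> (s y n))" by (rule bound[OF s(1)])
      also have "\<dots> \<le> K * norm (\<iota> (s y n))"
        by (intro mult_right_mono) (auto simp: K_def)
      finally show "norm (B (s y n)) \<le> K * norm (\<iota> (s y n))" .
    qed
  qed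
  moreover have "S (\<iota> u) = B u" if "u \<in> D" for u
    using key[of "\<lambda>_. u" "\<iota> u"] that by (simp add: LIMSEQ_const_iff)
  ultimately show "\<exists>S. bounded_linear S \<and> clinear S \<and> (\<forall>u\<in>D. S (\<iota> u) = B u)"
    using clinear_bounded_linear by blast
next
  fix S S'
  assume S: "bounded_linear S \<and> clinear S \<and> (\<forall>u\<in>D. S (\<iota> u) = B u)"
    and S': "bounded_linear S' \<and> clinear S' \<and> (\<forall>u\<in>D. S' (\<iota> u) = B u)"
  have "closed {y. S y = S' y}"
    using S S' by (intro closed_Collect_eq linear_continuous_on) auto
  moreover have "S x = S' x" if "x \<in> \<iota> ` D" for x
    using S S' that by force
  ultimately show "S = S'"
    by (intro ext) (rule dense_closed_all[OF dense])
qed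

section \<open>Inner products and operator extensions in one space of the scale\<close>

context spectral_op
begin

lemma scale_space_linear:
  assumes "is_scale_space A \<sigma> \<iota>" "u \<in> Domain (op_power A \<sigma>)" "v \<in> Domain (op_power A \<sigma>)"
  shows "\<iota> (c *\<^sub>C u + v) = c *\<^sub>C \<iota> u + \<iota> v"
  using assms unfolding is_scale_space_def by blast

lemma scale_space_cinner:
  assumes "is_scale_space A \<sigma> \<iota>" "(u, u') \<in> op_power A \<sigma>" "(v, v') \<in> op_power A \<sigma>"
  shows "cinner (\<iota> u) (\<iota> v) = cinner u' v'"
  using assms unfolding is_scale_space_def by blast

lemma scale_space_dense:
  assumes "is_scale_space A \<sigma> \<iota>"
  shows "closure (\<iota> ` Domain (op_power A \<sigma>)) = UNIV"
  using assms unfolding is_scale_space_def by (cases "\<sigma> \<ge> 0") simp_all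

lemma Domain_op_power_linear:
  "u \<in> Domain (op_power A \<sigma>) \<Longrightarrow> v \<in> Domain (op_power A \<sigma>) \<Longrightarrow> c *\<^sub>C u + v \<in> Domain (op_power A \<sigma>)"
  using op_power_linear by blast

lemma eigenspace_Domain: "u \<in> eigenspace A (complex_of_real p) \<Longrightarrow> u \<in> Domain (op_power A \<sigma>)"
  using eigenvector_op_power by blast

lemma Domain_op_power_sum:
  assumes "\<And>i. i \<in> I \<Longrightarrow> e i \<in> Domain (op_power A \<sigma>)"
  shows "(\<Sum>i\<in>I. c i *\<^sub>C e i) \<in> Domain (op_power A \<sigma>)"
proof -
  have "(0, 0) \<in> op_power A \<sigma>"
    unfolding op_power_eq spectral_integral_iff[OF powr_measurable]
    by (rule spectral_pair_truncI)
      (simp_all add: E_zero cut_borel clinear_zero \<Phi>_clinear bounded_borel_trunc powr_measurable)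
  then have "0 \<in> Domain (op_power A \<sigma>)" by blast
  then show ?thesis
    using assms by (induction I rule: infinite_finite_induct) (auto intro: Domain_op_power_linear)
qed

lemma scale_space_sum:
  assumes \<iota>: "is_scale_space A \<sigma> \<iota>" and e: "\<And>i. i \<in> I \<Longrightarrow> e i \<in> Domain (op_power A \<sigma>)"
  shows "\<iota> (\<Sum>i\<in>I. c i *\<^sub>C e i) = (\<Sum>i\<in>I. c i *\<^sub>C \<iota> (e i))"
proof -
  have "0 \<in> Domain (op_power A \<sigma>)"
    using Domain_op_power_sum[of "{}"] by simp
  then have zero: "\<iota> 0 = 0"
    using scale_space_linear[OF \<iota>, of 0 0 1] by simp
  show ?thesis
    using e
  proof (induction I rule: infinite_finite_induct)
    case (insert i I)
    then show ?case
      using scale_space_linear[OF \<iota>, of "e i" "\<Sum>i\<in>I. c i *\<^sub>C e i" "c i"] Domain_op_power_sum[of I e]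
      by simp
  qed (simp_all add: zero)
qed

text \<open>Both powers come from A^\<sigma>: one acts on u, the other is moved over from x. Against
  an eigenvector all inner products of the scale are thus multiples of one another.\<close>

lemma scale_space_cinner_eigenvector:
  assumes "is_scale_space A \<sigma> \<iota>" "u \<in> eigenspace A (complex_of_real p)" "x \<in> Domain (op_power A \<sigma>)"
  shows "cinner (\<iota> u) (\<iota> x) = p powr (2 * \<sigma>) *\<^sub>R cinner u x"
proof -
  obtain x' where x': "(x, x') \<in> op_power A \<sigma>" using assms(3) by blast
  have "cinner (\<iota> u) (\<iota> x) = cinner (p powr \<sigma> *\<^sub>R u) x'"
    by (rule scale_space_cinner[OF assms(1) eigenvector_op_power[OF assms(2)] x'])
  also have "\<dots> = (p powr \<sigma> * p powr \<sigma>) *\<^sub>R cinner u x"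
    by (simp add: cinner_scaleR_left eigenvector_cinner[OF assms(2) x'])
  also have "p powr \<sigma> * p powr \<sigma> = p powr (2 * \<sigma>)"
    by (simp add: powr_add[symmetric])
  finally show ?thesis .
qed

lemma extend_op_bounded:
  fixes \<iota> :: "'a \<Rightarrow> 'k::complex_hilbert" and B :: "'a \<Rightarrow> 'm::complex_hilbert"
  assumes \<iota>: "is_scale_space A \<sigma> \<iota>"
    and "\<And>c u v. u \<in> Domain (op_power A \<sigma>) \<Longrightarrow> v \<in> Domain (op_power A \<sigma>) \<Longrightarrow>
      B (c *\<^sub>C u + v) = c *\<^sub>C B u + B v"
    and "\<And>u. u \<in> Domain (op_power A \<sigma>) \<Longrightarrow> norm (B u) \<le> C * norm (\<iota> u)"
  shows "bounded_linear (extend_op A \<sigma> \<iota> B)" "clinear (extend_op A \<sigma> \<iota> B)"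
    and "\<And>u. u \<in> Domain (op_power A \<sigma>) \<Longrightarrow> extend_op A \<sigma> \<iota> B (\<iota> u) = B u"
proof -
  have "\<exists>!S. bounded_linear S \<and> clinear S \<and> (\<forall>u\<in>Domain (op_power A \<sigma>). S (\<iota> u) = B u)"
    by (rule dense_extension[OF Domain_op_power_linear scale_space_linear[OF \<iota>] assms(2)
          scale_space_dense[OF \<iota>] assms(3)])
  from theI'[OF this]
  show "bounded_linear (extend_op A \<sigma> \<iota> B)" "clinear (extend_op A \<sigma> \<iota> B)"
    and "\<And>u. u \<in> Domain (op_power A \<sigma>) \<Longrightarrow> extend_op A \<sigma> \<iota> B (\<iota> u) = B u"
    unfolding extend_op_def by auto
qed

text \<open>A coefficient <e i, u> is a multiple of the inner product with
  \<open>\<iota> (e i)\<close> in the scale space, hence bounded in its norm even for negative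
  \<sigma>, where this norm is weaker than the original one. So operators built from finitely many
  eigenvectors extend to every space of the scale.\<close>

lemma extend_op_finite_rank:
  fixes \<iota> :: "'a \<Rightarrow> 'k::complex_hilbert" and g :: "'i \<Rightarrow> 'm::complex_hilbert"
  assumes \<iota>: "is_scale_space A \<sigma> \<iota>" and I: "finite I"
    and e: "\<And>i. i \<in> I \<Longrightarrow> e i \<in> eigenspace A (complex_of_real (p i))" "\<And>i. i \<in> I \<Longrightarrow> 0 < p i"
  defines "B \<equiv> \<lambda>u. \<Sum>i\<in>I. cinner (e i) u *\<^sub>C g i"
  shows "bounded_linear (extend_op A \<sigma> \<iota> B)"
    and "\<And>u. u \<in> Domain (op_power A \<sigma>) \<Longrightarrow> extend_op A \<sigma> \<iota> B (\<iota> u) = B u"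
proof -
  have lin: "B (c *\<^sub>C u + v) = c *\<^sub>C B u + B v" for c u v
    by (simp add: B_def cinner_add_right cinner_scaleC_right complex_vs.scale_left_distrib sum.distrib
        complex_vs.scale_sum_right)
  define C where "C = (\<Sum>i\<in>I. p i powr (- 2 * \<sigma>) * norm (\<iota> (e i)) * norm (g i))"
  have bound: "norm (B u) \<le> C * norm (\<iota> u)" if u: "u \<in> Domain (op_power A \<sigma>)" for u
  proof -
    have "norm (B u) \<le> (\<Sum>i\<in>I. cmod (cinner (e i) u) * norm (g i))"
      unfolding B_def by (rule order_trans[OF norm_sum]) (simp add: norm_scaleC)
    also have "\<dots> \<le> (\<Sum>i\<in>I. p i powr (- 2 * \<sigma>) * norm (\<iota> (e i)) * norm (g i) * norm (\<iota> u))"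
    proof (rule sum_mono)
      fix i assume i: "i \<in> I"
      have "cinner (e i) u = p i powr (- 2 * \<sigma>) *\<^sub>R cinner (\<iota> (e i)) (\<iota> u)"
        unfolding scale_space_cinner_eigenvector[OF \<iota> e(1)[OF i] u]
        using e(2)[OF i] by (simp add: powr_add[symmetric])
      then have "cmod (cinner (e i) u) = p i powr (- 2 * \<sigma>) * cmod (cinner (\<iota> (e i)) (\<iota> u))"
        by simp
      also have "\<dots> \<le> p i powr (- 2 * \<sigma>) * (norm (\<iota> (e i)) * norm (\<iota> u))"
        by (intro mult_left_mono cauchy_schwarz) simp
      finally have "cmod (cinner (e i) u) * norm (g i)
          \<le> p i powr (- 2 * \<sigma>) * (norm (\<iota> (e i)) * norm (\<iota> u)) * norm (g i)"
        by (intro mult_right_mono) auto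
      then show "cmod (cinner (e i) u) * norm (g i)
          \<le> p i powr (- 2 * \<sigma>) * norm (\<iota> (e i)) * norm (g i) * norm (\<iota> u)"
        by (simp add: mult_ac)
    qed
    finally show ?thesis by (simp add: C_def sum_distrib_right)
  qed
  show "bounded_linear (extend_op A \<sigma> \<iota> B)"
    and "\<And>u. u \<in> Domain (op_power A \<sigma>) \<Longrightarrow> extend_op A \<sigma> \<iota> B (\<iota> u) = B u"
    using extend_op_bounded[OF \<iota> lin bound] by blast+
qed

end

section \<open>Two spaces of the scale whose indices differ by one half\<close>

locale scale_pair = spectral_op E A \<alpha>
  for E :: "real set \<Rightarrow> 'a::complex_hilbert \<Rightarrow> 'a" and A \<alpha> +
  fixes \<tau> :: real and \<iota> :: "'a \<Rightarrow> 'k::complex_hilbert" and \<iota>' :: "'a \<Rightarrow> 'm::complex_hilbert"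
  assumes \<iota>: "is_scale_space A \<tau> \<iota>" and \<iota>': "is_scale_space A (\<tau> - 1/2) \<iota>'"
begin

lemma Domain_lower: "x \<in> Domain (op_power A \<tau>) \<Longrightarrow> x \<in> Domain (op_power A (\<tau> - 1/2))"
  using op_power_lower[of x _ \<tau> "1/2"] by auto

text \<open>The index drops by 1/2, so the squared norms differ by one power of A, and A is at least
  \<sigma> on such x. With \<sigma> = \<alpha> this yields continuity of the inclusion J.\<close>

lemma norm_lower:
  assumes x: "x \<in> Domain (op_power A \<tau>)" and "E {..<\<sigma>} x = 0" "0 < \<sigma>"
  shows "\<sigma> * (norm (\<iota>' x))\<^sup>2 \<le> (norm (\<iota> x))\<^sup>2"
proof -
  obtain y where xy: "(x, y) \<in> op_power A \<tau>" using x by blast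
  have xy': "(x, \<Phi> (negpow (1/2)) y) \<in> op_power A (\<tau> - 1/2)"
    by (rule op_power_lower[OF xy]) simp
  have "(norm (\<iota>' x))\<^sup>2 = (norm (\<Phi> (negpow (1/2)) y))\<^sup>2"
    using scale_space_cinner[OF \<iota>' xy' xy'] unfolding cinner_self of_real_eq_iff .
  also have "\<dots> \<le> (\<sigma> powr (- (1/2)) * norm y)\<^sup>2"
    by (intro power_mono op_power_lower_norm[OF xy assms(2) _ assms(3)]) auto
  also have "\<dots> = (\<sigma> powr (- (1/2)) * \<sigma> powr (- (1/2))) * (norm y)\<^sup>2"
    by (simp add: power2_eq_square)
  also have "\<sigma> powr (- (1/2)) * \<sigma> powr (- (1/2)) = 1 / \<sigma>"
    using assms(3) by (simp add: powr_add[symmetric] powr_minus field_simps)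
  also have "(norm y)\<^sup>2 = (norm (\<iota> x))\<^sup>2"
    using scale_space_cinner[OF \<iota> xy xy] unfolding cinner_self of_real_eq_iff by simp
  finally show ?thesis
    using assms(3) by (simp add: field_simps)
qed

abbreviation J :: "'k \<Rightarrow> 'm" where
  "J \<equiv> inclusion A \<tau> \<iota> \<iota>'"

lemma bounded_linear_J: "bounded_linear J"
  and clinear_J: "clinear J"
  and J_\<iota>: "x \<in> Domain (op_power A \<tau>) \<Longrightarrow> J (\<iota> x) = \<iota>' x"
proof -
  have lin: "\<iota>' (c *\<^sub>C u + v) = c *\<^sub>C \<iota>' u + \<iota>' v"
    if "u \<in> Domain (op_power A \<tau>)" "v \<in> Domain (op_power A \<tau>)" for c u v
    using that by (intro scale_space_linear[OF \<iota>'] Domain_lower)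
  have bound: "norm (\<iota>' u) \<le> sqrt (1 / \<alpha>) * norm (\<iota> u)" if "u \<in> Domain (op_power A \<tau>)" for u
  proof (rule power2_le_imp_le)
    show "(norm (\<iota>' u))\<^sup>2 \<le> (sqrt (1 / \<alpha>) * norm (\<iota> u))\<^sup>2"
      using norm_lower[OF that E_below_zero \<alpha>_pos] \<alpha>_pos
      by (simp add: power_mult_distrib field_simps real_sqrt_divide)
  qed (use \<alpha>_pos in simp)
  note * = extend_op_bounded[OF \<iota> lin bound]
  show "bounded_linear J" "clinear J" and "x \<in> Domain (op_power A \<tau>) \<Longrightarrow> J (\<iota> x) = \<iota>' x"
    unfolding inclusion_def using * by blast+
qed

text \<open>On the image of \<iota> this compares p^(2 \<tau>) with p^(2 \<tau> - 1). Both sides are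
  continuous in y, so the identity survives in the completion.\<close>

lemma eigenvector_form:
  assumes u: "u \<in> eigenspace A (complex_of_real p)" and p: "0 < p"
  shows "cinner (\<iota> u) y = complex_of_real p * cinner (J (\<iota> u)) (J y)"
proof (rule dense_closed_all[OF scale_space_dense[OF \<iota>]])
  show "closed {y. cinner (\<iota> u) y = complex_of_real p * cinner (J (\<iota> u)) (J y)}"
    by (intro closed_Collect_eq continuous_intros continuous_on_cinner
        linear_continuous_on bounded_linear_J)
  fix y assume "y \<in> \<iota> ` Domain (op_power A \<tau>)"
  then obtain x where x: "x \<in> Domain (op_power A \<tau>)" "y = \<iota> x" by blast
  have "p powr (2 * \<tau>) = p * p powr (2 * (\<tau> - 1/2))"
    using p by (simp add: powr_diff algebra_simps)
  then show "cinner (\<iota> u) y = complex_of_real p * cinner (J (\<iota> u)) (J y)"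
    using x Domain_lower[OF x(1)] eigenspace_Domain[OF u]
    by (simp add: J_\<iota> scale_space_cinner_eigenvector[OF \<iota> u] scale_space_cinner_eigenvector[OF \<iota>' u]
        scaleR_conv_of_real)
qed

text \<open>On the image of \<iota> this is \<open>norm_lower\<close>, but the orthogonality
  conditions on y are not inherited by approximating vectors. So R projects the eigenvectors away:
  the inequality for \<open>R y\<close> is a closed condition without constraints that holds on the
  dense image, and \<open>R y = y\<close> for the y in question.\<close>

lemma gap_inequality:
  assumes I: "finite I"
    and e: "\<And>i. i \<in> I \<Longrightarrow> e i \<in> eigenspace A (complex_of_real (p i))" "\<And>i. i \<in> I \<Longrightarrow> 0 < p i"
    and orth: "\<And>i k. i \<in> I \<Longrightarrow> k \<in> I \<Longrightarrow> cinner (e i) (e k) = (if i = k then 1 else 0)"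
    and \<sigma>: "0 < \<sigma>" "\<And>x. (\<And>i. i \<in> I \<Longrightarrow> cinner (e i) x = 0) \<Longrightarrow> E {..<\<sigma>} x = 0"
    and y: "\<And>i. i \<in> I \<Longrightarrow> cinner (J (\<iota> (e i))) (J y) = 0"
  shows "\<sigma> * (norm (J y))\<^sup>2 \<le> (norm y)\<^sup>2"
proof -
  \<comment> \<open>The squared norm of \<open>\<iota> (e i)\<close> is
    \<open>p i powr (2 * \<tau>)\<close>, so R is the orthogonal projection onto the complement of
    these vectors.\<close>
  define R where "R y = y - (\<Sum>i\<in>I. (p i powr (- 2 * \<tau>) *\<^sub>R cinner (\<iota> (e i)) y) *\<^sub>C \<iota> (e i))" for y
  have contR: "continuous_on UNIV R"
    unfolding R_def by (intro continuous_intros continuous_on_scaleC continuous_on_cinner)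
  have contJR: "continuous_on UNIV (\<lambda>y. J (R y))"
    using continuous_on_compose2[OF linear_continuous_on[OF bounded_linear_J, of UNIV] contR] by simp
  have "\<sigma> * (norm (J (R y)))\<^sup>2 \<le> (norm (R y))\<^sup>2"
  proof (rule dense_closed_all[OF scale_space_dense[OF \<iota>], of "\<lambda>y. \<sigma> * (norm (J (R y)))\<^sup>2 \<le> (norm (R y))\<^sup>2"])
    show "closed {y. \<sigma> * (norm (J (R y)))\<^sup>2 \<le> (norm (R y))\<^sup>2}"
      by (intro closed_Collect_le continuous_intros contR contJR)
    fix y assume "y \<in> \<iota> ` Domain (op_power A \<tau>)"
    then obtain x where x: "x \<in> Domain (op_power A \<tau>)" "y = \<iota> x" by blast
    have eD: "e i \<in> Domain (op_power A \<tau>)" if "i \<in> I" for i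
      using eigenspace_Domain e(1) that by blast
    define s where "s = (\<Sum>i\<in>I. cinner (e i) x *\<^sub>C e i)"
    have s: "s \<in> Domain (op_power A \<tau>)"
      unfolding s_def by (rule Domain_op_power_sum[OF eD])
    define x' where "x' = (-1) *\<^sub>C s + x"
    have x': "x' \<in> Domain (op_power A \<tau>)"
      unfolding x'_def by (rule Domain_op_power_linear[OF s x(1)])
    have "p i powr (- 2 * \<tau>) *\<^sub>R cinner (\<iota> (e i)) (\<iota> x) = cinner (e i) x" if "i \<in> I" for i
      unfolding scale_space_cinner_eigenvector[OF \<iota> e(1)[OF that] x(1)]
      using e(2)[OF that] by (simp add: powr_add[symmetric])
    then have "R y = \<iota> x - (\<Sum>i\<in>I. cinner (e i) x *\<^sub>C \<iota> (e i))"
      unfolding R_def x(2) by simp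
    also have "\<dots> = \<iota> x'"
      unfolding x'_def scale_space_linear[OF \<iota> s x(1)]
      by (simp add: s_def scale_space_sum[OF \<iota> eD])
    finally have R: "R y = \<iota> x'" .
    have "cinner (e i) x' = 0" if "i \<in> I" for i
      using orthonormal_expansion[OF I that orth, of "\<lambda>i. cinner (e i) x"]
      by (simp add: x'_def s_def cinner_diff_right)
    then have "\<sigma> * (norm (\<iota>' x'))\<^sup>2 \<le> (norm (\<iota> x'))\<^sup>2"
      by (intro norm_lower[OF x' \<sigma>(2) \<sigma>(1)])
    then show "\<sigma> * (norm (J (R y)))\<^sup>2 \<le> (norm (R y))\<^sup>2"
      unfolding R J_\<iota>[OF x'] .
  qed
  moreover have "R y = y"
  proof -
    have "cinner (\<iota> (e i)) y = 0" if "i \<in> I" for i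
      using eigenvector_form[OF e[OF that], of y] y[OF that] by simp
    then show ?thesis unfolding R_def by simp
  qed
  ultimately show ?thesis by simp
qed

text \<open>Q has finite rank, so both operators exist as bounded extensions and their
  \<open>onorm\<close> is meaningful. On the span of the \<open>e i\<close> the projection Q is the
  identity, and the two operator norms bound v - P v in a and in b.\<close>

lemma defect_bounds:
  assumes I: "finite I"
    and e: "\<And>i. i \<in> I \<Longrightarrow> e i \<in> eigenspace A (complex_of_real (p i))" "\<And>i. i \<in> I \<Longrightarrow> 0 < p i"
    and orth: "\<And>i k. i \<in> I \<Longrightarrow> k \<in> I \<Longrightarrow> cinner (e i) (e k) = (if i = k then 1 else 0)"
    and P: "clinear P"
  defines "D \<equiv> defect A \<tau> \<iota> P (orth_proj (cspan (e ` I)))"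
    and "D' \<equiv> defect_lower A \<tau> \<iota> (\<tau> - 1/2) \<iota>' P (orth_proj (cspan (e ` I)))"
  shows "0 \<le> onorm D" "0 \<le> onorm D'"
    and "\<And>c. norm ((\<Sum>i\<in>I. c i *\<^sub>C \<iota> (e i)) - P (\<Sum>i\<in>I. c i *\<^sub>C \<iota> (e i)))
      \<le> onorm D * norm (\<Sum>i\<in>I. c i *\<^sub>C \<iota> (e i))"
    and "\<And>c. norm (J ((\<Sum>i\<in>I. c i *\<^sub>C \<iota> (e i)) - P (\<Sum>i\<in>I. c i *\<^sub>C \<iota> (e i))))
      \<le> onorm D' * norm (J (\<Sum>i\<in>I. c i *\<^sub>C \<iota> (e i)))"
proof -
  have eD: "e i \<in> Domain (op_power A \<sigma>)" if "i \<in> I" for i \<sigma>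
    using eigenspace_Domain e(1) that by blast
  let ?Q = "orth_proj (cspan (e ` I))"
  have Q: "?Q x = (\<Sum>i\<in>I. cinner (e i) x *\<^sub>C e i)" for x
    by (rule orth_proj_orthonormal[OF I orth])
  have \<iota>_sum: "\<iota> (\<Sum>i\<in>I. c i *\<^sub>C e i) = (\<Sum>i\<in>I. c i *\<^sub>C \<iota> (e i))" for c
    by (rule scale_space_sum[OF \<iota> eD])
  have \<iota>Q: "\<iota> (?Q x) - P (\<iota> (?Q x)) = (\<Sum>i\<in>I. cinner (e i) x *\<^sub>C (\<iota> (e i) - P (\<iota> (e i))))" for x
    unfolding Q \<iota>_sum
    by (simp add: clinear_sum[OF P] clinear_scaleC[OF P] complex_vs.scale_right_diff_distrib sum_subtractf)
  have J\<iota>Q: "J (\<iota> (?Q x) - P (\<iota> (?Q x))) = (\<Sum>i\<in>I. cinner (e i) x *\<^sub>C J (\<iota> (e i) - P (\<iota> (e i))))" for x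
    unfolding \<iota>Q by (simp add: clinear_sum[OF clinear_J] clinear_scaleC[OF clinear_J])
  have D: "bounded_linear D" and D_eq: "\<And>x. x \<in> Domain (op_power A \<tau>) \<Longrightarrow> D (\<iota> x) = \<iota> (?Q x) - P (\<iota> (?Q x))"
    unfolding D_def defect_def \<iota>Q by (rule extend_op_finite_rank[where e = e and p = p, OF \<iota> I]; use e in blast)+
  have D': "bounded_linear D'"
    and D'_eq: "\<And>x. x \<in> Domain (op_power A (\<tau> - 1/2)) \<Longrightarrow> D' (\<iota>' x) = J (\<iota> (?Q x) - P (\<iota> (?Q x)))"
    unfolding D'_def defect_lower_def J\<iota>Q by (rule extend_op_finite_rank[where e = e and p = p, OF \<iota>' I]; use e in blast)+
  show "0 \<le> onorm D" "0 \<le> onorm D'"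
    by (rule onorm_pos_le[OF D], rule onorm_pos_le[OF D'])
  fix c
  define v where "v = (\<Sum>i\<in>I. c i *\<^sub>C e i)"
  have v: "v \<in> Domain (op_power A \<sigma>)" for \<sigma>
    unfolding v_def by (rule Domain_op_power_sum[OF eD])
  have \<iota>v: "\<iota> v = (\<Sum>i\<in>I. c i *\<^sub>C \<iota> (e i))"
    unfolding v_def by (rule \<iota>_sum)
  have "?Q v = v"
    unfolding Q v_def by (rule sum.cong) (simp_all add: orthonormal_expansion[OF I _ orth])
  then have eq: "D (\<iota> v) = \<iota> v - P (\<iota> v)" "D' (\<iota>' v) = J (\<iota> v - P (\<iota> v))"
    using D_eq[OF v] D'_eq[OF v] by simp_all
  show "norm ((\<Sum>i\<in>I. c i *\<^sub>C \<iota> (e i)) - P (\<Sum>i\<in>I. c i *\<^sub>C \<iota> (e i)))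
      \<le> onorm D * norm (\<Sum>i\<in>I. c i *\<^sub>C \<iota> (e i))"
    using onorm[OF D, of "\<iota> v"] unfolding eq unfolding \<iota>v .
  show "norm (J ((\<Sum>i\<in>I. c i *\<^sub>C \<iota> (e i)) - P (\<Sum>i\<in>I. c i *\<^sub>C \<iota> (e i))))
      \<le> onorm D' * norm (J (\<Sum>i\<in>I. c i *\<^sub>C \<iota> (e i)))"
    using onorm[OF D', of "\<iota>' v"] unfolding eq unfolding J_\<iota>[OF v, symmetric] \<iota>v .
qed

end

section \<open>Error bounds\<close>

locale rayleigh_ritz = scale_pair E A \<alpha> \<tau> \<iota> \<iota>'
  for E :: "real set \<Rightarrow> 'h::complex_hilbert \<Rightarrow> 'h" and A \<alpha> \<tau>
    and \<iota> :: "'h \<Rightarrow> 'k::complex_hilbert" and \<iota>' :: "'h \<Rightarrow> 'm::complex_hilbert" +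
  fixes N :: enat and lam :: "nat \<Rightarrow> real" and u :: "nat \<Rightarrow> 'h"
    and w :: "nat \<Rightarrow> 'k" and \<Lambda> :: "nat \<Rightarrow> nat \<Rightarrow> real" and U :: "nat \<Rightarrow> nat \<Rightarrow> 'k"
  assumes eigenpairs: "lower_eigenpairs A N lam u"
    and complete: "complete_trial_vectors w"
    and ritz_pairs: "1 \<le> n \<Longrightarrow> ritz_pairs (T_op A \<tau> \<iota>) J w n (\<Lambda> n) (U n)"
begin

definition I :: "nat set" where
  "I = {i. 1 \<le> i \<and> enat i \<le> N}"

lemma lam_mono: "i \<in> I \<Longrightarrow> k \<in> I \<Longrightarrow> i \<le> k \<Longrightarrow> lam i \<le> lam k"
  and u_eigenspace: "i \<in> I \<Longrightarrow> u i \<in> eigenspace A (complex_of_real (lam i))"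
  and lam_below: "i \<in> I \<Longrightarrow> ereal (lam i) < lambda_inf A"
  and u_orthonormal: "i \<in> I \<Longrightarrow> k \<in> I \<Longrightarrow> cinner (u i) (u k) = (if i = k then 1 else 0)"
  and eigenspace_eq: "ereal p < lambda_inf A \<Longrightarrow>
    eigenspace A (complex_of_real p) = cspan {u i |i. i \<in> I \<and> lam i = p}"
  using eigenpairs unfolding lower_eigenpairs_def Let_def I_def[symmetric] mono_on_def by blast+

lemma I_initial: "k \<in> I \<Longrightarrow> i \<in> {1..k} \<Longrightarrow> i \<in> I"
  unfolding I_def by (auto intro: order_trans[of "enat i" "enat k" N])

lemma u_nonzero: "i \<in> I \<Longrightarrow> u i \<noteq> 0"
  using u_orthonormal[of i i] by auto

lemma lam_pos: "i \<in> I \<Longrightarrow> 0 < lam i"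
  using eigenvalue_ge[OF u_eigenspace u_nonzero] \<alpha>_pos less_le_trans by blast

lemma lam_in_spectrum: "i \<in> I \<Longrightarrow> complex_of_real (lam i) \<in> spectrum A"
  using eigenvalue_in_spectrum[OF u_eigenspace u_nonzero] by blast

text \<open>The norm of \<open>u i\<close> in the space with index \<tau> - 1/2 is
  \<open>lam i powr (\<tau> - 1/2)\<close>; the factor normalizes it in b.\<close>

definition \<phi> :: "nat \<Rightarrow> 'k" where
  "\<phi> i = complex_of_real (lam i powr (1/2 - \<tau>)) *\<^sub>C \<iota> (u i)"

lemma \<phi>_form:
  assumes "i \<in> I"
  shows "cinner (\<phi> i) y = complex_of_real (lam i) * cinner (J (\<phi> i)) (J y)"
  unfolding \<phi>_def
  by (simp add: clinear_scaleC[OF clinear_J] cinner_scaleC_left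
      eigenvector_form[OF u_eigenspace[OF assms] lam_pos[OF assms]])

lemma J_\<phi>_orthonormal:
  assumes i: "i \<in> I" and k: "k \<in> I"
  shows "cinner (J (\<phi> i)) (J (\<phi> k)) = (if i = k then 1 else 0)"
proof -
  have D: "u i \<in> Domain (op_power A \<sigma>)" if "i \<in> I" for i \<sigma>
    using eigenspace_Domain u_eigenspace that by blast
  have "cinner (\<iota>' (u i)) (\<iota>' (u k)) = lam i powr (2 * (\<tau> - 1/2)) *\<^sub>R cinner (u i) (u k)"
    by (rule scale_space_cinner_eigenvector[OF \<iota>' u_eigenspace[OF i] D[OF k]])
  moreover have "lam i powr (1/2 - \<tau>) * (lam i powr (1/2 - \<tau>) * lam i powr (2 * (\<tau> - 1/2))) = 1"
    using lam_pos[OF i] by (simp add: powr_add[symmetric])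
  then have "complex_of_real (lam i powr (1/2 - \<tau>)) * (complex_of_real (lam i powr (1/2 - \<tau>))
      * complex_of_real (lam i powr (2 * (\<tau> - 1/2)))) = 1"
    unfolding of_real_mult[symmetric] by simp
  ultimately show ?thesis
    unfolding \<phi>_def clinear_scaleC[OF clinear_J] cinner_scaleC_left cinner_scaleC_right J_\<iota>[OF D[OF i]] J_\<iota>[OF D[OF k]]
    using u_orthonormal[OF i k] by (cases "i = k") (auto simp: scaleR_conv_of_real)
qed

lemma ritz:
  assumes "1 \<le> n"
  shows "ritz J w n (\<Lambda> n) (U n)"
proof
  note r = ritz_pairs[OF assms, unfolded ritz_pairs_def mono_on_def]
  show "clinear J" by (rule clinear_J)
  show "\<Lambda> n i \<le> \<Lambda> n k" if "i \<in> {1..n}" "k \<in> {1..n}" "i \<le> k" for i k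
    using r that by blast
  show "\<exists>x. U n k = (\<Sum>j=1..n. x j *\<^sub>C w j)" if "k \<in> {1..n}" for k
    using r that by blast
  show "cinner (J (U n i)) (J (U n k)) = (if i = k then 1 else 0)" if "i \<in> {1..n}" "k \<in> {1..n}" for i k
    using r that by blast
  show "cinner (U n i) (U n k) = (if i = k then complex_of_real (\<Lambda> n i) else 0)"
    if "i \<in> {1..n}" "k \<in> {1..n}" for i k
    using r that by blast
qed

text \<open>By \<open>sp\<close>, the spectrum below \<sigma> consists of isolated eigenvalues whose
  eigenvectors are all among u 1, ..., u m. Orthogonality to these leaves no mass at any such point,
  hence none below \<sigma>.\<close>

lemma spectral_gap:
  assumes m: "{1..m} \<subseteq> I" and \<sigma>: "0 < \<sigma>"
    and sp: "\<And>p. p < \<sigma> \<Longrightarrow> complex_of_real p \<in> spectrum A \<Longrightarrow>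
      ereal p < lambda_inf A \<and> (\<forall>i\<in>I. lam i = p \<longrightarrow> i \<le> m)"
    and y: "\<And>i. i \<in> {1..m} \<Longrightarrow> cinner (J (\<phi> i)) (J y) = 0"
  shows "\<sigma> * (norm (J y))\<^sup>2 \<le> (norm y)\<^sup>2"
proof (rule gap_inequality[of "{1..m}" u lam])
  show "E {..<\<sigma>} x = 0" if x: "\<And>i. i \<in> {1..m} \<Longrightarrow> cinner (u i) x = 0" for x
  proof (rule E_isolated_null)
    fix p assume "p \<in> {..<\<sigma>}" and p: "complex_of_real p \<in> spectrum A"
    then have below: "ereal p < lambda_inf A" and le: "\<And>i. i \<in> I \<Longrightarrow> lam i = p \<Longrightarrow> i \<le> m"
      using sp by auto
    have "complex_of_real p isolated_in spectrum A"
      using below_lambda_inf_discrete[OF below p] by (simp add: discrete_spectrum_def)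
    moreover have "E {p} x = 0"
    proof (rule E_singleton_zero)
      fix v assume "v \<in> eigenspace A (complex_of_real p)"
      then show "cinner v x = 0"
        unfolding eigenspace_eq[OF below]
        by (rule cinner_span_zero) (use x le in \<open>auto simp: I_def\<close>)
    qed
    ultimately show "complex_of_real p isolated_in spectrum A \<and> E {p} x = 0" by blast
  qed simp
  show "cinner (J (\<iota> (u i))) (J y) = 0" if i: "i \<in> {1..m}" for i
    using y[OF i] lam_pos[of i] m i
    by (auto simp: \<phi>_def clinear_scaleC[OF clinear_J] cinner_scaleC_left)
  show "cinner (u i) (u k) = (if i = k then 1 else 0)" if "i \<in> {1..m}" "k \<in> {1..m}" for i k
    by (rule u_orthonormal) (use m that in auto)
qed (use m u_eigenspace lam_pos \<sigma> in auto)

lemma ritz_value_ge: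
  assumes j: "j \<in> I" "j \<le> n"
  shows "lam j \<le> \<Lambda> n j"
proof -
  have n: "1 \<le> n" using j by (auto simp: I_def)
  interpret ritz J w n "\<Lambda> n" "U n" by (rule ritz[OF n])
  show ?thesis
  proof (rule ritz_lower[where \<phi> = \<phi>])
    show "j \<in> {1..n}" using j by (auto simp: I_def)
    fix y assume y: "\<And>i. i \<in> {1..<j} \<Longrightarrow> cinner (J (\<phi> i)) (J y) = 0"
    show "lam j * (norm (J y))\<^sup>2 \<le> (norm y)\<^sup>2"
    \<comment> \<open>An eigenvalue strictly less than \<open>lam j\<close> has an index below j,
      whatever the multiplicity of \<open>lam j\<close>; for j = 1 the list of constraints is
      empty.\<close>
    proof (rule spectral_gap[of "j - 1"])
      show "{1..j - 1} \<subseteq> I" using I_initial[OF j(1)] by auto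
      show "0 < lam j" by (rule lam_pos[OF j(1)])
      show "ereal p < lambda_inf A \<and> (\<forall>i\<in>I. lam i = p \<longrightarrow> i \<le> j - 1)" if "p < lam j" for p
      proof
        show "ereal p < lambda_inf A"
          using that lam_below[OF j(1)] less_trans ereal_less_eq(3) by (metis ereal_less(2) less_ereal.simps(1))
        show "\<forall>i\<in>I. lam i = p \<longrightarrow> i \<le> j - 1"
        proof (intro ballI impI)
          fix i assume i: "i \<in> I" "lam i = p"
          then have "\<not> j \<le> i" using lam_mono[OF j(1) i(1)] that by auto
          then show "i \<le> j - 1" by simp
        qed
      qed
      show "cinner (J (\<phi> i)) (J y) = 0" if "i \<in> {1..j - 1}" for i
        using that by (intro y) auto
    qed
  qed
qed

lemma ritz_value_le:
  assumes j: "j \<in> I" "j \<le> n"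
    and d: "0 \<le> d" "\<And>c. norm ((\<Sum>i=1..j. c i *\<^sub>C \<phi> i) - ritz_projection w n (\<Sum>i=1..j. c i *\<^sub>C \<phi> i))
      \<le> d * norm (\<Sum>i=1..j. c i *\<^sub>C \<phi> i)"
  shows "\<Lambda> n j * (1 - 2 * (lam j / lam 1) * d\<^sup>2) \<le> lam j"
proof -
  have n: "1 \<le> n" using j by (auto simp: I_def)
  interpret ritz J w n "\<Lambda> n" "U n" by (rule ritz[OF n])
  have I: "i \<in> I" if "i \<in> {1..j}" for i
    using I_initial[OF j(1) that] .
  have j1: "1 \<in> {1..j}" "1 \<in> I" using j(1) I by (auto simp: I_def)
  show ?thesis
  proof (rule ritz_upper[where \<phi> = \<phi> and lam = lam])
    show "j \<in> {1..n}" using j by (auto simp: I_def)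
    show "0 < lam 1" by (rule lam_pos[OF j1(2)])
    show "cinner (\<phi> i) y = complex_of_real (lam i) * cinner (J (\<phi> i)) (J y)" if "i \<in> {1..j}" for i y
      by (rule \<phi>_form[OF I[OF that]])
    show "lam 1 \<le> lam i" if "i \<in> {1..j}" for i
      using lam_mono[OF j1(2) I[OF that]] that by simp
    show "lam i \<le> lam j" if "i \<in> {1..j}" for i
      using lam_mono[OF I[OF that] j(1)] that by simp
  qed (use J_\<phi>_orthonormal I d in blast)+
qed

text \<open>A vector of the dense span lies in the span of finitely many \<open>w i\<close>, and P
  is the best approximation from every larger trial space.\<close>

lemma ritz_projection_tendsto: "(\<lambda>n. ritz_projection w n x) \<longlonglongrightarrow> x"
proof (rule LIMSEQ_I)
  fix e :: real assume e: "e > 0"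
  have "x \<in> closure (cspan (w ` {1..}))"
    using complete by (simp add: complete_trial_vectors_def)
  then obtain y where y: "y \<in> cspan (w ` {1..})" "dist y x < e"
    using e unfolding closure_approachable by blast
  have "\<exists>m. y \<in> cspan (w ` {1..m})"
    using y(1)
  proof (induction rule: complex_vs.span_induct_alt)
    case base
    then show ?case using complex_vs.span_zero by blast
  next
    case (step c b z)
    then obtain k m where km: "k \<ge> 1" "b = w k" "z \<in> cspan (w ` {1..m})" by auto
    have "z \<in> cspan (w ` {1..max k m})"
      using complex_vs.span_mono[of "w ` {1..m}" "w ` {1..max k m}"] km(3) by fastforce
    moreover have "b \<in> cspan (w ` {1..max k m})"
      using km by (intro complex_vs.span_base) auto
    ultimately show ?case
      by (intro exI[of _ "max k m"] complex_vs.span_add complex_vs.span_scale)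
  qed
  then obtain m where m: "y \<in> cspan (w ` {1..m})" by blast
  have "norm (ritz_projection w n x - x) < e" if "n \<ge> max m 1" for n
  proof -
    interpret ritz J w n "\<Lambda> n" "U n" by (rule ritz) (use that in simp)
    have "y \<in> cspan (w ` {1..n})"
      using complex_vs.span_mono[of "w ` {1..m}" "w ` {1..n}"] m that by fastforce
    then have "norm (x - P x) \<le> norm (x - y)" by (rule P_best_approx)
    then show ?thesis
      using y(2) by (simp add: dist_norm norm_minus_commute)
  qed
  then show "\<exists>no. \<forall>n\<ge>no. norm (ritz_projection w n x - x) < e" by blast
qed

lemma ritz_value_eventually_less:
  assumes j: "j \<in> I" and \<epsilon>: "\<epsilon> > 0"
  shows "\<forall>\<^sub>F n in sequentially. \<Lambda> n j < lam j + \<epsilon>"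
proof -
  obtain K where K: "K > 0" "\<And>x. norm (J x) \<le> norm x * K"
    using bounded_linear.pos_bounded[OF bounded_linear_J] by blast
  \<comment> \<open>On a finite-dimensional span, strong convergence of P is convergence in norm:
    each b-coefficient of x is at most |J x| \<le> K |x|, so \<open>d n\<close> bounds I - P
    there.\<close>
  define d where "d n = K * (\<Sum>i=1..j. norm (\<phi> i - ritz_projection w n (\<phi> i)))" for n
  have d0: "0 \<le> d n" for n
    using K(1) by (simp add: d_def sum_nonneg)
  have "d \<longlonglongrightarrow> K * (\<Sum>i=1..j. norm (\<phi> i - \<phi> i))"
    unfolding d_def by (intro tendsto_intros ritz_projection_tendsto)
  then have "d \<longlonglongrightarrow> 0" by simp
  then have "(\<lambda>n. 2 * (lam j / lam 1) * (d n)\<^sup>2) \<longlonglongrightarrow> 2 * (lam j / lam 1) * 0\<^sup>2"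
    by (intro tendsto_intros)
  then have "(\<lambda>n. 2 * (lam j / lam 1) * (d n)\<^sup>2) \<longlonglongrightarrow> 0" by simp
  \<comment> \<open>The threshold \<theta> solves (lam j + \<epsilon>) (1 - \<theta>) = lam j, so a
    Ritz value of at least lam j + \<epsilon> would violate the upper bound.\<close>
  moreover have "0 < \<epsilon> / (lam j + \<epsilon>)"
    using \<epsilon> lam_pos[OF j] by simp
  ultimately have "\<forall>\<^sub>F n in sequentially. 2 * (lam j / lam 1) * (d n)\<^sup>2 < \<epsilon> / (lam j + \<epsilon>)"
    by (rule order_tendstoD(2))
  then show ?thesis
    using eventually_ge_at_top[of j]
  proof eventually_elim
    case (elim n)
    have n: "1 \<le> n" using j elim(2) by (auto simp: I_def)
    interpret ritz J w n "\<Lambda> n" "U n" by (rule ritz[OF n])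
    have "norm ((\<Sum>i=1..j. c i *\<^sub>C \<phi> i) - P (\<Sum>i=1..j. c i *\<^sub>C \<phi> i)) \<le> d n * norm (\<Sum>i=1..j. c i *\<^sub>C \<phi> i)" for c
    proof -
      let ?x = "\<Sum>i=1..j. c i *\<^sub>C \<phi> i"
      have c: "cmod (c i) \<le> K * norm ?x" if i: "i \<in> {1..j}" for i
      proof -
        have "c i = cinner (J (\<phi> i)) (J ?x)"
          unfolding clinear_sum[OF clinear_J] clinear_scaleC[OF clinear_J]
          by (rule orthonormal_expansion[symmetric]) (use i I_initial[OF j] J_\<phi>_orthonormal in auto)
        then have "cmod (c i) \<le> norm (J (\<phi> i)) * norm (J ?x)"
          using cauchy_schwarz by metis
        moreover have "(norm (J (\<phi> i)))\<^sup>2 = 1"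
          using J_\<phi>_orthonormal[OF I_initial[OF j i] I_initial[OF j i]] by (simp add: norm_sq_cinner)
        then have "norm (J (\<phi> i)) = 1"
          by (metis norm_ge_zero power2_eq_1_iff neg_0_le_iff_le not_one_le_zero)
        ultimately show ?thesis using K(2)[of ?x] by (simp add: mult.commute)
      qed
      have "?x - P ?x = (\<Sum>i=1..j. c i *\<^sub>C (\<phi> i - P (\<phi> i)))"
        by (simp add: clinear_sum[OF P_clinear] clinear_scaleC[OF P_clinear]
            complex_vs.scale_right_diff_distrib sum_subtractf)
      also have "norm \<dots> \<le> (\<Sum>i=1..j. cmod (c i) * norm (\<phi> i - P (\<phi> i)))"
        by (rule order_trans[OF norm_sum]) (simp add: norm_scaleC)
      also have "\<dots> \<le> (\<Sum>i=1..j. (K * norm ?x) * norm (\<phi> i - P (\<phi> i)))"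
        using c by (intro sum_mono mult_right_mono) auto
      also have "\<dots> = d n * norm ?x"
        by (simp add: d_def sum_distrib_left sum_distrib_right mult_ac)
      finally show ?thesis .
    qed
    from ritz_value_le[OF j elim(2) d0 this]
    have le: "\<Lambda> n j * (1 - 2 * (lam j / lam 1) * (d n)\<^sup>2) \<le> lam j" .
    show "\<Lambda> n j < lam j + \<epsilon>"
    proof (rule ccontr)
      assume "\<not> \<Lambda> n j < lam j + \<epsilon>"
      then have ge: "lam j + \<epsilon> \<le> \<Lambda> n j" by simp
      have pos: "0 < lam j + \<epsilon>" using \<epsilon> lam_pos[OF j] by simp
      have "\<epsilon> / (lam j + \<epsilon>) < 1" using \<epsilon> lam_pos[OF j] by simp
      then have "(lam j + \<epsilon>) * (1 - \<epsilon> / (lam j + \<epsilon>)) \<le> \<Lambda> n j * (1 - \<epsilon> / (lam j + \<epsilon>))"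
        using ge by (intro mult_right_mono) auto
      also have "\<dots> < \<Lambda> n j * (1 - 2 * (lam j / lam 1) * (d n)\<^sup>2)"
        using elim(1) ge pos by (intro mult_strict_left_mono) auto
      also have "\<dots> \<le> lam j" by (rule le)
      finally show False using pos by (simp add: field_simps)
    qed
  qed
qed

lemma \<phi>_sum: "(\<Sum>i\<in>C. c i *\<^sub>C \<phi> i) = (\<Sum>i\<in>C. (c i * complex_of_real (lam i powr (1/2 - \<tau>))) *\<^sub>C \<iota> (u i))"
  by (simp add: \<phi>_def)

text \<open>From \<Lambda> (1 - q) \<le> \<lambda> one reads \<Lambda> - \<lambda> \<le> q \<Lambda>
  without dividing, so the bound holds for every n \<ge> l and not only asymptotically.\<close>

lemma ritz_value_bounds:
  assumes l: "l \<in> I" "l \<le> n" and j: "j \<in> {1..l}"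
  defines "D \<equiv> defect A \<tau> \<iota> (ritz_projection w n) (orth_proj (cspan (u ` {1..l})))"
    and "D' \<equiv> defect_lower A \<tau> \<iota> (\<tau> - 1/2) \<iota>' (ritz_projection w n) (orth_proj (cspan (u ` {1..l})))"
  shows "0 \<le> \<Lambda> n j - lam j"
    and "\<Lambda> n j - lam j \<le> \<Lambda> n l * ((onorm D')\<^sup>2 + 2 * lam l * (\<Sum>i=1..l. 1 / lam i) * (onorm D)\<^sup>2)"
proof -
  have I: "i \<in> I" if "i \<in> {1..l}" for i
    by (rule I_initial[OF l(1) that])
  have jI: "j \<in> I" "j \<le> n" using I j l by auto
  show low: "0 \<le> \<Lambda> n j - lam j"
    using ritz_value_ge[OF jI] by simp
  have n: "1 \<le> n" using j l by auto
  interpret ritz J w n "\<Lambda> n" "U n" by (rule ritz[OF n])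
  have db: "0 \<le> onorm D"
    "\<And>c. norm ((\<Sum>i=1..l. c i *\<^sub>C \<iota> (u i)) - P (\<Sum>i=1..l. c i *\<^sub>C \<iota> (u i)))
      \<le> onorm D * norm (\<Sum>i=1..l. c i *\<^sub>C \<iota> (u i))"
    unfolding D_def
    by (rule defect_bounds[of "{1..l}" u lam P]; use I u_eigenspace lam_pos u_orthonormal P_clinear in blast)+
  have "norm ((\<Sum>i=1..j. c i *\<^sub>C \<phi> i) - P (\<Sum>i=1..j. c i *\<^sub>C \<phi> i)) \<le> onorm D * norm (\<Sum>i=1..j. c i *\<^sub>C \<phi> i)" for c
  proof -
    \<comment> \<open>Combinations of the first j vectors are padded with zeros, so that the
      operator norm belonging to all l vectors applies.\<close>
    have "(\<Sum>i=1..j. c i *\<^sub>C \<phi> i)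
        = (\<Sum>i=1..l. (if i \<le> j then c i * complex_of_real (lam i powr (1/2 - \<tau>)) else 0) *\<^sub>C \<iota> (u i))"
      unfolding \<phi>_sum by (rule sum.mono_neutral_cong_left) (use j in auto)
    then show ?thesis using db(2) by simp
  qed
  from ritz_value_le[OF jI db(1) this]
  have "\<Lambda> n j - lam j \<le> \<Lambda> n j * (2 * (lam j / lam 1) * (onorm D)\<^sup>2)"
    by (simp add: algebra_simps)
  \<comment> \<open>1 / lam 1 is one term of the sum, lam j \<le> lam l, and the squared norm of D'
    is nonnegative.\<close>
  also have "\<dots> \<le> \<Lambda> n l * ((onorm D')\<^sup>2 + 2 * lam l * (\<Sum>i=1..l. 1 / lam i) * (onorm D)\<^sup>2)"
  proof (rule mult_mono)
    show "\<Lambda> n j \<le> \<Lambda> n l"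
      using j l by (intro \<Lambda>_mono) auto
    show "0 \<le> \<Lambda> n l"
      using \<Lambda>_pos[of l] j l by auto
    have l1: "1 \<in> {1..l}" using j by auto
    have "lam j / lam 1 \<le> lam l / lam 1"
      using lam_mono[OF jI(1) l(1)] lam_pos[OF I[OF l1]] j by (intro divide_right_mono) auto
    also have "\<dots> = lam l * (1 / lam 1)" by simp
    also have "\<dots> \<le> lam l * (\<Sum>i=1..l. 1 / lam i)"
    proof (rule mult_left_mono)
      show "1 / lam 1 \<le> (\<Sum>i=1..l. 1 / lam i)"
        by (rule member_le_sum) (use l1 lam_pos I in \<open>auto intro: less_imp_le\<close>)
      show "0 \<le> lam l" using lam_pos[OF l(1)] by simp
    qed
    finally have "lam j / lam 1 * (onorm D)\<^sup>2 \<le> lam l * (\<Sum>i=1..l. 1 / lam i) * (onorm D)\<^sup>2"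
      by (intro mult_right_mono) auto
    then show "2 * (lam j / lam 1) * (onorm D)\<^sup>2
        \<le> (onorm D')\<^sup>2 + 2 * lam l * (\<Sum>i=1..l. 1 / lam i) * (onorm D)\<^sup>2"
      using zero_le_power2[of "onorm D'"] by (simp only: mult.assoc)
    have "0 \<le> lam j / lam 1"
      using lam_pos[OF jI(1)] lam_pos[OF I[OF l1]] by simp
    then show "0 \<le> 2 * (lam j / lam 1) * (onorm D)\<^sup>2"
      by (intro mult_nonneg_nonneg) auto
  qed
  finally show "\<Lambda> n j - lam j \<le> \<Lambda> n l * ((onorm D')\<^sup>2 + 2 * lam l * (\<Sum>i=1..l. 1 / lam i) * (onorm D)\<^sup>2)" .
qed

lemma eigenvalue_discrete: "j \<in> I \<Longrightarrow> complex_of_real (lam j) \<in> discrete_spectrum A"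
  using below_lambda_inf_discrete[OF lam_below lam_in_spectrum] .

text \<open>The list of eigenvalues may be infinite, but an eigenvalue below the essential spectrum
  has an eigenspace spanned by finitely many vectors, and a larger number of orthonormal vectors in
  it would be dependent.\<close>

lemma cluster_finite:
  assumes "j \<in> I"
  shows "finite {i \<in> I. lam i = lam j}"
proof -
  let ?C = "{i \<in> I. lam i = lam j}"
  obtain B where B: "finite B" "eigenspace A (complex_of_real (lam j)) = cspan B"
    using eigenvalue_discrete[OF assms] unfolding discrete_spectrum_def by blast
  have "card F \<le> card B" if F: "F \<subseteq> ?C" "finite F" for F
  proof (rule ccontr)
    assume less: "\<not> card F \<le> card B"
    have "\<exists>x. u i = (\<Sum>b\<in>B. x b *\<^sub>C b)" if "i \<in> F" for i
    proof -
      have "u i \<in> cspan B"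
        using u_eigenspace[of i] F(1) that B(2) by auto
      then show ?thesis
        unfolding complex_vs.span_finite[OF B(1)] by blast
    qed
    then obtain X where X: "\<And>i. i \<in> F \<Longrightarrow> u i = (\<Sum>b\<in>B. X i b *\<^sub>C b)" by metis
    obtain c where c: "\<exists>i\<in>F. c i \<noteq> 0" "\<And>b. b \<in> B \<Longrightarrow> (\<Sum>i\<in>F. X i b * c i) = 0"
      using homogeneous_system_solution[of B F "\<lambda>b i. X i b"] B(1) F(2) less by (meson not_le)
    have "(\<Sum>i\<in>F. c i *\<^sub>C u i) = (\<Sum>i\<in>F. \<Sum>b\<in>B. (X i b * c i) *\<^sub>C b)"
      by (rule sum.cong) (simp_all add: X complex_vs.scale_sum_right mult.commute)
    also have "\<dots> = (\<Sum>b\<in>B. (\<Sum>i\<in>F. X i b * c i) *\<^sub>C b)"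
      by (subst sum.swap) (simp add: complex_vs.scale_sum_left)
    also have "\<dots> = 0" using c(2) by simp
    finally have "(\<Sum>i\<in>F. c i *\<^sub>C u i) = 0" .
    moreover have "cinner (u k) (\<Sum>i\<in>F. c i *\<^sub>C u i) = c k" if "k \<in> F" for k
      by (rule orthonormal_expansion[OF F(2) that]) (rule u_orthonormal; use F(1) in auto)
    ultimately show False using c(1) by auto
  qed
  then show ?thesis
    using finite_if_finite_subsets_card_bdd[of ?C "card B"] by blast
qed

lemma ritz_vector_bounds:
  assumes l: "l \<in> I" and j: "j \<in> {1..l}" and \<kappa>: "0 < \<kappa>" "\<kappa> < 1"
  defines "z \<equiv> complex_of_real (lam j)"
  defines "\<delta> \<equiv> setdist {z} (spectrum A - {z})"
    and "D' \<equiv> \<lambda>n. defect_lower A \<tau> \<iota> (\<tau> - 1/2) \<iota>' (ritz_projection w n) (orth_proj (eigenspace A z))"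
  shows "\<forall>\<^sub>F n in sequentially.
    \<exists>v\<in>eigenspace A z. norm (\<iota>' v) = 1 \<and>
      (norm (\<iota> v - U n j))\<^sup>2 \<le> 4 * lam j * (1 + lam j / (\<kappa> * \<delta>))\<^sup>2 *
        (onorm (D' n))\<^sup>2 + \<Lambda> n j - lam j \<and>
      norm (\<iota>' v - J (U n j)) \<le> 2 * (1 + lam l / (\<kappa> * \<delta>)) *
        onorm (D' n)"
proof -
  have jI: "j \<in> I" by (rule I_initial[OF l j])
  define C where "C = {i \<in> I. lam i = lam j}"
  define m where "m = Max C"
  have C: "finite C" "j \<in> C"
    using cluster_finite[OF jI] jI by (auto simp: C_def)
  have mC: "m \<in> C" unfolding m_def using C by (intro Max_in) auto
  then have mI: "m \<in> I" and lam_m: "lam m = lam j" by (auto simp: C_def)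
  have Cm: "i \<le> m" if "i \<in> C" for i
    unfolding m_def using C that by simp
  have le_m: "i \<le> m" if "i \<in> I" "lam i \<le> lam j" for i
  proof (rule ccontr)
    assume "\<not> i \<le> m"
    then have "lam m \<le> lam i" using lam_mono[OF mI that(1)] by simp
    then have "i \<in> C" using that lam_m by (simp add: C_def)
    then show False using Cm \<open>\<not> i \<le> m\<close> by blast
  qed
  have I_m: "{1..m} \<subseteq> I" using I_initial[OF mI] by blast
  have eigenspace_z: "eigenspace A z = cspan (u ` C)"
  proof -
    have "{u i |i. i \<in> I \<and> lam i = lam j} = u ` C" by (auto simp: C_def)
    then show ?thesis unfolding z_def eigenspace_eq[OF lam_below[OF jI]] by simp
  qed
  \<comment> \<open>Min-max at the index following the cluster: an interval free of spectrum above
    \<open>lam j\<close> pushes every later Ritz value past it, for all n.\<close>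
  have above: "\<sigma> \<le> \<Lambda> n i"
    if \<sigma>: "0 < \<sigma>" "\<And>p. lam j < p \<Longrightarrow> p < \<sigma> \<Longrightarrow> complex_of_real p \<notin> spectrum A"
      and i: "m < i" "i \<le> n" for \<sigma> n i
  proof -
    have n: "1 \<le> n" using i by simp
    interpret ritz J w n "\<Lambda> n" "U n" by (rule ritz[OF n])
    have "\<sigma> \<le> \<Lambda> n (Suc m)"
    proof (rule ritz_lower[where \<phi> = \<phi>])
      show "Suc m \<in> {1..n}" using i by simp
      fix y assume y: "\<And>i. i \<in> {1..<Suc m} \<Longrightarrow> cinner (J (\<phi> i)) (J y) = 0"
      show "\<sigma> * (norm (J y))\<^sup>2 \<le> (norm y)\<^sup>2"
      proof (rule spectral_gap[OF I_m \<sigma>(1)])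
        fix p assume "p < \<sigma>" "complex_of_real p \<in> spectrum A"
        then have p: "p \<le> lam j" using \<sigma>(2)[of p] by force
        then have "ereal p \<le> ereal (lam j)" by simp
        then have "ereal p < lambda_inf A" using lam_below[OF jI] by (rule le_less_trans)
        then show "ereal p < lambda_inf A \<and> (\<forall>i\<in>I. lam i = p \<longrightarrow> i \<le> m)"
          using le_m p by auto
      qed (use y in auto)
    qed
    also have "\<dots> \<le> \<Lambda> n i"
      using i by (intro \<Lambda>_mono) auto
    finally show ?thesis .
  qed
  \<comment> \<open>\<open>setdist\<close> from the empty set is 0, a default that would destroy the
    gap. The set is nonempty: otherwise \<open>above\<close> would hold for every \<sigma>, while
    the Ritz value with index m + 1 for n = m + 1 is a fixed real number.\<close>
  have ne: "spectrum A - {z} \<noteq> {}"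
  proof
    assume empty: "spectrum A - {z} = {}"
    define \<sigma> where "\<sigma> = \<bar>\<Lambda> (Suc m) (Suc m)\<bar> + 1"
    have "\<sigma> \<le> \<Lambda> (Suc m) (Suc m)"
    proof (rule above)
      show "complex_of_real p \<notin> spectrum A" if "lam j < p" for p
        using empty that by (auto simp: z_def)
    qed (auto simp: \<sigma>_def)
    then show False by (simp add: \<sigma>_def)
  qed
  have "z isolated_in spectrum A"
    using eigenvalue_discrete[OF jI] by (simp add: discrete_spectrum_def z_def)
  then obtain V where V: "open V" "V \<inter> spectrum A = {z}"
    unfolding isolated_in_def by blast
  then obtain e where e: "e > 0" "ball z e \<subseteq> V"
    by (metis IntD1 openE singletonI)
  have "e \<le> \<delta>"
    unfolding \<delta>_def
  proof (rule le_setdistI)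
    fix x y assume xy: "x \<in> {z}" "y \<in> spectrum A - {z}"
    then have "y \<notin> V" using V(2) by blast
    then show "e \<le> dist x y" using e(2) xy by (auto simp: subset_eq not_less)
  qed (use ne in auto)
  then have \<delta>: "0 < \<delta>" using e(1) by simp
  have far: "\<delta> \<le> \<bar>lam j - p\<bar>" if "complex_of_real p \<in> spectrum A" "p \<noteq> lam j" for p
  proof -
    have "\<delta> \<le> dist z (complex_of_real p)"
      unfolding \<delta>_def by (rule setdist_le_dist) (use that in \<open>auto simp: z_def\<close>)
    also have "\<dots> = \<bar>lam j - p\<bar>"
      unfolding z_def dist_of_real by (simp add: dist_real_def)
    finally show ?thesis .
  qed
  \<comment> \<open>Ritz values up to the end of the cluster eventually exceed their eigenvalues by
    less than (1 - \<kappa>) \<delta>. For such an index outside C the eigenvalue is at most lam j -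
    \<delta>, which leaves the distance \<kappa> \<delta>.\<close>
  have "\<forall>\<^sub>F n in sequentially. \<forall>i\<in>{1..m}. \<Lambda> n i < lam i + (1 - \<kappa>) * \<delta>"
    by (intro eventually_ball_finite ballI ritz_value_eventually_less) (use I_m \<kappa> \<delta> in auto)
  then show ?thesis
    using eventually_ge_at_top[of m]
  proof eventually_elim
    case (elim n)
    have n: "1 \<le> n" using elim(2) mI by (auto simp: I_def)
    interpret ritz J w n "\<Lambda> n" "U n" by (rule ritz[OF n])
    have CI: "i \<in> I" "lam i = lam j" if "i \<in> C" for i
      using that by (auto simp: C_def)
    have Cn: "C \<subseteq> {1..n}"
    proof
      fix i assume "i \<in> C"
      then show "i \<in> {1..n}" using Cm[of i] elim(2) by (auto simp: C_def I_def)
    qed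
    have db: "0 \<le> onorm (D' n)"
      "\<And>c. norm (J ((\<Sum>i\<in>C. c i *\<^sub>C \<iota> (u i)) - P (\<Sum>i\<in>C. c i *\<^sub>C \<iota> (u i))))
        \<le> onorm (D' n) * norm (J (\<Sum>i\<in>C. c i *\<^sub>C \<iota> (u i)))"
      unfolding D'_def eigenspace_z
      by (rule defect_bounds[of C u lam P]; use C CI u_eigenspace lam_pos u_orthonormal P_clinear in blast)+
    have "\<kappa> * \<delta> \<le> \<bar>\<Lambda> n i - lam j\<bar>" if i: "i \<in> {1..n} - C" for i
    proof (cases "i \<le> m")
      case True
      then have "i \<in> {1..m}" using i by auto
      then have iI: "i \<in> I" and less: "\<Lambda> n i < lam i + (1 - \<kappa>) * \<delta>"
        using I_m elim(1) by auto
      have "lam i \<le> lam j" using lam_mono[OF iI mI True] lam_m by simp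
      moreover have "lam i \<noteq> lam j" using i iI by (auto simp: C_def)
      ultimately have "\<delta> \<le> lam j - lam i"
        using far[OF lam_in_spectrum[OF iI]] by simp
      then show ?thesis using less by (simp add: algebra_simps)
    next
      case False
      have "lam j + \<delta> \<le> \<Lambda> n i"
      proof (rule above)
        show "0 < lam j + \<delta>" using lam_pos[OF jI] \<delta> by simp
        show "complex_of_real p \<notin> spectrum A" if "lam j < p" "p < lam j + \<delta>" for p
          using far[of p] that by auto
      qed (use False i in auto)
      moreover have "\<kappa> * \<delta> \<le> 1 * \<delta>" using \<kappa> \<delta> by (intro mult_right_mono) auto
      ultimately show ?thesis by simp
    qed
    note gap = this
    have "\<exists>c x. x = (\<Sum>i\<in>C. c i *\<^sub>C \<phi> i) \<and> norm (J x) = 1 \<and>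
      norm (J x - J (U n j)) \<le> 2 * (1 + lam j / (\<kappa> * \<delta>)) * onorm (D' n) \<and>
      (norm (x - U n j))\<^sup>2 = lam j * (norm (J x - J (U n j)))\<^sup>2 + \<Lambda> n j - lam j"
    proof (rule ritz_vector[OF Cn C(2)])
      show "cinner (J (\<phi> i)) (J (\<phi> k)) = (if i = k then 1 else 0)" if "i \<in> C" "k \<in> C" for i k
        by (rule J_\<phi>_orthonormal[OF CI(1)[OF that(1)] CI(1)[OF that(2)]])
      show "cinner (\<phi> i) y = complex_of_real (lam j) * cinner (J (\<phi> i)) (J y)" if "i \<in> C" for i y
        using \<phi>_form[OF CI(1)[OF that], of y] CI(2)[OF that] by simp
      show "0 < lam j" by (rule lam_pos[OF jI])
      show "0 < \<kappa> * \<delta>" using \<kappa> \<delta> by simp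
      show "norm (J ((\<Sum>i\<in>C. c i *\<^sub>C \<phi> i) - P (\<Sum>i\<in>C. c i *\<^sub>C \<phi> i)))
          \<le> onorm (D' n) * norm (J (\<Sum>i\<in>C. c i *\<^sub>C \<phi> i))" for c
        unfolding \<phi>_sum by (rule db(2))
    qed (use gap db(1) in auto)
    then obtain c x where x: "x = (\<Sum>i\<in>C. c i *\<^sub>C \<phi> i)"
      and c: "norm (J x) = 1" "norm (J x - J (U n j)) \<le> 2 * (1 + lam j / (\<kappa> * \<delta>)) * onorm (D' n)"
      "(norm (x - U n j))\<^sup>2 = lam j * (norm (J x - J (U n j)))\<^sup>2 + \<Lambda> n j - lam j"
      by blast
    define v where "v = (\<Sum>i\<in>C. (c i * complex_of_real (lam i powr (1/2 - \<tau>))) *\<^sub>C u i)"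
    have uD: "u i \<in> Domain (op_power A \<tau>)" if "i \<in> C" for i
      using eigenspace_Domain[OF u_eigenspace[OF CI(1)[OF that]]] .
    have \<iota>v: "\<iota> v = x"
      unfolding x v_def \<phi>_sum by (rule scale_space_sum[OF \<iota> uD])
    have \<iota>'v: "\<iota>' v = J x"
      unfolding \<iota>v[symmetric] by (rule J_\<iota>[symmetric]) (unfold v_def, rule Domain_op_power_sum[OF uD])
    have v: "v \<in> eigenspace A z"
      unfolding eigenspace_z v_def
      by (intro complex_vs.span_sum complex_vs.span_scale complex_vs.span_base) auto
    have "(norm (\<iota> v - U n j))\<^sup>2 = lam j * (norm (\<iota>' v - J (U n j)))\<^sup>2 + \<Lambda> n j - lam j"
      unfolding \<iota>v \<iota>'v by (rule c(3))
    also have "lam j * (norm (\<iota>' v - J (U n j)))\<^sup>2 \<le> lam j * (2 * (1 + lam j / (\<kappa> * \<delta>)) * onorm (D' n))\<^sup>2"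
      using c(2) lam_pos[OF jI] unfolding \<iota>'v by (intro mult_left_mono power_mono) auto
    also have "\<dots> = 4 * lam j * (1 + lam j / (\<kappa> * \<delta>))\<^sup>2 * (onorm (D' n))\<^sup>2"
      unfolding power_mult_distrib by simp
    finally have 1: "(norm (\<iota> v - U n j))\<^sup>2
        \<le> 4 * lam j * (1 + lam j / (\<kappa> * \<delta>))\<^sup>2 * (onorm (D' n))\<^sup>2 + \<Lambda> n j - lam j"
      by simp
    have "norm (\<iota>' v - J (U n j)) \<le> 2 * (1 + lam j / (\<kappa> * \<delta>)) * onorm (D' n)"
      unfolding \<iota>'v by (rule c(2))
    also have "\<dots> \<le> 2 * (1 + lam l / (\<kappa> * \<delta>)) * onorm (D' n)"
      using lam_mono[OF jI l] j \<kappa> \<delta> db(1)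
      by (intro mult_right_mono mult_left_mono add_left_mono divide_right_mono) auto
    finally show ?case
      using v c(1) 1 unfolding \<iota>'v[symmetric] by blast
  qed
qed

end

theorem theorem3p1:
  fixes A :: "'h::complex_hilbert operator"
    and N :: enat and lam :: "nat \<Rightarrow> real" and u :: "nat \<Rightarrow> 'h"
    and \<tau> :: real and l :: nat
    and \<iota> :: "'h \<Rightarrow> 'k::complex_hilbert"  (* 'k is H_tau *)
    and \<iota>' :: "'h \<Rightarrow> 'm::complex_hilbert" (* 'm is H_(tau - 1/2) *)
    and w :: "nat \<Rightarrow> 'k"
    and \<Lambda> :: "nat \<Rightarrow> nat \<Rightarrow> real" and U :: "nat \<Rightarrow> nat \<Rightarrow> 'k"
  assumes "separable TYPE('h)"
    and "selfadjoint A" and "positive_definite A"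
    and "lower_eigenpairs A N lam u"
    and "1 \<le> l" and "enat l \<le> N"
    and "is_scale_space A \<tau> \<iota>" and "is_scale_space A (\<tau> - 1/2) \<iota>'"
    and "trial_vectors w" and "complete_trial_vectors w"
    and "\<And>n. 1 \<le> n \<Longrightarrow>
           ritz_pairs (T_op A \<tau> \<iota>) (inclusion A \<tau> \<iota> \<iota>') w n (\<Lambda> n) (U n)"
  shows
    "(\<forall>\<^sub>F n in sequentially. \<forall>j\<in>{1..l}.
        let D = defect A \<tau> \<iota> (ritz_projection w n) (orth_proj (cspan (u ` {1..l})));
            D' = defect_lower A \<tau> \<iota> (\<tau> - 1/2) \<iota>' (ritz_projection w n)
                   (orth_proj (cspan (u ` {1..l})))
        in 0 \<le> \<Lambda> n j - lam j \<and>
           \<Lambda> n j - lam j \<le>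
             \<Lambda> n l * ((onorm D')\<^sup>2 + 2 * lam l * (\<Sum>i=1..l. 1 / lam i) * (onorm D)\<^sup>2)) \<and>
     (\<forall>\<kappa>. 0 < \<kappa> \<and> \<kappa> < 1 \<longrightarrow>
       (\<forall>\<^sub>F n in sequentially. \<forall>j\<in>{1..l}.
          let z = complex_of_real (lam j);
              \<delta> = setdist {z} (spectrum A - {z});
              D' = defect_lower A \<tau> \<iota> (\<tau> - 1/2) \<iota>' (ritz_projection w n)
                     (orth_proj (eigenspace A z))
          in \<exists>v \<in> eigenspace A z.
               norm (\<iota>' v) = 1 \<and>
               (norm (\<iota> v - U n j))\<^sup>2 \<le>
                 4 * lam j * (1 + lam j / (\<kappa> * \<delta>))\<^sup>2 * (onorm D')\<^sup>2 + \<Lambda> n j - lam j \<and>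
               norm (\<iota>' v - inclusion A \<tau> \<iota> \<iota>' (U n j)) \<le>
                 2 * (1 + lam l / (\<kappa> * \<delta>)) * onorm D'))"
proof -
  \<comment> \<open>\<iota> maps the domain of the power onto a dense set, so the power is not the
    empty relation; its definition then yields an E.\<close>
  have "op_power A \<tau> \<noteq> {}"
    using assms(7) unfolding is_scale_space_def by (cases "\<tau> \<ge> 0") auto
  then obtain E where E: "spectral_measure_of A E"
    unfolding op_power_def by blast
  obtain \<alpha> where \<alpha>: "\<alpha> > 0" "\<And>x y. (x, y) \<in> A \<Longrightarrow> \<alpha> * (norm x)\<^sup>2 \<le> Re (cinner y x)"
    using assms(3) unfolding positive_definite_def by blast
  interpret rayleigh_ritz E A \<alpha> \<tau> \<iota> \<iota>' N lam u w \<Lambda> U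
    using E \<alpha> assms by unfold_locales (auto simp: spectral_measure_of_def)
  have l: "l \<in> I" using assms(5,6) by (simp add: I_def)
  show ?thesis
    unfolding Let_def
  proof (intro conjI allI impI)
    show "\<forall>\<^sub>F n in sequentially. \<forall>j\<in>{1..l}. 0 \<le> \<Lambda> n j - lam j \<and> \<Lambda> n j - lam j \<le> \<Lambda> n l *
        ((onorm (defect_lower A \<tau> \<iota> (\<tau> - 1/2) \<iota>' (ritz_projection w n) (orth_proj (cspan (u ` {1..l})))))\<^sup>2
        + 2 * lam l * (\<Sum>i=1..l. 1 / lam i) *
          (onorm (defect A \<tau> \<iota> (ritz_projection w n) (orth_proj (cspan (u ` {1..l})))))\<^sup>2)"
      using eventually_ge_at_top[of l] by eventually_elim (blast intro: ritz_value_bounds[OF l])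
  qed (intro eventually_ball_finite ballI ritz_vector_bounds[OF l]; simp)
qed

end
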